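(* Let $\mathcal{M}$ be a quasi-free Hilbert module of finite rank $k$ over $A(\mathbb{D})$ which is semi-Fredholm at every $\omega\in\mathbb{D}$. Assume there exists an isometric module map $U$ on $\mathcal{M}$ with $\bigcap_{j\ge0}U^j\mathcal{M}=(0)$ such that $\dim\mathcal{M}/U\mathcal{M}<\infty$. Then $\mathcal{M}$ is $A(\mathbb{D})$-module isomorphic, via a unitary module map, to $H^2_{\mathcal{E}}(\mathbb{D})$ for a Hilbert space $\mathcal{E}$ with $\dim\mathcal{E}=k$.
   Context: $\mathbb{D}$ is the open unit disk and $A(\mathbb{D})$ is the completion, in the supremum norm over $\mathbb{D}$, of the functions holomorphic on a neighborhood of the closed disk. All Hilbert spaces are complex and separable. A (contractive) Hilbert module over $A(\mathbb{D})$ is a Hilbert space $\mathcal{M}$ which is a unital $A(\mathbb{D})$-module with $\|\varphi f\|_{\mathcal{M}}\le\|\varphi\|_{A(\mathbb{D})}\|f\|_{\mathcal{M}}$. Quasi-free: for $1\le m\le\infty$, let $\ell^2_m$ be the Hilbert space of dimension $m$. A Hilbert space $\mathcal{R}$ is a quasi-free Hilbert module of rank $m$ over $A(\mathbb{D})$ if it is the completion of the algebraic tensor product $A(\mathbb{D})\otimes\ell^2_m$ in an inner product such that: (1) for each $z\in\mathbb{D}$ the evaluation map $\mathrm{eval}_{z}:A(\mathbb{D})\otimes\ell^2_m\to\ell^2_m$ is bounded, and these maps are locally uniformly bounded on $\mathbb{D}$; (2) $\|\sum\varphi\theta_i\otimes x_i\|_{\mathcal{R}}\le\|\varphi\|_{A(\mathbb{D})}\|\sum\theta_i\otimes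 x_i\|_{\mathcal{R}}$ for $\varphi,\theta_i\in A(\mathbb{D})$, $x_i\in\ell^2_m$; (3) for every sequence $\{F_i\}$ in $A(\mathbb{D})\otimes\ell^2_m$ which is Cauchy in the $\mathcal{R}$-norm, $\mathrm{eval}_{z}(F_i)\to0$ for all $z\in\mathbb{D}$ if and only if $\|F_i\|_{\mathcal{R}}\to0$. Semi-Fredholm: for $\omega\in\mathbb{D}$, let $I_{\omega}\subset\mathbb{C}[z]$ be the maximal ideal of polynomials vanishing at $\omega$; $\mathcal{M}$ is semi-Fredholm at $\omega$ if $\dim\mathcal{M}/(I_{\omega}\cdot\mathcal{M})<\infty$, where $I_\omega\cdot\mathcal{M}$ is the linear span of $\{pf:p\in I_\omega,f\in\mathcal{M}\}$. $H^2_{\mathcal{E}}(\mathbb{D})$ is the Hardy space of $\mathcal{E}$-valued functions on $\mathbb{D}$, with $A(\mathbb{D})$ acting by pointwise multiplication. *)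

theory Defs
  imports "HOL-Complex_Analysis.Complex_Analysis"
begin

section \<open>Complex inner product spaces\<close>

text \<open>
  The inner product is linear in the first argument. Norm, metric and topology are those of
  the underlying real inner product space, whose inner product is the real part of the complex
  one; hence \<open>cinner x x = (norm x)\<^sup>2\<close>. Separable complex Hilbert spaces are the types of sort
  \<open>{complex_inner, polish_space}\<close>, where \<open>polish_space\<close> contributes completeness and second
  countability.
\<close>

class complex_inner = real_inner +
  fixes scaleC :: "complex \<Rightarrow> 'a \<Rightarrow> 'a" (infixr \<open>*\<^sub>C\<close> 75)
    and cinner :: "'a \<Rightarrow> 'a \<Rightarrow> complex"
  assumes scaleC_add_right: "c *\<^sub>C (x + y) = c *\<^sub>C x + c *\<^sub>C y"
    and scaleC_add_left: "(c + d) *\<^sub>C x = c *\<^sub>C x + d *\<^sub>C x"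
    and scaleC_scaleC: "c *\<^sub>C d *\<^sub>C x = (c * d) *\<^sub>C x"
    and scaleC_of_real: "complex_of_real r *\<^sub>C x = r *\<^sub>R x"
    and cinner_commute: "cinner x y = cnj (cinner y x)"
    and cinner_add_left: "cinner (x + y) z = cinner x z + cinner y z"
    and cinner_scaleC_left: "cinner (c *\<^sub>C x) y = c * cinner x y"
    and Re_cinner: "Re (cinner x y) = inner x y"
begin

lemma scaleC_one: "1 *\<^sub>C x = x"
  using scaleC_of_real[of 1 x] scaleR_one[of x] by (metis of_real_1)

end

global_interpretation complex_vector: vector_space "scaleC :: complex \<Rightarrow> 'a \<Rightarrow> 'a::complex_inner"
  by unfold_locales
    (simp_all add: scaleC_add_right scaleC_add_left scaleC_scaleC scaleC_one)

lemma cinner_self: "cinner x x = complex_of_real ((norm x)\<^sup>2)"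
  for x :: "'a::complex_inner"
proof -
  have "Im (cinner x x) = 0"
    using arg_cong[OF cinner_commute[of x x], of Im] by simp
  then show ?thesis
    by (simp add: complex_eq_iff Re_cinner power2_norm_eq_inner)
qed

instantiation complex :: complex_inner
begin

definition scaleC_complex :: "complex \<Rightarrow> complex \<Rightarrow> complex"
  where "scaleC_complex c x = c * x"

definition cinner_complex :: "complex \<Rightarrow> complex \<Rightarrow> complex"
  where "cinner_complex x y = x * cnj y"

instance
  by standard
    (simp_all add: scaleC_complex_def cinner_complex_def algebra_simps scaleR_conv_of_real
      inner_complex_def)

end

instantiation vec :: (complex_inner, finite) complex_inner
begin

definition scaleC_vec :: "complex \<Rightarrow> ('a, 'b) vec \<Rightarrow> ('a, 'b) vec"
  where "scaleC_vec c x = (\<chi> i. c *\<^sub>C x $ i)"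

definition cinner_vec :: "('a, 'b) vec \<Rightarrow> ('a, 'b) vec \<Rightarrow> complex"
  where "cinner_vec x y = (\<Sum>i\<in>UNIV. cinner (x $ i) (y $ i))"

instance
proof
  fix x y :: "('a, 'b) vec"
  show "cinner x y = cnj (cinner y x)"
    unfolding cinner_vec_def cnj_sum by (rule sum.cong[OF refl], rule cinner_commute)
qed (simp_all add: vec_eq_iff scaleC_vec_def cinner_vec_def scaleC_add_right scaleC_add_left
      scaleC_scaleC scaleC_of_real cinner_add_left cinner_scaleC_left sum.distrib
      sum_distrib_left Re_cinner inner_vec_def)

end

text \<open>The type \<open>complex ^ 'k\<close> is the Hilbert space of dimension \<open>CARD('k)\<close>.\<close>

lemma complex_dim_vec: "complex_vector.dim (UNIV :: (complex ^ 'k) set) = CARD('k)"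
proof -
  have "(scaleC :: complex \<Rightarrow> complex ^ 'k \<Rightarrow> complex ^ 'k) = (*s)"
    by (simp add: fun_eq_iff scaleC_vec_def scaleC_complex_def vector_scalar_mult_def)
  then show ?thesis
    using vec_dim_card[where 'a = complex and 'n = 'k] by simp
qed

text \<open>The quotient of the space by \<open>S\<close> is spanned by the cosets of finitely many vectors.\<close>

definition finite_codim :: "'a::complex_inner set \<Rightarrow> bool"
  where "finite_codim S \<longleftrightarrow>
    (\<exists>B. finite B \<and> (\<forall>x. \<exists>b \<in> complex_vector.span B. x - b \<in> S))"


section \<open>The disk algebra\<close>

abbreviation unit_disk :: "complex set" (\<open>\<bbbD>\<close>)
  where "\<bbbD> \<equiv> ball 0 1"

text \<open>
  The completion in the supremum norm is realized by uniform limits on \<open>\<bbbD>\<close>. Functions on \<open>\<bbbD>\<close>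
  are total functions that vanish off \<open>\<bbbD>\<close>. Analyticity on the closed disk is holomorphy on
  an open neighbourhood of it.
\<close>

definition disk_limit :: "(complex \<Rightarrow> complex) \<Rightarrow> bool"
  where "disk_limit \<phi> \<longleftrightarrow>
    (\<exists>\<psi>. (\<forall>n::nat. \<psi> n analytic_on cball 0 1) \<and> uniform_limit \<bbbD> \<psi> \<phi> sequentially)"

definition on_disk :: "(complex \<Rightarrow> complex) \<Rightarrow> complex \<Rightarrow> complex"
  where "on_disk f z = (if z \<in> \<bbbD> then f z else 0)"

lemma disk_limit_on_disk [simp]: "disk_limit (on_disk f) \<longleftrightarrow> disk_limit f"
  unfolding disk_limit_def
  by (intro ex_cong1 conj_cong refl uniform_limit_cong') (auto simp: on_disk_def)

lemma disk_limit_analytic: "f analytic_on cball 0 1 \<Longrightarrow> disk_limit f"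
  unfolding disk_limit_def by (intro exI[of _ "\<lambda>_. f"]) (auto intro!: uniform_limitI)

lemma disk_limit_bounded:
  assumes "disk_limit \<phi>"
  shows "bounded (\<phi> ` \<bbbD>)"
proof -
  obtain \<psi> where \<psi>: "\<And>n::nat. \<psi> n analytic_on cball 0 1" and
    lim: "uniform_limit \<bbbD> \<psi> \<phi> sequentially"
    using assms by (auto simp: disk_limit_def)
  have "bounded (\<psi> n ` \<bbbD>)" for n
  proof -
    have "continuous_on (cball 0 1) (\<psi> n)"
      using \<psi> analytic_imp_holomorphic holomorphic_on_imp_continuous_on by blast
    then have "bounded (\<psi> n ` cball 0 1)"
      by (simp add: compact_continuous_image compact_imp_bounded)
    then show ?thesis
      by (rule bounded_subset) auto
  qed
  then show ?thesis
    by (intro uniform_limit_bounded[OF lim] always_eventually) auto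
qed

lemma disk_limit_add:
  assumes "disk_limit f" "disk_limit g"
  shows "disk_limit (\<lambda>z. f z + g z)"
proof -
  obtain \<psi> \<psi>' where lim: "uniform_limit \<bbbD> \<psi> f sequentially" "uniform_limit \<bbbD> \<psi>' g sequentially"
    and an: "\<And>n. \<psi> n analytic_on cball 0 1" "\<And>n. \<psi>' n analytic_on cball 0 1"
    using assms by (auto simp: disk_limit_def)
  have "\<forall>n. (\<lambda>z. \<psi> n z + \<psi>' n z) analytic_on cball 0 1"
    by (intro allI analytic_on_add an)
  moreover have "uniform_limit \<bbbD> (\<lambda>n z. \<psi> n z + \<psi>' n z) (\<lambda>z. f z + g z) sequentially"
    by (intro uniform_limit_add lim)
  ultimately show ?thesis
    unfolding disk_limit_def by (intro exI conjI)
qed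

lemma disk_limit_mult:
  assumes "disk_limit f" "disk_limit g"
  shows "disk_limit (\<lambda>z. f z * g z)"
proof -
  obtain \<psi> \<psi>' where lim: "uniform_limit \<bbbD> \<psi> f sequentially" "uniform_limit \<bbbD> \<psi>' g sequentially"
    and an: "\<And>n. \<psi> n analytic_on cball 0 1" "\<And>n. \<psi>' n analytic_on cball 0 1"
    using assms by (auto simp: disk_limit_def)
  have "\<forall>n. (\<lambda>z. \<psi> n z * \<psi>' n z) analytic_on cball 0 1"
    by (intro allI analytic_on_mult an)
  moreover have "uniform_limit \<bbbD> (\<lambda>n z. \<psi> n z * \<psi>' n z) (\<lambda>z. f z * g z) sequentially"
    by (intro uniform_lim_mult lim disk_limit_bounded assms)
  ultimately show ?thesis
    unfolding disk_limit_def by (intro exI conjI)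
qed

lemma disk_limit_poly: "disk_limit (poly p)"
proof -
  have "(\<lambda>z. \<Sum>i\<le>degree p. coeff p i * z ^ i) analytic_on cball 0 1"
    by (intro analytic_intros)
  then show ?thesis
    unfolding poly_altdef [abs_def] by (rule disk_limit_analytic)
qed

lemma disk_limit_const [simp]: "disk_limit (\<lambda>_. c)"
  by (rule disk_limit_analytic) simp

typedef disk_algebra = "{\<phi>. disk_limit \<phi> \<and> (\<forall>z. z \<notin> \<bbbD> \<longrightarrow> \<phi> z = 0)}"
  morphisms disk_fun Abs_disk_algebra
  by (rule exI[of _ "\<lambda>_. 0"]) simp

setup_lifting type_definition_disk_algebra

instantiation disk_algebra :: comm_ring_1
begin

lift_definition zero_disk_algebra :: disk_algebra is "\<lambda>_. 0"
  by simp

lift_definition one_disk_algebra :: disk_algebra is "on_disk (\<lambda>_. 1)"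
  by (simp, simp add: on_disk_def)

lift_definition plus_disk_algebra :: "disk_algebra \<Rightarrow> disk_algebra \<Rightarrow> disk_algebra"
  is "\<lambda>f g z. f z + g z"
  by (simp add: disk_limit_add)

lift_definition times_disk_algebra :: "disk_algebra \<Rightarrow> disk_algebra \<Rightarrow> disk_algebra"
  is "\<lambda>f g z. f z * g z"
  by (simp add: disk_limit_mult)

lift_definition uminus_disk_algebra :: "disk_algebra \<Rightarrow> disk_algebra"
  is "\<lambda>f z. - f z"
  using disk_limit_mult[OF disk_limit_const[of "-1"]] by simp

definition minus_disk_algebra :: "disk_algebra \<Rightarrow> disk_algebra \<Rightarrow> disk_algebra"
  where "minus_disk_algebra f g = f + - g"

instance
proof
  fix f g h :: disk_algebra
  show "f * g * h = f * (g * h)" "f + g + h = f + (g + h)" "(f + g) * h = f * h + g * h"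
    by (transfer; simp add: algebra_simps)+
  show "f * g = g * f" "f + g = g + f" "0 + f = f" "- f + f = 0"
    by (transfer; simp add: algebra_simps)+
  show "1 * f = f"
    by transfer (auto simp: on_disk_def)
  show "f - g = f + - g"
    by (rule minus_disk_algebra_def)
  show "(0 :: disk_algebra) \<noteq> 1"
    by transfer (simp add: fun_eq_iff on_disk_def exI[of _ 0])
qed

end

lift_definition disk_poly :: "complex poly \<Rightarrow> disk_algebra" is "\<lambda>p. on_disk (poly p)"
  by (simp add: disk_limit_poly, simp add: on_disk_def)

definition disk_norm :: "disk_algebra \<Rightarrow> real"
  where "disk_norm \<phi> = (SUP z\<in>\<bbbD>. norm (disk_fun \<phi> z))"

lemma norm_le_disk_norm: "norm (disk_fun \<phi> z) \<le> disk_norm \<phi>" if "z \<in> \<bbbD>"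
proof -
  have "bounded (disk_fun \<phi> ` \<bbbD>)"
    using disk_fun[of \<phi>] disk_limit_bounded by blast
  then have "bdd_above ((\<lambda>z. norm (disk_fun \<phi> z)) ` \<bbbD>)"
    by (auto simp: bounded_iff intro: bdd_aboveI2)
  then show ?thesis
    unfolding disk_norm_def using that by (rule cSUP_upper[rotated])
qed


section \<open>Hilbert modules over the disk algebra\<close>

locale hilbert_module = module act
  for act :: "disk_algebra \<Rightarrow> 'm::{complex_inner, polish_space} \<Rightarrow> 'm" +
  assumes act_const: "act (disk_poly [:c:]) x = c *\<^sub>C x"
    and norm_act_le: "norm (act \<phi> x) \<le> disk_norm \<phi> * norm x"

text \<open>
  The algebraic tensor product of the disk algebra with \<open>'e\<close>, whose elements
  \<open>\<Sum>i. \<theta> i \<otimes> x i\<close> are represented by the functions \<open>z \<mapsto> \<Sum>i. \<theta> i z *\<^sub>C x i\<close>. This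
  representation is faithful, and evaluation at \<open>z\<close> becomes application to \<open>z\<close>.
\<close>

definition disk_tensor :: "(complex \<Rightarrow> 'e::complex_inner) set"
  where "disk_tensor = {F. \<exists>(n::nat) \<theta> x. F = (\<lambda>z. \<Sum>i<n. disk_fun (\<theta> i) z *\<^sub>C x i)}"

text \<open>
  The inner product on the tensor product is the one pulled back along the injective linear
  map \<open>\<iota>\<close>, and density of the range says that the module is its completion.
\<close>

locale quasi_free_embedding = hilbert_module act
  for act :: "disk_algebra \<Rightarrow> 'm::{complex_inner, polish_space} \<Rightarrow> 'm"
    and \<iota> :: "(complex \<Rightarrow> 'e::{complex_inner, polish_space}) \<Rightarrow> 'm" +
  assumes \<iota>_add: "\<lbrakk>F \<in> disk_tensor; G \<in> disk_tensor\<rbrakk> \<Longrightarrow> \<iota> (\<lambda>z. F z + G z) = \<iota> F + \<iota> G"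
    and \<iota>_scaleC: "F \<in> disk_tensor \<Longrightarrow> \<iota> (\<lambda>z. c *\<^sub>C F z) = c *\<^sub>C \<iota> F"
    and \<iota>_inj: "inj_on \<iota> disk_tensor"
    and \<iota>_dense: "closure (\<iota> ` disk_tensor) = UNIV"
    and \<iota>_act: "F \<in> disk_tensor \<Longrightarrow> \<iota> (\<lambda>z. disk_fun \<phi> z *\<^sub>C F z) = act \<phi> (\<iota> F)"
    and eval_bounded: "z \<in> \<bbbD> \<Longrightarrow> \<exists>C. \<forall>F\<in>disk_tensor. norm (F z) \<le> C * norm (\<iota> F)"
    and eval_locally_uniformly_bounded: "w \<in> \<bbbD> \<Longrightarrow>
      \<exists>\<delta>>0. \<exists>C. \<forall>z\<in>\<bbbD> \<inter> ball w \<delta>. \<forall>F\<in>disk_tensor. norm (F z) \<le> C * norm (\<iota> F)"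
    and norm_mult_le: "F \<in> disk_tensor \<Longrightarrow>
      norm (\<iota> (\<lambda>z. disk_fun \<phi> z *\<^sub>C F z)) \<le> disk_norm \<phi> * norm (\<iota> F)"
    and cauchy_eval_iff:
      "\<And>Fs :: nat \<Rightarrow> complex \<Rightarrow> 'e. \<lbrakk>\<And>i. Fs i \<in> disk_tensor; Cauchy (\<lambda>i. \<iota> (Fs i))\<rbrakk> \<Longrightarrow>
        (\<forall>z\<in>\<bbbD>. (\<lambda>i. Fs i z) \<longlonglongrightarrow> 0) \<longleftrightarrow> (\<lambda>i. norm (\<iota> (Fs i))) \<longlonglongrightarrow> 0"

text \<open>The coefficient space is passed as a type; the rank is its Hilbert space dimension.\<close>

definition quasi_free ::
    "(disk_algebra \<Rightarrow> 'm \<Rightarrow> 'm::{complex_inner, polish_space}) \<Rightarrow>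
     'e::{complex_inner, polish_space} itself \<Rightarrow> bool"
  where "quasi_free act _ \<longleftrightarrow>
    (\<exists>\<iota> :: (complex \<Rightarrow> 'e) \<Rightarrow> 'm. quasi_free_embedding act \<iota>)"

definition ideal_product ::
    "(disk_algebra \<Rightarrow> 'm \<Rightarrow> 'm::complex_inner) \<Rightarrow> complex \<Rightarrow> 'm set"
  where "ideal_product act \<omega> =
    complex_vector.span {act (disk_poly p) f | p f. poly p \<omega> = 0}"

definition semi_fredholm_at ::
    "(disk_algebra \<Rightarrow> 'm \<Rightarrow> 'm::complex_inner) \<Rightarrow> complex \<Rightarrow> bool"
  where "semi_fredholm_at act \<omega> \<longleftrightarrow> finite_codim (ideal_product act \<omega>)"

definition isometric_module_map ::
    "(disk_algebra \<Rightarrow> 'm \<Rightarrow> 'm::complex_inner) \<Rightarrow> ('m \<Rightarrow> 'm) \<Rightarrow> bool"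
  where "isometric_module_map act U \<longleftrightarrow>
    module_hom act act U \<and> (\<forall>x. norm (U x) = norm x)"


section \<open>Vector-valued Hardy space\<close>

definition has_taylor_coeffs ::
    "(complex \<Rightarrow> 'e::complex_inner) \<Rightarrow> (nat \<Rightarrow> 'e) \<Rightarrow> bool"
  where "has_taylor_coeffs f a \<longleftrightarrow> (\<forall>z\<in>\<bbbD>. (\<lambda>n. z ^ n *\<^sub>C a n) sums f z)"

definition taylor_coeff :: "(complex \<Rightarrow> 'e::complex_inner) \<Rightarrow> nat \<Rightarrow> 'e"
  where "taylor_coeff f = (THE a. has_taylor_coeffs f a)"

text \<open>As for the disk algebra, functions on \<open>\<bbbD>\<close> vanish off \<open>\<bbbD>\<close>.\<close>

definition hardy_space :: "(complex \<Rightarrow> 'e::complex_inner) set"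
  where "hardy_space = {f. (\<forall>z. z \<notin> \<bbbD> \<longrightarrow> f z = 0) \<and>
    (\<exists>a. has_taylor_coeffs f a \<and> summable (\<lambda>n. (norm (a n))\<^sup>2))}"

definition hardy_cinner ::
    "(complex \<Rightarrow> 'e::complex_inner) \<Rightarrow> (complex \<Rightarrow> 'e) \<Rightarrow> complex"
  where "hardy_cinner f g = (\<Sum>n. cinner (taylor_coeff f n) (taylor_coeff g n))"

lemma taylor_coeff_eq:
  fixes f :: "complex \<Rightarrow> 'e::complex_inner"
  assumes "has_taylor_coeffs f a"
  shows "taylor_coeff f = a"
  unfolding taylor_coeff_def
proof (rule the_equality[where P = "has_taylor_coeffs f", OF assms])
  fix b
  assume b: "has_taylor_coeffs f b"
  have bl: "bounded_linear (\<lambda>x. cinner x e)" for e :: 'e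
  proof (rule bounded_linear_intro[where K = "2 * norm e"])
    fix x :: 'e
    have "Im (cinner x e) = - Re (cinner (\<i> *\<^sub>C x) e)"
      by (simp add: cinner_scaleC_left)
    then have "\<bar>Im (cinner x e)\<bar> \<le> norm (\<i> *\<^sub>C x) * norm e"
      by (simp add: Re_cinner Cauchy_Schwarz_ineq2)
    also have "norm (\<i> *\<^sub>C x) = norm x"
    proof -
      have "cinner (\<i> *\<^sub>C x) (\<i> *\<^sub>C x) = cinner x x"
        using cinner_commute[of x "\<i> *\<^sub>C x"] cinner_commute[of x x]
        by (simp add: cinner_scaleC_left)
      then have "(norm (\<i> *\<^sub>C x))\<^sup>2 = (norm x)\<^sup>2"
        unfolding cinner_self of_real_eq_iff .
      then show ?thesis
        by simp
    qed
    finally have "\<bar>Im (cinner x e)\<bar> \<le> norm x * norm e" .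
    moreover have "\<bar>Re (cinner x e)\<bar> \<le> norm x * norm e"
      by (simp add: Re_cinner Cauchy_Schwarz_ineq2)
    ultimately show "norm (cinner x e) \<le> norm x * (2 * norm e)"
      using cmod_le[of "cinner x e"] by linarith
  qed (simp_all add: cinner_add_left cinner_scaleC_left scaleR_conv_of_real flip: scaleC_of_real)
  have "cinner (b n) e = cinner (a n) e" for n and e :: 'e
  proof -
    have s: "(\<lambda>n. cinner (c n) e * z ^ n) sums cinner (f z) e"
      if "has_taylor_coeffs f c" "z \<in> \<bbbD>" for c z
      using bounded_linear.sums[OF bl[of e]] that
      unfolding has_taylor_coeffs_def by (fastforce simp: cinner_scaleC_left mult.commute)
    let ?c = "\<lambda>n. cinner (b n) e - cinner (a n) e"
    have d: "(\<lambda>n. ?c n * z ^ n) sums 0" if "norm z < 1" for z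
      using sums_diff[OF s[OF b, of z] s[OF assms, of z]] that by (simp add: left_diff_distrib)
    have "?c n = 0"
    proof (cases "n = 0")
      case True
      then show ?thesis
        using d[of 0] by (simp only: powser_sums_zero_iff) simp
    next
      case False
      show ?thesis
      proof (rule ccontr)
        assume "?c n \<noteq> 0"
        show False
        proof (rule powser_0_nonzero[of 1 0 ?c "\<lambda>_. 0" n])
          fix r :: real
          assume "0 < r" and r: "\<And>z :: complex. z \<in> cball 0 r - {0} \<Longrightarrow> (0 :: complex) \<noteq> 0"
          show False
            using r[of "of_real r"] \<open>0 < r\<close> by simp
        qed (use d False \<open>?c n \<noteq> 0\<close> in simp_all)
      qed
    qed
    then show ?thesis
      by simp
  qed
  then have "cinner (b n - a n) (b n - a n) = 0" for n
    by (metis add_cancel_left_left cinner_add_left diff_add_cancel)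
  then show "b = a"
    by (auto simp: fun_eq_iff cinner_self)
qed

text \<open>
  Unitary module maps onto the Hardy space, on which the disk algebra acts by pointwise
  multiplication. Complex linearity is additivity together with compatibility with constants.
\<close>

definition unitary_module_map_hardy ::
    "(disk_algebra \<Rightarrow> 'm \<Rightarrow> 'm::complex_inner) \<Rightarrow>
     ('m \<Rightarrow> complex \<Rightarrow> 'e::complex_inner) \<Rightarrow> bool"
  where "unitary_module_map_hardy act V \<longleftrightarrow>
    bij_betw V UNIV hardy_space \<and>
    (\<forall>x y. V (x + y) = (\<lambda>z. V x z + V y z)) \<and>
    (\<forall>\<phi> x. V (act \<phi> x) = (\<lambda>z. disk_fun \<phi> z *\<^sub>C V x z)) \<and>
    (\<forall>x y. hardy_cinner (V x) (V y) = cinner x y)"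

end

theory Submission
  imports Defs "HOL-Computational_Algebra.Fundamental_Theorem_Algebra"
begin

text \<open>
  Let \<open>Z\<close> be multiplication by the coordinate function. The point is that \<open>Z\<close> is an isometry.
  Let \<open>E \<zeta>\<close> be the eigenspace of the adjoint of \<open>U\<close> for \<open>cnj \<zeta>\<close>; it has bounded dimension and is
  invariant under the adjoint of \<open>Z\<close>. Unit vectors of \<open>E \<zeta>\<close> tend to \<open>0\<close> weakly as
  \<open>\<bar>\<zeta>\<bar>\<close> tends to \<open>1\<close>, whereas \<open>Z - \<omega>\<close> is onto up to finite dimension; by a Baire category
  argument the eigenvalues of the adjoint of \<open>Z\<close> on \<open>E \<zeta>\<close> therefore leave every compact subset
  of the disk. A contraction in bounded dimension with almost unimodular eigenvalues is almost
  isometric, so the defect of \<open>Z\<close> on \<open>E \<zeta>\<close> tends to \<open>0\<close>. Along kernel vectors this defect is a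
  harmonic function of \<open>\<zeta>\<close>, and the maximum principle makes it vanish at \<open>\<zeta> = 0\<close>, that is, on the
  complement of the range of \<open>U\<close>; translation by \<open>U\<close> does the rest.

  Evaluations show that the isometry \<open>Z\<close> is pure and that the complement of its range is
  isomorphic to the fibre over \<open>0\<close>, so the Wold decomposition of \<open>Z\<close> is the desired unitary map.
\<close>

section \<open>Complex inner product spaces\<close>

text \<open>In the Wold model of \<open>U\<close>, \<open>Z\<close> is multiplication by a bounded
  analytic matrix function on the disk, \<open>Zs\<close> acts on \<open>E \<zeta>\<close> as the
  adjoint of its value at \<zeta>, and the claim is that this function has isometric boundary
  values. The proof never forms boundary values: its estimates hold at interior points, uniformly
  near the circle, and the maximum principle transports them to 0. Two obstacles shape it. Being
  semi-Fredholm is an algebraic condition: it gives solvability, but neither a bound on the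
  solutions nor a closed range. Baire category supplies approximate solutions with a bound, which is
  enough against vectors that tend weakly to 0. Moreover, eigenvalues alone do not make a non-normal
  matrix almost isometric; for contractions they do, with a loss depending only on the dimension,
  and the codimension of the range of \<open>U\<close> bounds the dimension of all
  \<open>E \<zeta>\<close> at once. The rank enters only at the end, through the fibre over
  0.\<close>

lemma cinner_add_right: "cinner x (y + z) = cinner x y + cinner x z"
  for x y z :: "'a::complex_inner"
  by (metis cinner_add_left cinner_commute complex_cnj_add)

lemma cinner_scaleC_right: "cinner x (c *\<^sub>C y) = cnj c * cinner x y"
  for x y :: "'a::complex_inner"
  by (metis cinner_commute cinner_scaleC_left complex_cnj_mult)

lemma norm_scaleC: "norm (c *\<^sub>C x) = cmod c * norm x"
  for x :: "'a::complex_inner"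
proof -
  have "complex_of_real ((norm (c *\<^sub>C x))\<^sup>2) = c * (cnj c * cinner x x)"
    by (simp only: cinner_self[symmetric] cinner_scaleC_left cinner_scaleC_right
        mult.left_commute)
  also have "\<dots> = complex_of_real ((cmod c * norm x)\<^sup>2)"
    unfolding cinner_self power_mult_distrib of_real_mult
    by (simp add: complex_norm_square del: of_real_power)
  finally have "(norm (c *\<^sub>C x))\<^sup>2 = (cmod c * norm x)\<^sup>2"
    unfolding of_real_eq_iff .
  then show ?thesis
    by simp
qed

lemma norm_cinner_le: "cmod (cinner x y) \<le> norm x * norm y"
  for x y :: "'a::complex_inner"
proof (cases "cinner x y = 0")
  case False
  \<comment> \<open>This unimodular factor turns the inner product into its modulus, so the real
    Cauchy-Schwarz inequality applies without losing a constant.\<close>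
  define c where "c = cnj (sgn (cinner x y))"
  have c: "cmod c = 1"
    using False by (simp add: c_def norm_sgn)
  have "c * cinner x y = cmod (cinner x y)"
    using False complex_norm_square[of "cinner x y"]
    by (simp add: c_def sgn_eq power2_eq_square field_simps)
  then have "cmod (cinner x y) = Re (cinner (c *\<^sub>C x) y)"
    by (simp add: cinner_scaleC_left)
  also have "\<dots> \<le> norm (c *\<^sub>C x) * norm y"
    unfolding Re_cinner by (rule norm_cauchy_schwarz)
  finally show ?thesis
    by (simp add: norm_scaleC c)
qed simp

lemma bounded_bilinear_cinner: "bounded_bilinear (cinner :: 'a::complex_inner \<Rightarrow> 'a \<Rightarrow> complex)"
proof (rule bounded_bilinear.intro)
  show "\<exists>K. \<forall>a b :: 'a. norm (cinner a b) \<le> norm a * norm b * K"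
    by (intro exI[of _ 1]) (simp add: norm_cinner_le)
qed (simp_all add: cinner_add_left cinner_add_right cinner_scaleC_left cinner_scaleC_right
    scaleR_conv_of_real flip: scaleC_of_real)

lemma bounded_bilinear_scaleC: "bounded_bilinear (scaleC :: complex \<Rightarrow> 'a::complex_inner \<Rightarrow> 'a)"
proof (rule bounded_bilinear.intro)
  show "\<exists>K. \<forall>a (b :: 'a). norm (a *\<^sub>C b) \<le> norm a * norm b * K"
    by (intro exI[of _ 1]) (simp add: norm_scaleC)
qed (simp_all add: scaleC_add_left scaleC_add_right scaleC_scaleC scaleR_conv_of_real mult.commute
    flip: scaleC_of_real)

interpretation cinner: bounded_bilinear "cinner :: 'a::complex_inner \<Rightarrow> 'a \<Rightarrow> complex"
  by (rule bounded_bilinear_cinner)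

interpretation scaleC: bounded_bilinear "scaleC :: complex \<Rightarrow> 'a::complex_inner \<Rightarrow> 'a"
  by (rule bounded_bilinear_scaleC)

lemmas cinner_simps = cinner.add_left cinner.add_right cinner.diff_left cinner.diff_right
  cinner.minus_left cinner.minus_right cinner_scaleC_left cinner_scaleC_right

lemma cinner_eq_0_commute: "cinner x y = 0 \<longleftrightarrow> cinner y x = 0"
  for x y :: "'a::complex_inner"
  using cinner_commute[of x y] by auto

lemma norm_sq_cinner: "(norm x)\<^sup>2 = Re (cinner x x)" for x :: "'a::complex_inner"
  by (simp add: cinner_self)

lemma cinner_self_eq_0 [simp]: "cinner x x = 0 \<longleftrightarrow> x = 0" for x :: "'a::complex_inner"
  by (simp add: cinner_self)

lemma cinner_eqI: "(\<And>z. cinner z x = cinner z y) \<Longrightarrow> x = y" for x y :: "'a::complex_inner"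
  using cinner_self_eq_0[of "x - y"] by (simp add: cinner_simps)

lemma norm_sq_add: "(norm (x + y))\<^sup>2 = (norm x)\<^sup>2 + (norm y)\<^sup>2 + 2 * Re (cinner x y)"
  for x y :: "'a::complex_inner"
  using cinner_commute[of y x] by (simp add: norm_sq_cinner cinner_simps)

lemma norm_sq_add_orthogonal: "cinner x y = 0 \<Longrightarrow> (norm (x + y))\<^sup>2 = (norm x)\<^sup>2 + (norm y)\<^sup>2"
  for x y :: "'a::complex_inner"
  by (simp add: norm_sq_add)

section \<open>Complex-linear maps, orthogonal projection and adjoints\<close>

abbreviation clinear :: "('a::complex_inner \<Rightarrow> 'b::complex_inner) \<Rightarrow> bool"
  where "clinear \<equiv> Vector_Spaces.linear scaleC scaleC"

lemma clinearI:
  "(\<And>x y. f (x + y) = f x + f y) \<Longrightarrow> (\<And>c x. f (c *\<^sub>C x) = c *\<^sub>C f x) \<Longrightarrow> clinear f"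
  for f :: "'a::complex_inner \<Rightarrow> 'b::complex_inner"
  by unfold_locales (simp_all add: scaleC_add_right scaleC_add_left scaleC_scaleC scaleC_one)

lemma clinear_module_hom: "clinear f \<Longrightarrow> module_hom scaleC scaleC f"
  by (simp add: Vector_Spaces.linear_def)

lemma clinear_add: "clinear f \<Longrightarrow> f (x + y) = f x + f y"
  by (rule module_hom.add[OF clinear_module_hom])

lemma clinear_scaleC: "clinear f \<Longrightarrow> f (c *\<^sub>C x) = c *\<^sub>C f x"
  by (rule module_hom.scale[OF clinear_module_hom])

lemma clinear_0: "clinear f \<Longrightarrow> f 0 = 0"
  by (rule module_hom.zero[OF clinear_module_hom])

lemma clinear_diff: "clinear f \<Longrightarrow> f (x - y) = f x - f y"
  by (rule module_hom.diff[OF clinear_module_hom])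

lemma clinear_sum: "clinear f \<Longrightarrow> f (sum g S) = (\<Sum>a\<in>S. f (g a))"
  by (rule module_hom.sum[OF clinear_module_hom])

lemma clinear_bounded_linear:
  assumes "clinear f" and "\<And>x. norm (f x) \<le> C * norm x"
  shows "bounded_linear f"
proof (rule bounded_linear_intro[where K = C])
  show "f (r *\<^sub>R x) = r *\<^sub>R f x" for r x
    using clinear_scaleC[OF assms(1), of "of_real r" x] by (simp add: scaleC_of_real)
qed (use assms in \<open>auto simp: clinear_add mult.commute\<close>)

text \<open>Parallelogram law: a sequence in \<open>G\<close> minimizing the distance to \<open>x\<close> is Cauchy.\<close>

lemma orthogonal_projection_exists:
  fixes G :: "'m::{complex_inner, complete_space} set"
  assumes sub: "complex_vector.subspace G" and cl: "closed G"
  obtains p where "p \<in> G" "\<And>g. g \<in> G \<Longrightarrow> cinner (x - p) g = 0"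
proof -
  define \<delta> where "\<delta> = infdist x G"
  have ne: "G \<noteq> {}"
    using complex_vector.subspace_0[OF sub] by auto
  have add: "a + b \<in> G" and sc: "c *\<^sub>C a \<in> G" and diff: "a - b \<in> G"
    if "a \<in> G" "b \<in> G" for a b c
    using sub that
    by (auto intro: complex_vector.subspace_add complex_vector.subspace_scale
        complex_vector.subspace_diff)
  have scR: "r *\<^sub>R a \<in> G" if "a \<in> G" for a r
    using sc[OF that that, of "of_real r"] by (simp add: scaleC_of_real)
  have low: "\<delta> \<le> norm (x - g)" if "g \<in> G" for g
    using infdist_le[OF that, of x] by (simp add: \<delta>_def dist_norm)
  have \<delta>0: "0 \<le> \<delta>"
    by (simp add: \<delta>_def infdist_nonneg)
  have "\<exists>g\<in>G. norm (x - g) < \<delta> + inverse (real (Suc n))" for n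
  proof (rule ccontr)
    assume "\<not> ?thesis"
    then have "\<delta> + inverse (real (Suc n)) \<le> infdist x G"
      unfolding infdist_notempty[OF ne]
      by (intro cINF_greatest ne) (auto simp: dist_norm not_less)
    then show False
      by (simp add: \<delta>_def)
  qed
  then obtain g where g: "\<And>n. g n \<in> G" "\<And>n. norm (x - g n) < \<delta> + inverse (real (Suc n))"
    by metis
  have lim: "(\<lambda>n. norm (x - g n)) \<longlonglongrightarrow> \<delta>"
  proof (rule tendsto_sandwich)
    show "\<forall>\<^sub>F n in sequentially. \<delta> \<le> norm (x - g n)"
      "\<forall>\<^sub>F n in sequentially. norm (x - g n) \<le> \<delta> + inverse (real (Suc n))"
      using low g less_imp_le by (blast intro: always_eventually)+
    show "(\<lambda>n. \<delta> + inverse (real (Suc n))) \<longlonglongrightarrow> \<delta>"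
      by (rule LIMSEQ_inverse_real_of_nat_add)
  qed simp
  \<comment> \<open>The midpoint of two members of \<open>G\<close> is in \<open>G\<close> and so
    has distance at least \<delta> from \<open>x\<close>; this is what turns the law into a Cauchy
    estimate.\<close>
  have par: "(norm (g n - g m))\<^sup>2 \<le> 2 * (norm (x - g n))\<^sup>2 + 2 * (norm (x - g m))\<^sup>2 - 4 * \<delta>\<^sup>2" for n m
  proof -
    have "\<delta> \<le> norm (x - (1/2) *\<^sub>R (g n + g m))"
      by (intro low scR add g)
    also have "\<dots> = norm ((1/2) *\<^sub>R ((x - g n) + (x - g m)))"
      by (rule arg_cong[where f = norm])
         (simp add: algebra_simps flip: scaleR_add_left)
    finally have "2 * \<delta> \<le> norm ((x - g n) + (x - g m))"
      by simp
    then have "(2 * \<delta>)\<^sup>2 \<le> (norm ((x - g n) + (x - g m)))\<^sup>2"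
      using \<delta>0 by (intro power_mono) auto
    moreover have "(norm ((x - g n) + (x - g m)))\<^sup>2 + (norm ((x - g m) - (x - g n)))\<^sup>2 =
        2 * (norm (x - g n))\<^sup>2 + 2 * (norm (x - g m))\<^sup>2"
      by (simp add: power2_norm_eq_inner inner_add_left inner_add_right inner_diff_left
          inner_diff_right inner_commute)
    ultimately show ?thesis
      by (simp add: power_mult_distrib)
  qed
  have "Cauchy g"
  proof (rule metric_CauchyI)
    fix e :: real
    assume e: "0 < e"
    have "(\<lambda>n. (norm (x - g n))\<^sup>2 - \<delta>\<^sup>2) \<longlonglongrightarrow> \<delta>\<^sup>2 - \<delta>\<^sup>2"
      by (intro tendsto_intros lim)
    then have "\<forall>\<^sub>F n in sequentially. (norm (x - g n))\<^sup>2 - \<delta>\<^sup>2 < e\<^sup>2 / 4"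
      using e by (intro order_tendstoD(2)[where y = "\<delta>\<^sup>2 - \<delta>\<^sup>2"]) auto
    then obtain N where N: "\<And>n. n \<ge> N \<Longrightarrow> (norm (x - g n))\<^sup>2 - \<delta>\<^sup>2 < e\<^sup>2 / 4"
      by (auto simp: eventually_sequentially)
    show "\<exists>M. \<forall>m\<ge>M. \<forall>n\<ge>M. dist (g m) (g n) < e"
    proof (intro exI allI impI)
      fix m n
      assume "N \<le> m" "N \<le> n"
      then have "(norm (g m - g n))\<^sup>2 < e\<^sup>2"
        using par[of m n] N[of m] N[of n] by linarith
      then show "dist (g m) (g n) < e"
        using e by (simp add: dist_norm power_less_imp_less_base)
    qed
  qed
  then obtain p where p: "g \<longlonglongrightarrow> p"
    using Cauchy_convergent convergent_def by blast
  have pG: "p \<in> G"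
    using cl p g(1) by (meson closed_sequentially)
  have "(\<lambda>n. norm (x - g n)) \<longlonglongrightarrow> norm (x - p)"
    by (intro tendsto_intros p)
  then have np: "norm (x - p) = \<delta>"
    using lim LIMSEQ_unique by blast
  have orth: "inner (x - p) h = 0" if h: "h \<in> G" for h
  proof (rule ccontr)
    assume nz: "inner (x - p) h \<noteq> 0"
    then have h0: "0 < (norm h)\<^sup>2"
      by auto
    \<comment> \<open>The step along \<open>h\<close> that minimizes the distance to
      \<open>x\<close>; unless the inner product vanishes, it would lead below \<delta>.\<close>
    define t where "t = inner (x - p) h / (norm h)\<^sup>2"
    have "\<delta> \<le> norm (x - (p + t *\<^sub>R h))"
      by (intro low add pG scR h)
    then have "\<delta>\<^sup>2 \<le> (norm (x - (p + t *\<^sub>R h)))\<^sup>2"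
      using \<delta>0 by (intro power_mono)
    also have "\<dots> = (norm (x - p))\<^sup>2 - 2 * t * inner (x - p) h + t\<^sup>2 * (norm h)\<^sup>2"
      unfolding power2_norm_eq_inner
      by (simp add: inner_add_left inner_add_right inner_diff_left inner_diff_right inner_commute
          power2_eq_square algebra_simps)
    also have "\<dots> = \<delta>\<^sup>2 - (inner (x - p) h)\<^sup>2 / (norm h)\<^sup>2"
      using h0 by (simp add: np t_def power2_eq_square field_simps)
    finally have "(inner (x - p) h)\<^sup>2 / (norm h)\<^sup>2 \<le> 0"
      by simp
    then show False
      using nz h0 by (simp add: divide_le_0_iff)
  qed
  show ?thesis
  proof (rule that[OF pG])
    fix h
    assume h: "h \<in> G"
    have "Im (cinner (x - p) h) = Re (cinner (x - p) (\<i> *\<^sub>C h))"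
      by (simp add: cinner_scaleC_right)
    also have "\<dots> = 0"
      unfolding Re_cinner by (intro orth sc[OF h h])
    finally show "cinner (x - p) h = 0"
      using orth[OF h] by (simp add: complex_eq_iff Re_cinner)
  qed
qed

text \<open>Modulo its kernel a nonzero functional is one-dimensional. For \<open>u\<close>
  orthogonal to the kernel, \<open>f x *\<^sub>C u - f u *\<^sub>C x\<close> lies in the kernel, and
  its orthogonality to \<open>u\<close> is already the formula.\<close>

lemma riesz_representation:
  fixes f :: "'m::{complex_inner, complete_space} \<Rightarrow> complex"
  assumes f: "clinear f" and bd: "\<And>x. cmod (f x) \<le> C * norm x"
  obtains y where "\<And>x. f x = cinner x y"
proof (cases "\<forall>x. f x = 0")
  case True
  then show ?thesis
    by (intro that[of 0]) (simp add: cinner.zero_right)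
next
  case False
  then obtain x0 where x0: "f x0 \<noteq> 0"
    by auto
  define G where "G = {x. f x = 0}"
  have "complex_vector.subspace G"
    by (auto simp: G_def complex_vector.subspace_def clinear_0[OF f] clinear_add[OF f]
        clinear_scaleC[OF f])
  moreover have "closed G"
    unfolding G_def
    using clinear_bounded_linear[OF f bd]
    by (intro closed_Collect_eq continuous_on_const linear_continuous_on)
  ultimately obtain p where p: "p \<in> G" "\<And>g. g \<in> G \<Longrightarrow> cinner (x0 - p) g = 0"
    using orthogonal_projection_exists[of G x0] by metis
  define u where "u = x0 - p"
  have fu: "f u \<noteq> 0"
    using x0 p(1) by (simp add: u_def clinear_diff[OF f] G_def)
  then have u0: "cinner u u \<noteq> 0"
    using clinear_0[OF f] by auto
  show ?thesis
  proof (rule that[of "cnj (f u / cinner u u) *\<^sub>C u"])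
    fix x
    have "f x *\<^sub>C u - f u *\<^sub>C x \<in> G"
      by (simp add: G_def clinear_diff[OF f] clinear_scaleC[OF f] scaleC_complex_def)
    then have "cinner (f x *\<^sub>C u - f u *\<^sub>C x) u = 0"
      using p(2) cinner_eq_0_commute unfolding u_def by blast
    then have "f x * cinner u u = f u * cinner x u"
      by (simp add: cinner_simps)
    then have "f x = f u / cinner u u * cinner x u"
      using u0 by (simp add: divide_simps)
    then show "f x = cinner x (cnj (f u / cinner u u) *\<^sub>C u)"
      by (simp only: cinner_scaleC_right complex_cnj_cnj)
  qed
qed

lemma adjoint_exists:
  fixes T :: "'m::{complex_inner, complete_space} \<Rightarrow> 'm"
  assumes T: "clinear T" and bd: "\<And>x. norm (T x) \<le> norm x"
  obtains S where "clinear S" "\<And>x. norm (S x) \<le> norm x" "\<And>x y. cinner (T x) y = cinner x (S y)"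
proof -
  have "\<exists>s. \<forall>x. cinner (T x) y = cinner x s" for y
  proof -
    have "clinear (\<lambda>x. cinner (T x) y)"
      by (rule clinearI)
         (simp_all add: clinear_add[OF T] clinear_scaleC[OF T] cinner_simps scaleC_complex_def)
    moreover have "cmod (cinner (T x) y) \<le> norm y * norm x" for x
      using norm_cinner_le[of "T x" y] mult_right_mono[OF bd[of x], of "norm y"]
      by (simp add: mult.commute)
    ultimately show ?thesis
      using riesz_representation[of "\<lambda>x. cinner (T x) y" "norm y"] by metis
  qed
  then obtain S where S: "\<And>x y. cinner (T x) y = cinner x (S y)"
    by metis
  have "clinear S"
    by (rule clinearI; rule cinner_eqI) (simp_all add: cinner_simps flip: S)
  moreover have "norm (S y) \<le> norm y" for y
  proof (cases "S y = 0")
    case False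
    have "(norm (S y))\<^sup>2 = Re (cinner (T (S y)) y)"
      by (simp add: S norm_sq_cinner)
    also have "\<dots> \<le> norm (T (S y)) * norm y"
      by (meson complex_Re_le_cmod norm_cinner_le order_trans)
    also have "\<dots> \<le> norm (S y) * norm y"
      by (simp add: bd mult_right_mono)
    finally show ?thesis
      using False by (simp add: power2_eq_square)
  qed simp
  ultimately show ?thesis
    using S that by blast
qed

section \<open>Contractions on finite-dimensional subspaces\<close>

text \<open>More than \<open>card S\<close> iterates of \<open>x\<close> cannot be independent, so a
  nonzero polynomial in \<open>B\<close> annihilates \<open>x\<close>. Dividing a root out of one of
  least degree leaves a polynomial that does not annihilate \<open>x\<close>, and its value is an
  eigenvector.\<close>

lemma finite_dim_eigenvector:
  fixes B :: "'m::complex_inner \<Rightarrow> 'm"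
  assumes B: "clinear B" and S: "finite S" "\<And>x. x \<in> complex_vector.span S \<Longrightarrow> B x \<in> complex_vector.span S"
    and x: "x \<in> complex_vector.span S" "x \<noteq> 0"
  obtains \<mu> v where "v \<in> complex_vector.span S" "v \<noteq> 0" "B v = \<mu> *\<^sub>C v"
proof -
  define ev where "ev p = (\<Sum>i\<le>degree p. coeff p i *\<^sub>C (B ^^ i) x)" for p
  have ev_upto: "ev p = (\<Sum>i\<le>N. coeff p i *\<^sub>C (B ^^ i) x)" if "degree p \<le> N" for p N
    unfolding ev_def using that
    by (intro sum.mono_neutral_left) (auto simp: coeff_eq_0 scaleC.zero_left)
  have pow: "(B ^^ i) x \<in> complex_vector.span S" for i
    by (induction i) (auto simp: x S)
  have ev_in: "ev p \<in> complex_vector.span S" for p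
    unfolding ev_def by (intro complex_vector.span_sum complex_vector.span_scale pow)
  have "\<exists>p. p \<noteq> 0 \<and> ev p = 0"
  \<comment> \<open>Dependence is a property of sets, in which repeated iterates collapse; a
    repetition is therefore treated separately, by a difference of two monomials.\<close>
  proof (cases "inj_on (\<lambda>i. (B ^^ i) x) {..card S}")
    case False
    then obtain i j where ij: "i \<noteq> j" "(B ^^ i) x = (B ^^ j) x"
      by (auto simp: inj_on_def)
    let ?p = "monom (1::complex) i - monom 1 j"
    have "coeff ?p i \<noteq> 0"
      using ij by simp
    then have "?p \<noteq> 0"
      by fastforce
    moreover have "ev ?p = (\<Sum>k\<le>max i j. coeff ?p k *\<^sub>C (B ^^ k) x)"
      by (intro ev_upto degree_diff_le) (auto intro: order_trans[OF degree_monom_le])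
    then have "ev ?p = (\<Sum>k\<le>max i j. (if k = i then (B ^^ k) x else 0))
        - (\<Sum>k\<le>max i j. (if k = j then (B ^^ k) x else 0))"
      unfolding sum_subtractf[symmetric] by (auto intro!: sum.cong
          simp: scaleC.diff_left scaleC.zero_left scaleC_one)
    then have "ev ?p = 0"
      by (simp add: ij)
    ultimately show ?thesis
      by blast
  next
    case True
    let ?T = "(\<lambda>i. (B ^^ i) x) ` {..card S}"
    have "card ?T = Suc (card S)"
      using card_image[OF True] by simp
    then have "complex_vector.dependent ?T"
      using complex_vector.independent_span_bound[OF S(1), of ?T] pow by auto
    then obtain u y where u: "y \<in> ?T" "u y \<noteq> 0" "(\<Sum>v\<in>?T. u v *\<^sub>C v) = 0"
      using complex_vector.dependent_finite[of ?T] by auto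
    then obtain j where j: "j \<le> card S" "u ((B ^^ j) x) \<noteq> 0"
      by auto
    define p where "p = (\<Sum>i\<le>card S. monom (u ((B ^^ i) x)) i)"
    have cf: "coeff p i = (if i \<le> card S then u ((B ^^ i) x) else 0)" for i
      by (simp add: p_def coeff_sum coeff_monom)
    have "degree p \<le> card S"
      by (rule degree_le) (simp add: cf)
    then have "ev p = (\<Sum>i\<le>card S. u ((B ^^ i) x) *\<^sub>C (B ^^ i) x)"
      by (simp add: ev_upto cf)
    also have "\<dots> = 0"
      using u(3) sum.reindex[OF True, of "\<lambda>v. u v *\<^sub>C v"] by (simp add: o_def)
    finally show ?thesis
      using cf[of j] j by (intro exI[of _ p]) auto
  qed
  then obtain p where p: "p \<noteq> 0" "ev p = 0"
    and least: "\<And>q. q \<noteq> 0 \<Longrightarrow> ev q = 0 \<Longrightarrow> degree p \<le> degree q"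
    using ex_has_least_nat[of "\<lambda>p. p \<noteq> 0 \<and> ev p = 0" _ degree] by metis
  have "degree p \<noteq> 0"
  proof
    assume "degree p = 0"
    then have "coeff p 0 \<noteq> 0" "coeff p 0 *\<^sub>C x = 0"
      using p leading_coeff_0_iff[of p] by (auto simp: ev_def)
    then show False
      using x(2) norm_scaleC[of "coeff p 0" x] by simp
  qed
  then obtain \<mu> where "poly p \<mu> = 0"
    using alg_closed_imp_poly_has_root[of p] by auto
  then obtain q where q: "p = [:-\<mu>, 1:] * q"
    by (auto simp: poly_eq_0_iff_dvd)
  with p have q0: "q \<noteq> 0"
    by auto
  have deg: "degree p = Suc (degree q)"
    unfolding q using q0 by (subst degree_mult_eq) auto
  have "ev p = (\<Sum>i\<le>Suc (degree q). coeff (pCons 0 q) i *\<^sub>C (B ^^ i) x - \<mu> *\<^sub>C coeff q i *\<^sub>C (B ^^ i) x)"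
    unfolding ev_def deg unfolding q
    by (intro sum.cong refl)
       (simp add: scaleC.diff_left scaleC_scaleC)
  also have "\<dots> = (\<Sum>i\<le>degree q. coeff q i *\<^sub>C (B ^^ Suc i) x) - \<mu> *\<^sub>C ev q"
    unfolding sum_subtractf sum.atMost_Suc_shift[of "\<lambda>i. coeff (pCons 0 q) i *\<^sub>C (B ^^ i) x"]
      complex_vector.scale_sum_right[symmetric] ev_upto[of q "Suc (degree q)", OF le_SucI[OF order_refl], symmetric]
    by (simp add: scaleC.zero_left)
  also have "(\<Sum>i\<le>degree q. coeff q i *\<^sub>C (B ^^ Suc i) x) = B (ev q)"
    by (simp add: ev_def clinear_sum[OF B] clinear_scaleC[OF B])
  finally have "B (ev q) = \<mu> *\<^sub>C ev q"
    using p by simp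
  moreover have "ev q \<noteq> 0"
    using least[OF q0] deg by auto
  ultimately show ?thesis
    using that ev_in by blast
qed

text \<open>Schur triangularization in quantitative form: split off a unit eigenvector
  \<open>v\<close>, compress \<open>B\<close> to its orthogonal complement and induct. The rest of
  the row of \<open>v\<close> is bounded by \<open>sqrt (1 - s\<^sup>2)\<close>, and each of the
  \<open>d\<close> splittings loses this once.\<close>

lemma norm_ge_of_eigenvalues_ge:
  fixes B :: "'m::complex_inner \<Rightarrow> 'm"
  assumes "clinear B" "finite S" "card S \<le> d" and s: "0 < s" "s < 1"
    and "\<And>x. x \<in> complex_vector.span S \<Longrightarrow> B x \<in> complex_vector.span S"
    and "\<And>x. x \<in> complex_vector.span S \<Longrightarrow> norm (B x) \<le> norm x"
    and "\<And>\<mu> v. v \<in> complex_vector.span S \<Longrightarrow> v \<noteq> 0 \<Longrightarrow> B v = \<mu> *\<^sub>C v \<Longrightarrow> s \<le> cmod \<mu>"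
    and "x \<in> complex_vector.span S"
  shows "(s - real d * sqrt (1 - s\<^sup>2)) * norm x \<le> norm (B x)"
  using assms(1-3,6-)
proof (induction d arbitrary: B S x)
  case 0
  then show ?case
    by simp
next
  case (Suc d)
  note B = Suc.prems(1) and inv = Suc.prems(4) and contr = Suc.prems(5) and eig = Suc.prems(6)
  show ?case
  proof (cases "x = 0")
    case False
    let ?E = "complex_vector.span S"
    define c where "c = sqrt (1 - s\<^sup>2)"
    have s2: "0 < 1 - s\<^sup>2"
      using s by (simp add: power_less_one_iff)
    have c: "0 \<le> c" "c\<^sup>2 = 1 - s\<^sup>2"
      using s2 by (simp_all add: c_def)
    obtain \<nu> v0 where v0: "v0 \<in> ?E" "v0 \<noteq> 0" "B v0 = \<nu> *\<^sub>C v0"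
      using finite_dim_eigenvector[OF B Suc.prems(2) inv Suc.prems(7) False] by metis
    define v where "v = complex_of_real (inverse (norm v0)) *\<^sub>C v0"
    have v: "v \<in> ?E" "norm v = 1" "B v = \<nu> *\<^sub>C v" "v \<noteq> 0"
      using v0 by (simp_all add: v_def norm_scaleC clinear_scaleC[OF B] scaleC_scaleC mult.commute
          complex_vector.span_scale norm_inverse)
    have vv: "cinner v v = 1"
      using v(2) by (simp add: cinner_self)
    have \<nu>: "s \<le> cmod \<nu>" "\<nu> \<noteq> 0"
      using eig[OF v(1) v(4) v(3)] s by auto
    define Q where "Q y = y - cinner y v *\<^sub>C v" for y
    have Q: "clinear Q"
      by (rule clinearI) (simp_all add: Q_def cinner_simps scaleC.add_left scaleC.diff_right scaleC_scaleC)
    have Q_orth: "cinner (Q y) v = 0" for y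
      by (simp add: Q_def cinner_simps vv)
    have Q_v: "Q v = 0"
      by (simp add: Q_def vv scaleC_one)
    have Q_in: "Q y \<in> ?E" if "y \<in> ?E" for y
      unfolding Q_def using that v(1)
      by (intro complex_vector.span_diff complex_vector.span_scale)
    have "complex_vector.independent {v}"
      using v(4) by simp
    then obtain S' where S': "{v} \<subseteq> S'" "S' \<subseteq> ?E" "complex_vector.independent S'"
        "?E \<subseteq> complex_vector.span S'"
      using complex_vector.maximal_independent_subset_extend[of "{v}" ?E] v(1) by auto
    have finS': "finite S'" "card S' \<le> Suc d"
      using complex_vector.independent_span_bound[OF Suc.prems(2) S'(3) S'(2)] Suc.prems(3) by auto
    \<comment> \<open>\<open>Q\<close> annihilates \<open>v\<close>, so one generator is saved;
      \<open>T\<close> spans the orthogonal complement of \<open>v\<close> in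
      \<open>?E\<close>.\<close>
    define T where "T = Q ` (S' - {v})"
    have "card (S' - {v}) \<le> d"
      using finS' S'(1) by (simp add: card_Diff_singleton_if)
    then have T: "finite T" "card T \<le> d"
      unfolding T_def using finS' card_image_le[of "S' - {v}" Q] by auto
    have QT: "y \<in> complex_vector.span T" if y: "y \<in> ?E" "cinner y v = 0" for y
    proof -
      have "y \<in> complex_vector.span (insert v (S' - {v}))"
        using S'(1,4) y(1) by (simp add: insert_absorb subset_iff)
      then obtain k where k: "y - k *\<^sub>C v \<in> complex_vector.span (S' - {v})"
        unfolding complex_vector.span_breakdown_eq by blast
      have "y = Q (y - k *\<^sub>C v)"
        using y(2) by (simp add: clinear_diff[OF Q] clinear_scaleC[OF Q] Q_v) (simp add: Q_def scaleC.zero_left scaleC.zero_right)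
      then show ?thesis
        unfolding T_def module_hom.span_image[OF clinear_module_hom[OF Q]] using k by blast
    qed
    have TE: "y \<in> ?E \<and> cinner y v = 0" if "y \<in> complex_vector.span T" for y
    proof (rule complex_vector.span_induct[OF that])
      show "complex_vector.subspace {y. y \<in> ?E \<and> cinner y v = 0}"
        by (auto simp: complex_vector.subspace_def cinner_simps cinner.zero_left
            complex_vector.span_zero complex_vector.span_add complex_vector.span_scale)
    qed (use S'(2) in \<open>auto simp: T_def Q_orth intro!: Q_in\<close>)
    have BQ: "B y = cinner (B y) v *\<^sub>C v + Q (B y)" for y
      by (simp add: Q_def)
    have pyth: "(norm (a *\<^sub>C v + Q y))\<^sup>2 = (cmod a)\<^sup>2 + (norm (Q y))\<^sup>2" for a y
      using norm_sq_add_orthogonal[of "a *\<^sub>C v" "Q y"] Q_orth[of y] cinner_eq_0_commute[of v "Q y"]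
      by (simp add: cinner_scaleC_left norm_scaleC v(2))
    text \<open>A contraction with an almost unimodular diagonal entry has a small row.\<close>
    have off: "cmod (cinner (B y) v) \<le> c * norm y" if y: "y \<in> ?E" "cinner y v = 0" for y
    proof -
      define b where "b = cinner (B y) v"
      \<comment> \<open>This value maximizes \<open>(1 + t)\<^sup>2 - t\<^sup>2 / s\<^sup>2\<close>.
        In the test vector \<open>z\<close> below, the division by \<nu> gives \<open>B z\<close>
        the \<open>v\<close>-component \<open>(1 + t) * b\<close>, while the
        \<open>v\<close>-component of \<open>z\<close> is at most
        \<open>t * cmod b / s\<close>.\<close>
      define t where "t = s\<^sup>2 / (1 - s\<^sup>2)"
      have t: "0 \<le> t" "1 + t = 1 / (1 - s\<^sup>2)"
        using s2 by (simp_all add: t_def field_simps)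
      define z where "z = (t * b / \<nu>) *\<^sub>C v + y"
      have Qy: "Q y = y"
        by (simp add: Q_def y(2) scaleC.zero_left)
      have zE: "z \<in> ?E"
        unfolding z_def by (intro complex_vector.span_add complex_vector.span_scale v y)
      have "B z = (t * b) *\<^sub>C v + B y"
        using \<nu> by (simp add: z_def clinear_add[OF B] clinear_scaleC[OF B] v(3) scaleC_scaleC)
      also have "\<dots> = ((1 + t) * b) *\<^sub>C v + Q (B y)"
        by (subst BQ) (simp add: b_def scaleC.add_left distrib_right)
      finally have "(cmod ((1 + t) * b))\<^sup>2 \<le> (norm (B z))\<^sup>2"
        by (simp add: pyth)
      also have "\<dots> \<le> (norm z)\<^sup>2"
        using contr[OF zE] by (intro power_mono) auto
      also have "\<dots> = (cmod (t * b / \<nu>))\<^sup>2 + (norm y)\<^sup>2"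
        unfolding z_def using pyth[of _ y] Qy by simp
      also have "cmod (t * b / \<nu>) \<le> t * cmod b / s"
        using \<nu> s t by (simp add: norm_mult norm_divide frac_le)
      then have "(cmod (t * b / \<nu>))\<^sup>2 \<le> (t * cmod b / s)\<^sup>2"
        by (intro power_mono) auto
      finally have "(cmod ((1 + t) * b))\<^sup>2 \<le> (t * cmod b / s)\<^sup>2 + (norm y)\<^sup>2"
        by simp
      then have "((1 + t)\<^sup>2 - t\<^sup>2 / s\<^sup>2) * (cmod b)\<^sup>2 \<le> (norm y)\<^sup>2"
      proof -
        have "cmod ((1 + t) * b) = (1 + t) * cmod b"
          using t(1) unfolding norm_mult norm_of_real by simp
        then show ?thesis
          using \<open>(cmod ((1 + t) * b))\<^sup>2 \<le> (t * cmod b / s)\<^sup>2 + (norm y)\<^sup>2\<close>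
          by (simp add: power_mult_distrib power_divide left_diff_distrib)
      qed
      moreover have "(1 + t)\<^sup>2 - t\<^sup>2 / s\<^sup>2 = 1 / (1 - s\<^sup>2)"
      proof -
        have "t\<^sup>2 / s\<^sup>2 = s\<^sup>2 / (1 - s\<^sup>2)\<^sup>2"
          using s by (simp add: t_def power_divide power2_eq_square)
        then have "(1 + t)\<^sup>2 - t\<^sup>2 / s\<^sup>2 = (1 - s\<^sup>2) / (1 - s\<^sup>2)\<^sup>2"
          unfolding t(2) by (simp add: power_divide diff_divide_distrib)
        also have "\<dots> = 1 / (1 - s\<^sup>2)"
          using s2 by (simp add: power2_eq_square)
        finally show ?thesis .
      qed
      ultimately have "(cmod b)\<^sup>2 \<le> (1 - s\<^sup>2) * (norm y)\<^sup>2"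
        using s2 by (simp add: field_simps)
      also have "\<dots> = (c * norm y)\<^sup>2"
        by (simp add: power_mult_distrib c)
      finally show ?thesis
        unfolding b_def[symmetric] using c(1) by (simp add: power2_le_iff_abs_le abs_mult)
    qed
    define a y where "a = cinner x v" and "y = Q x"
    have x_eq: "x = a *\<^sub>C v + y"
      by (simp add: a_def y_def Q_def)
    have yE: "y \<in> ?E" "cinner y v = 0"
      using Q_in[OF Suc.prems(7)] Q_orth by (auto simp: y_def)
    have nx: "(norm x)\<^sup>2 = (cmod a)\<^sup>2 + (norm y)\<^sup>2"
      using pyth[of a x] by (simp add: x_eq[symmetric] flip: y_def)
    then have "(norm y)\<^sup>2 \<le> (norm x)\<^sup>2"
      by simp
    then have y_le: "norm y \<le> norm x"
      by (simp add: power2_le_iff_abs_le)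
    have IH: "(s - real d * c) * norm y \<le> norm (Q (B y))"
      unfolding c_def
    proof (rule Suc.IH[of "\<lambda>y. Q (B y)", OF _ T])
      show "clinear (\<lambda>y. Q (B y))"
        by (rule clinearI) (simp_all add: clinear_add[OF B] clinear_add[OF Q] clinear_scaleC[OF B] clinear_scaleC[OF Q])
      show "Q (B y) \<in> complex_vector.span T" if "y \<in> complex_vector.span T" for y
        using TE[OF that] by (intro QT Q_in inv Q_orth) auto
      show "norm (Q (B y)) \<le> norm y" if "y \<in> complex_vector.span T" for y
      proof -
        have "(norm (Q (B y)))\<^sup>2 \<le> (norm (B y))\<^sup>2"
          using pyth[of "cinner (B y) v" "B y"] by (simp flip: BQ)
        then have "norm (Q (B y)) \<le> norm (B y)"
          by (simp add: power2_le_iff_abs_le)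
        then show ?thesis
          using contr[of y] TE[OF that] by simp
      qed
      show "s \<le> cmod \<mu>" if w: "w \<in> complex_vector.span T" "w \<noteq> 0" "Q (B w) = \<mu> *\<^sub>C w" for \<mu> w
      proof (cases "\<mu> = \<nu>")
        case False
        define b where "b = cinner (B w) v"
        \<comment> \<open>An eigenvector of the compression becomes one of \<open>B\<close>: this
          multiple of \<open>v\<close> absorbs the row entry \<open>b\<close>. If
          \<open>\<mu> = \<nu>\<close>, the eigenvalue is already known to be large.\<close>
        define u where "u = w + (b / (\<mu> - \<nu>)) *\<^sub>C v"
        have Bw: "B w = b *\<^sub>C v + \<mu> *\<^sub>C w"
          unfolding b_def w(3)[symmetric] by (rule BQ)
        have "b + b / (\<mu> - \<nu>) * \<nu> = \<mu> * (b / (\<mu> - \<nu>))"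
          using False by (simp add: field_simps)
        then have "B u = \<mu> *\<^sub>C u"
          by (simp add: u_def clinear_add[OF B] clinear_scaleC[OF B] Bw v(3) scaleC_scaleC
              scaleC.add_right add.assoc add.left_commute flip: scaleC.add_left)
        moreover have "u \<in> ?E"
          unfolding u_def using TE[OF w(1)]
          by (intro complex_vector.span_add complex_vector.span_scale v) auto
        moreover have "u \<noteq> 0"
        proof
          assume "u = 0"
          then have "cinner u w = 0"
            by (simp add: cinner.zero_left)
          moreover have "cinner v w = 0"
            using TE[OF w(1)] cinner_eq_0_commute by blast
          ultimately show False
            using w(2) by (simp add: u_def cinner_simps)
        qed
        ultimately show ?thesis
          using eig by blast
      qed (use \<nu> in simp)
      show "y \<in> complex_vector.span T"
        by (rule QT[OF yE])
    qed
    define m where "m = s - real d * c"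
    \<comment> \<open>Comparing squares needs \<open>m\<close> nonnegative; for negative
      \<open>m\<close> the bound is trivial.\<close>
    have m_le: "m * norm x \<le> norm ((a * \<nu>) *\<^sub>C v + Q (B y))"
    proof (cases "0 \<le> m")
      case True
      have "m \<le> cmod \<nu>"
        using \<nu> mult_nonneg_nonneg[OF of_nat_0_le_iff c(1), of d] unfolding m_def by linarith
      then have "(m * cmod a)\<^sup>2 \<le> (cmod (a * \<nu>))\<^sup>2"
        using True by (intro power_mono) (auto simp: norm_mult mult.commute[of "cmod a"] mult_right_mono)
      moreover have "(m * norm y)\<^sup>2 \<le> (norm (Q (B y)))\<^sup>2"
        using True IH by (intro power_mono) (auto simp: m_def)
      ultimately have "(m * norm x)\<^sup>2 \<le> (norm ((a * \<nu>) *\<^sub>C v + Q (B y)))\<^sup>2"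
        by (simp add: pyth nx power_mult_distrib distrib_left)
      then show ?thesis
        using True by (simp add: power2_le_iff_abs_le abs_mult)
    next
      case False
      then have "m * norm x \<le> 0"
        by (simp add: mult_nonpos_nonneg)
      then show ?thesis
        using norm_ge_zero order_trans by blast
    qed
    have "B x = (a * \<nu>) *\<^sub>C v + B y"
      by (subst x_eq) (simp add: clinear_add[OF B] clinear_scaleC[OF B] v(3) scaleC_scaleC)
    then have "B x = ((a * \<nu>) *\<^sub>C v + Q (B y)) + cinner (B y) v *\<^sub>C v"
      using BQ[of y] by (metis add.assoc add.commute)
    then have "norm ((a * \<nu>) *\<^sub>C v + Q (B y)) \<le> norm (B x) + cmod (cinner (B y) v)"
      using norm_triangle_ineq4[of "B x" "cinner (B y) v *\<^sub>C v"]
      by (simp add: norm_scaleC v(2))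
    moreover have "c * norm y \<le> c * norm x"
      using y_le c(1) by (rule mult_left_mono)
    ultimately show ?thesis
      using m_le off[OF yE] by (simp add: m_def c_def[symmetric] algebra_simps)
  qed simp
qed

section \<open>Pure isometries\<close>

text \<open>The equality case of the Cauchy-Schwarz inequality: \<open>S (T x)\<close> is no longer
  than \<open>x\<close>, yet its inner product with \<open>x\<close> is
  \<open>(norm x)\<^sup>2\<close>.\<close>

lemma adjoint_isometric_vector:
  fixes T :: "'m::complex_inner \<Rightarrow> 'm"
  assumes adj: "\<And>x y. cinner (T x) y = cinner x (S y)"
    and bd: "\<And>x. norm (S x) \<le> norm x" and eq: "norm (T x) = norm x"
  shows "S (T x) = x"
proof -
  have "(norm (S (T x)))\<^sup>2 \<le> (norm x)\<^sup>2"
    using bd[of "T x"] eq by (intro power_mono) auto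
  moreover have "Re (cinner (S (T x)) x) = (norm x)\<^sup>2"
    using cinner_commute[of "S (T x)" x] by (simp add: norm_sq_cinner eq flip: adj)
      (simp add: eq flip: norm_sq_cinner)
  ultimately have "(norm (S (T x) + - x))\<^sup>2 \<le> 0"
    unfolding norm_sq_add by (simp add: cinner_simps)
  then show ?thesis
    by simp
qed

text \<open>For \<open>p = 1\<close> this covers absolute convergence, for \<open>p = 2\<close>
  orthogonal series, which need not converge absolutely.\<close>

lemma summable_of_sum_norm_le:
  fixes f :: "nat \<Rightarrow> 'm::{real_normed_vector, complete_space}"
  assumes g: "summable g" and le: "\<And>A. finite A \<Longrightarrow> norm (\<Sum>n\<in>A. f n) ^ p \<le> (\<Sum>n\<in>A. g n)" and p: "0 < p"
  shows "summable f"
proof -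
  have "Cauchy (\<lambda>n. \<Sum>i<n. f i)"
  proof (rule metric_CauchyI)
    fix e :: real
    assume e: "0 < e"
    moreover have "Cauchy (\<lambda>n. \<Sum>i<n. g i)"
      using g by (simp add: summable_iff_convergent convergent_Cauchy)
    ultimately obtain M where M: "\<And>m n. M \<le> m \<Longrightarrow> M \<le> n \<Longrightarrow> dist (\<Sum>i<m. g i) (\<Sum>i<n. g i) < e ^ p"
      using metric_CauchyD[of _ "e ^ p"] by (meson zero_less_power)
    have "dist (\<Sum>i<m. f i) (\<Sum>i<n. f i) < e" if "M \<le> m" "m \<le> n" for m n
    proof -
      have "dist (\<Sum>i<m. f i) (\<Sum>i<n. f i) ^ p = norm (\<Sum>i\<in>{..<n} - {..<m}. f i) ^ p"
        using that by (subst sum_diff) (auto simp: dist_norm norm_minus_commute)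
      also have "\<dots> \<le> (\<Sum>i\<in>{..<n} - {..<m}. g i)"
        by (intro le) simp
      also have "\<dots> = (\<Sum>i<n. g i) - (\<Sum>i<m. g i)"
        using that by (subst sum_diff) auto
      also have "\<dots> < e ^ p"
        using M[of m n] that by (auto simp: dist_norm)
      finally show ?thesis
        using e by (meson less_le_not_le power_less_imp_less_base less_imp_le)
    qed
    then show "\<exists>M. \<forall>m\<ge>M. \<forall>n\<ge>M. dist (\<Sum>i<m. f i) (\<Sum>i<n. f i) < e"
      by (intro exI[of _ M]) (metis dist_commute nle_le)
  qed
  then show ?thesis
    by (simp add: summable_iff_convergent Cauchy_convergent)
qed

lemma summable_of_norm_le:
  fixes f :: "nat \<Rightarrow> 'm::{real_normed_vector, complete_space}"
  assumes "summable g" and "\<And>n. norm (f n) \<le> g n"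
  shows "summable f"
  by (rule summable_of_sum_norm_le[OF assms(1), of _ 1]) (auto intro: sum_norm_le assms(2))

locale pure_isometry =
  fixes U Us :: "'m::{complex_inner, complete_space} \<Rightarrow> 'm"
  assumes U: "clinear U" and norm_U [simp]: "norm (U x) = norm x"
    and Us: "clinear Us" and norm_Us: "norm (Us x) \<le> norm x"
    and adj: "cinner (U x) y = cinner x (Us y)"
    and pure: "(\<Inter>j. range (U ^^ j)) = {0}"
begin

lemma Us_U [simp]: "Us (U x) = x"
  by (rule adjoint_isometric_vector[OF adj norm_Us norm_U])

lemma adj': "cinner (Us x) y = cinner x (U y)"
  using adj[of y x] cinner_commute by metis

lemma cinner_U_U: "cinner (U x) (U y) = cinner x y"
  by (simp add: adj)

lemma bounded_linear_U: "bounded_linear U"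
  using clinear_bounded_linear[OF U, of 1] by simp

lemma bounded_linear_Us: "bounded_linear Us"
  using clinear_bounded_linear[OF Us, of 1] norm_Us by simp

text \<open>The orthogonal projection onto the wandering subspace, that is, onto the kernel of
  \<open>Us\<close>.\<close>

definition P where "P x = x - U (Us x)"

lemma P: "clinear P"
  by (rule clinearI) (simp_all add: P_def clinear_add[OF U] clinear_add[OF Us] clinear_scaleC[OF U]
      clinear_scaleC[OF Us] scaleC.diff_right)

lemma Us_P [simp]: "Us (P x) = 0"
  by (simp add: P_def clinear_diff[OF Us])

lemma P_U [simp]: "P (U x) = 0"
  by (simp add: P_def)

lemma P_wandering: "Us x = 0 \<Longrightarrow> P x = x"
  by (simp add: P_def clinear_0[OF U])

lemma cinner_P_P: "cinner (P x) (P y) = cinner x y - cinner (Us x) (Us y)"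
proof -
  have "cinner (P x) (P y) = cinner (P x) y - cinner (Us (P x)) (Us y)"
    unfolding P_def[of y] by (simp only: cinner.diff_right adj')
  also have "\<dots> = cinner x y - cinner (Us x) (Us y)"
    by (simp add: cinner.zero_left P_def cinner.diff_left adj clinear_diff[OF Us])
  finally show ?thesis .
qed

lemma norm_P: "(norm (P x))\<^sup>2 = (norm x)\<^sup>2 - (norm (Us x))\<^sup>2"
  by (simp add: norm_sq_cinner cinner_P_P)

text \<open>The Wold decomposition as an induction principle, by which properties spread from
  wandering vectors to the whole space. If \<open>y\<close> is orthogonal to \<open>G\<close>, then
  \<open>P y = 0\<close>, so \<open>y = U (Us y)\<close>, and \<open>Us y\<close> is again
  orthogonal to \<open>G\<close>; iterating puts \<open>y\<close> into every
  \<open>range (U ^^ n)\<close>.\<close>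

lemma closed_invariant_eq_UNIV:
  assumes sub: "complex_vector.subspace G" and cl: "closed G"
    and wand: "\<And>w. Us w = 0 \<Longrightarrow> w \<in> G" and inv: "\<And>x. x \<in> G \<Longrightarrow> U x \<in> G"
  shows "G = UNIV"
proof -
  have step: "U (Us y) = y \<and> (\<forall>g\<in>G. cinner g (Us y) = 0)" if y: "\<forall>g\<in>G. cinner g y = 0" for y
  proof -
    have "cinner (P y) (P y) = cinner (P y) y - cinner (Us (P y)) (Us y)"
      unfolding P_def[of y] by (simp only: cinner.diff_right adj')
    then have "P y = 0"
      using y wand[of "P y"] by (simp add: cinner.zero_left)
    moreover have "cinner g (Us y) = 0" if "g \<in> G" for g
      using y inv[OF that] by (simp flip: adj)
    ultimately show ?thesis
      by (simp add: P_def)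
  qed
  have zero: "y = 0" if y: "\<forall>g\<in>G. cinner g y = 0" for y
  proof -
    have "(U ^^ n) ((Us ^^ n) y) = y \<and> (\<forall>g\<in>G. cinner g ((Us ^^ n) y) = 0)" for n
    proof (induction n)
      case (Suc n)
      then show ?case
        using step[of "(Us ^^ n) y"] by (simp add: funpow_swap1[of U])
    qed (use y in simp)
    then have "y \<in> (\<Inter>j. range (U ^^ j))"
      by (metis INT_iff rangeI)
    then show ?thesis
      using pure by auto
  qed
  have "x \<in> G" for x
  proof -
    obtain p where p: "p \<in> G" "\<And>g. g \<in> G \<Longrightarrow> cinner (x - p) g = 0"
      using orthogonal_projection_exists[OF sub cl, of x] by metis
    then have "x - p = 0"
      using zero cinner_eq_0_commute by blast
    then show ?thesis
      using p(1) by simp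
  qed
  then show ?thesis
    by auto
qed

section \<open>Eigenspaces of the adjoint and kernel vectors\<close>

definition E where "E \<zeta> = {x. Us x = cnj \<zeta> *\<^sub>C x}"

lemma EI: "Us x = cnj \<zeta> *\<^sub>C x \<Longrightarrow> x \<in> E \<zeta>"
  and ED: "x \<in> E \<zeta> \<Longrightarrow> Us x = cnj \<zeta> *\<^sub>C x"
  by (simp_all add: E_def)

lemma subspace_E: "complex_vector.subspace (E \<zeta>)"
  by (auto simp: E_def complex_vector.subspace_def clinear_0[OF Us] clinear_add[OF Us]
      clinear_scaleC[OF Us] scaleC.add_right scaleC.zero_right scaleC_scaleC mult.commute)

lemma norm_P_E: "x \<in> E \<zeta> \<Longrightarrow> (norm (P x))\<^sup>2 = (1 - (cmod \<zeta>)\<^sup>2) * (norm x)\<^sup>2"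
  by (simp add: norm_P ED norm_scaleC power_mult_distrib left_diff_distrib)

text \<open>The Neumann series for the inverse of \<open>I - cnj \<zeta> U\<close> applied to
  \<open>w\<close>. For wandering \<open>w\<close> it is the Szego kernel vector at \<zeta> of the
  Wold model.\<close>

definition kernel_vec where "kernel_vec \<zeta> w = (\<Sum>n. cnj \<zeta> ^ n *\<^sub>C (U ^^ n) w)"

lemma norm_funpow_U [simp]: "norm ((U ^^ n) w) = norm w"
  by (induction n) simp_all

lemma summable_kernel_vec:
  assumes "cmod \<zeta> < 1"
  shows "summable (\<lambda>n. cnj \<zeta> ^ n *\<^sub>C (U ^^ n) w)"
proof (rule summable_of_norm_le)
  show "summable (\<lambda>n. cmod \<zeta> ^ n * norm w)"
    using assms by (intro summable_mult2 summable_geometric) auto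
qed (simp add: norm_scaleC norm_power)

lemma kernel_vec_eq:
  assumes "cmod \<zeta> < 1"
  shows "kernel_vec \<zeta> w = w + cnj \<zeta> *\<^sub>C U (kernel_vec \<zeta> w)"
proof -
  have "(\<lambda>n. cnj \<zeta> *\<^sub>C U (cnj \<zeta> ^ n *\<^sub>C (U ^^ n) w)) sums (cnj \<zeta> *\<^sub>C U (kernel_vec \<zeta> w))"
    unfolding kernel_vec_def
    by (intro bounded_linear.sums[OF scaleC.bounded_linear_right] bounded_linear.sums[OF bounded_linear_U]
        summable_sums summable_kernel_vec assms)
  then have "(\<lambda>n. cnj \<zeta> ^ Suc n *\<^sub>C (U ^^ Suc n) w) sums (cnj \<zeta> *\<^sub>C U (kernel_vec \<zeta> w))"
    by (simp add: clinear_scaleC[OF U] scaleC_scaleC)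
  from sums_unique[OF this] show ?thesis
    using suminf_split_head[OF summable_kernel_vec[OF assms], of w]
    by (simp add: kernel_vec_def scaleC_one)
qed

text \<open>Multiplying the isometry \<open>U\<close> by \<open>cnj \<zeta>\<close> gives a strict
  contraction, so the fixed point is unique. Linearity and the description of
  \<open>E \<zeta>\<close> follow from this equation, without touching the series.\<close>

lemma kernel_vec_unique:
  assumes "cmod \<zeta> < 1" "x = w + cnj \<zeta> *\<^sub>C U x"
  shows "x = kernel_vec \<zeta> w"
proof -
  have "x - kernel_vec \<zeta> w =
      (w + cnj \<zeta> *\<^sub>C U x) - (w + cnj \<zeta> *\<^sub>C U (kernel_vec \<zeta> w))"
    by (simp only: assms(2)[symmetric] kernel_vec_eq[OF assms(1), symmetric])
  then have "x - kernel_vec \<zeta> w = cnj \<zeta> *\<^sub>C U (x - kernel_vec \<zeta> w)"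
    unfolding clinear_diff[OF U] scaleC.diff_right by simp
  then have "norm (x - kernel_vec \<zeta> w) = cmod \<zeta> * norm (x - kernel_vec \<zeta> w)"
    by (metis complex_mod_cnj norm_U norm_scaleC)
  then show ?thesis
    using assms(1) by simp
qed

lemma kernel_vec_in_E:
  assumes "cmod \<zeta> < 1" "Us w = 0"
  shows "kernel_vec \<zeta> w \<in> E \<zeta>"
  by (rule EI, subst kernel_vec_eq[OF assms(1)])
     (simp add: clinear_add[OF Us] clinear_scaleC[OF Us] assms(2))

lemma E_eq_kernel_vec:
  assumes "cmod \<zeta> < 1" "x \<in> E \<zeta>"
  shows "x = kernel_vec \<zeta> (P x)"
  by (rule kernel_vec_unique[OF assms(1)]) (simp add: P_def ED[OF assms(2)] clinear_scaleC[OF U])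

lemma clinear_kernel_vec:
  assumes "cmod \<zeta> < 1"
  shows "clinear (kernel_vec \<zeta>)"
proof (rule clinearI)
  show "kernel_vec \<zeta> (x + y) = kernel_vec \<zeta> x + kernel_vec \<zeta> y" for x y
  proof (rule kernel_vec_unique[OF assms, symmetric])
    have "kernel_vec \<zeta> x + kernel_vec \<zeta> y =
        (x + cnj \<zeta> *\<^sub>C U (kernel_vec \<zeta> x)) + (y + cnj \<zeta> *\<^sub>C U (kernel_vec \<zeta> y))"
      by (simp only: kernel_vec_eq[OF assms, symmetric])
    then show "kernel_vec \<zeta> x + kernel_vec \<zeta> y =
        x + y + cnj \<zeta> *\<^sub>C U (kernel_vec \<zeta> x + kernel_vec \<zeta> y)"
      unfolding clinear_add[OF U] scaleC.add_right by (simp only: add_ac)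
  qed
  show "kernel_vec \<zeta> (c *\<^sub>C x) = c *\<^sub>C kernel_vec \<zeta> x" for c x
  proof (rule kernel_vec_unique[OF assms, symmetric])
    have "c *\<^sub>C kernel_vec \<zeta> x = c *\<^sub>C (x + cnj \<zeta> *\<^sub>C U (kernel_vec \<zeta> x))"
      by (simp only: kernel_vec_eq[OF assms, symmetric])
    then show "c *\<^sub>C kernel_vec \<zeta> x = c *\<^sub>C x + cnj \<zeta> *\<^sub>C U (c *\<^sub>C kernel_vec \<zeta> x)"
      unfolding clinear_scaleC[OF U] scaleC.add_right scaleC_scaleC by (simp only: mult.commute)
  qed
qed

text \<open>The vectors \<open>b\<close> with this property form a closed subspace, and it is
  invariant because \<open>cinner (U b) x = \<zeta> * cinner b x\<close> on
  \<open>E \<zeta>\<close>. A wandering \<open>b\<close> sees only \<open>P x\<close>, whose squared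
  norm carries the factor \<open>1 - (cmod \<zeta>)\<^sup>2\<close>.\<close>

lemma weak_decay:
  assumes "0 < \<epsilon>"
  shows "\<exists>\<rho><1. \<forall>\<zeta> x. \<rho> \<le> cmod \<zeta> \<longrightarrow> cmod \<zeta> < 1 \<longrightarrow> x \<in> E \<zeta> \<longrightarrow> cmod (cinner b x) \<le> \<epsilon> * norm x"
proof -
  define D where "D b \<epsilon> \<rho> \<longleftrightarrow> (\<forall>\<zeta> x. \<rho> \<le> cmod \<zeta> \<longrightarrow> cmod \<zeta> < 1 \<longrightarrow> x \<in> E \<zeta> \<longrightarrow> cmod (cinner b x) \<le> \<epsilon> * norm x)"
    for b \<epsilon> \<rho>
  define G where "G = {b. \<forall>\<epsilon>>0. \<exists>\<rho><1. D b \<epsilon> \<rho>}"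
  have DI: "D b \<epsilon> \<rho>" if "\<And>\<zeta> x. \<rho> \<le> cmod \<zeta> \<Longrightarrow> cmod \<zeta> < 1 \<Longrightarrow> x \<in> E \<zeta> \<Longrightarrow> cmod (cinner b x) \<le> \<epsilon> * norm x"
    for b \<epsilon> \<rho>
    using that by (simp add: D_def)
  have DD: "cmod (cinner b x) \<le> \<epsilon> * norm x" if "D b \<epsilon> \<rho>" "\<rho> \<le> cmod \<zeta>" "cmod \<zeta> < 1" "x \<in> E \<zeta>" for b \<epsilon> \<rho> \<zeta> x
    using that by (simp add: D_def)
  have "G = UNIV"
  proof (rule closed_invariant_eq_UNIV)
    show "complex_vector.subspace G"
    proof (rule complex_vector.subspaceI)
      show "0 \<in> G"
        by (auto simp: G_def cinner.zero_left intro!: DI exI[of _ 0])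
    next
      fix a b
      assume a: "a \<in> G" and b: "b \<in> G"
      show "a + b \<in> G"
        unfolding G_def
      proof (rule CollectI, intro allI impI)
        fix \<epsilon> :: real
        assume "0 < \<epsilon>"
        then obtain \<rho> \<rho>' where \<rho>: "\<rho> < 1" "\<rho>' < 1" "D a (\<epsilon>/2) \<rho>" "D b (\<epsilon>/2) \<rho>'"
          using a b half_gt_zero[of \<epsilon>] unfolding G_def by blast
        have "D (a + b) \<epsilon> (max \<rho> \<rho>')"
        proof (rule DI)
          fix \<zeta> x
          assume "max \<rho> \<rho>' \<le> cmod \<zeta>" "cmod \<zeta> < 1" "x \<in> E \<zeta>"
          then have "cmod (cinner a x) \<le> \<epsilon>/2 * norm x" "cmod (cinner b x) \<le> \<epsilon>/2 * norm x"
            using DD[OF \<rho>(3)] DD[OF \<rho>(4)] by auto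
          then show "cmod (cinner (a + b) x) \<le> \<epsilon> * norm x"
            using norm_triangle_ineq[of "cinner a x" "cinner b x"] by (simp add: cinner.add_left)
        qed
        then show "\<exists>\<rho><1. D (a + b) \<epsilon> \<rho>"
          using \<rho> by (intro exI[of _ "max \<rho> \<rho>'"]) auto
      qed
    next
      fix c b
      assume b: "b \<in> G"
      show "c *\<^sub>C b \<in> G"
        unfolding G_def
      proof (rule CollectI, intro allI impI)
        fix \<epsilon> :: real
        assume "0 < \<epsilon>"
        then have "0 < \<epsilon> / (cmod c + 1)"
          by (simp add: add_nonneg_pos)
        then obtain \<rho> where \<rho>: "\<rho> < 1" "D b (\<epsilon> / (cmod c + 1)) \<rho>"
          using b unfolding G_def by blast
        have "D (c *\<^sub>C b) \<epsilon> \<rho>"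
        proof (rule DI)
          fix \<zeta> x
          assume "\<rho> \<le> cmod \<zeta>" "cmod \<zeta> < 1" "x \<in> E \<zeta>"
          then have "cmod (cinner b x) \<le> \<epsilon> / (cmod c + 1) * norm x"
            using DD[OF \<rho>(2)] by auto
          then have "cmod (cinner (c *\<^sub>C b) x) \<le> cmod c * (\<epsilon> / (cmod c + 1) * norm x)"
            unfolding cinner_scaleC_left norm_mult by (rule mult_left_mono) simp
          also have "\<dots> = cmod c / (cmod c + 1) * (\<epsilon> * norm x)"
            by simp
          also have "\<dots> \<le> 1 * (\<epsilon> * norm x)"
            using \<open>0 < \<epsilon>\<close> by (intro mult_right_mono) (auto simp: divide_le_eq add_nonneg_pos)
          finally show "cmod (cinner (c *\<^sub>C b) x) \<le> \<epsilon> * norm x"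
            by simp
        qed
        then show "\<exists>\<rho><1. D (c *\<^sub>C b) \<epsilon> \<rho>"
          using \<rho> by blast
      qed
    qed
    show "closed G"
      unfolding closure_subset_eq[symmetric]
    proof
      fix b
      assume b: "b \<in> closure G"
      show "b \<in> G"
        unfolding G_def
      proof (rule CollectI, intro allI impI)
        fix \<epsilon> :: real
        assume "0 < \<epsilon>"
        then obtain a where a: "a \<in> G" "dist a b < \<epsilon>/2"
          using b unfolding closure_approachable by (meson half_gt_zero)
        then obtain \<rho> where \<rho>: "\<rho> < 1" "D a (\<epsilon>/2) \<rho>"
          using half_gt_zero[OF \<open>0 < \<epsilon>\<close>] unfolding G_def by blast
        have "D b \<epsilon> \<rho>"
        proof (rule DI)
          fix \<zeta> x
          assume "\<rho> \<le> cmod \<zeta>" "cmod \<zeta> < 1" "x \<in> E \<zeta>"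
          then have "cmod (cinner a x) \<le> \<epsilon>/2 * norm x"
            using DD[OF \<rho>(2)] by auto
          moreover have "cmod (cinner (b - a) x) \<le> \<epsilon>/2 * norm x"
            using norm_cinner_le[of "b - a" x] a(2)
            by (smt (verit) dist_norm mult_right_mono norm_ge_zero norm_minus_commute)
          ultimately show "cmod (cinner b x) \<le> \<epsilon> * norm x"
            using norm_triangle_ineq[of "cinner (b - a) x" "cinner a x"] by (simp add: cinner.diff_left)
        qed
        then show "\<exists>\<rho><1. D b \<epsilon> \<rho>"
          using \<rho> by blast
      qed
    qed
  next
    fix w
    assume w: "Us w = 0"
    show "w \<in> G"
      unfolding G_def
    proof (rule CollectI, intro allI impI)
      fix \<epsilon> :: real
      assume e: "0 < \<epsilon>"
      \<comment> \<open>As \<open>1 - (cmod \<zeta>)\<^sup>2\<close> is at most twice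
        \<open>1 - cmod \<zeta>\<close>, beyond this radius its product with
        \<open>(norm w)\<^sup>2 + 1\<close> is at most \<open>\<epsilon>\<^sup>2\<close>. The added
        1 keeps the denominator positive for \<open>w = 0\<close>.\<close>
      define \<rho> where "\<rho> = max 0 (1 - \<epsilon>\<^sup>2 / (2 * ((norm w)\<^sup>2 + 1)))"
      have pos: "0 < (norm w)\<^sup>2 + 1"
        by (simp add: add_nonneg_pos)
      then have \<rho>: "\<rho> < 1" "0 \<le> \<rho>"
        using e by (auto simp: \<rho>_def)
      have "D w \<epsilon> \<rho>"
      proof (rule DI)
        fix \<zeta> x
        assume z: "\<rho> \<le> cmod \<zeta>" "cmod \<zeta> < 1" and x: "x \<in> E \<zeta>"
        have "1 - (cmod \<zeta>)\<^sup>2 = (1 - cmod \<zeta>) * (1 + cmod \<zeta>)"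
          by (simp add: power2_eq_square algebra_simps)
        also have "\<dots> \<le> \<epsilon>\<^sup>2 / (2 * ((norm w)\<^sup>2 + 1)) * 2"
          using z \<rho>(2) by (intro mult_mono) (auto simp: \<rho>_def)
        finally have "((norm w)\<^sup>2 + 1) * (1 - (cmod \<zeta>)\<^sup>2) \<le> \<epsilon>\<^sup>2"
          using pos by (simp add: field_simps)
        moreover have "0 \<le> 1 - (cmod \<zeta>)\<^sup>2"
          using z by (simp add: power_le_one)
        ultimately have "(norm w)\<^sup>2 * (1 - (cmod \<zeta>)\<^sup>2) \<le> \<epsilon>\<^sup>2"
          by (simp add: distrib_right)
        then have "(norm w)\<^sup>2 * (norm (P x))\<^sup>2 \<le> (\<epsilon> * norm x)\<^sup>2"
          unfolding norm_P_E[OF x] power_mult_distrib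
          by (simp add: mult_right_mono flip: mult.assoc)
        then have "norm w * norm (P x) \<le> \<epsilon> * norm x"
          using e by (simp add: abs_le_square_iff[symmetric] abs_mult flip: power_mult_distrib)
        moreover have "cinner w x = cinner w (P x)"
          by (simp add: P_def cinner.diff_right w cinner.zero_left flip: adj')
        ultimately show "cmod (cinner w x) \<le> \<epsilon> * norm x"
          using norm_cinner_le[of w "P x"] by simp
      qed
      then show "\<exists>\<rho><1. D w \<epsilon> \<rho>"
        using \<rho> by blast
    qed
  next
    fix b
    assume b: "b \<in> G"
    show "U b \<in> G"
      unfolding G_def
    proof (rule CollectI, intro allI impI)
      fix \<epsilon> :: real
      assume e: "0 < \<epsilon>"
      then obtain \<rho> where \<rho>: "\<rho> < 1" "D b \<epsilon> \<rho>"
        using b unfolding G_def by blast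
      have "D (U b) \<epsilon> \<rho>"
      proof (rule DI)
        fix \<zeta> x
        assume z: "\<rho> \<le> cmod \<zeta>" "cmod \<zeta> < 1" and x: "x \<in> E \<zeta>"
        have "cmod (cinner (U b) x) = cmod \<zeta> * cmod (cinner b x)"
          by (simp add: adj ED[OF x] cinner_scaleC_right norm_mult)
        also have "\<dots> \<le> 1 * cmod (cinner b x)"
          using z by (intro mult_right_mono) auto
        finally show "cmod (cinner (U b) x) \<le> \<epsilon> * norm x"
          using DD[OF \<rho>(2) z x] by simp
      qed
      then show "\<exists>\<rho><1. D (U b) \<epsilon> \<rho>"
        using \<rho> by blast
    qed
  qed
  then show ?thesis
    using assms unfolding G_def D_def by blast
qed

end

text \<open>The first half of the open mapping theorem, for \<open>T\<close> augmented by the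
  finitely many directions in \<open>F\<close>. An approximate solution with half the error suffices
  for the application, so no iteration to an exact one follows.\<close>

lemma approximate_preimage_bound:
  fixes T :: "'m::{complex_inner, complete_space} \<Rightarrow> 'm"
  assumes T: "clinear T" and F: "finite F"
    and onto: "\<And>x. \<exists>g. \<exists>b\<in>complex_vector.span F. x = T g + b"
  obtains C where "0 < C" "\<And>x. \<exists>g c. norm g \<le> C * norm x \<and> (\<forall>f\<in>F. cmod (c f) \<le> C * norm x) \<and>
      norm (x - (T g + (\<Sum>f\<in>F. c f *\<^sub>C f))) \<le> norm x / 2"
proof -
  define A where "A n = {T g + (\<Sum>f\<in>F. c f *\<^sub>C f) | g c. norm g \<le> real n \<and> (\<forall>f\<in>F. cmod (c f) \<le> real n)}" for n
  have "\<exists>n. x \<in> A n" for x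
  proof -
    obtain g b where gb: "b \<in> complex_vector.span F" "x = T g + b"
      using onto by blast
    then obtain c where c: "b = (\<Sum>f\<in>F. c f *\<^sub>C f)"
      using complex_vector.span_finite[OF F] by auto
    obtain n where n: "norm g + (\<Sum>f\<in>F. cmod (c f)) \<le> real n"
      using real_arch_simple by blast
    have "cmod (c f) \<le> real n" if "f \<in> F" for f
      using member_le_sum[OF that norm_ge_zero F, of c] n norm_ge_zero[of g] by linarith
    moreover have "norm g \<le> real n"
      using n sum_nonneg[of F "\<lambda>f. cmod (c f)"] by simp
    ultimately show ?thesis
      using gb(2) c by (auto simp: A_def)
  qed
  then have cover: "\<Union>(range (\<lambda>n. closure (A n))) = UNIV"
    using closure_subset by blast
  have "\<exists>n. interior (closure (A n)) \<noteq> {}"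
  proof (rule ccontr)
    assume "\<not> ?thesis"
    then have "(euclidean :: 'm topology) interior_of \<Union>(range (\<lambda>n. closure (A n))) = {}"
      by (intro Baire_category_alt) (auto simp: completely_metrizable_space_euclidean)
    then show False
      by (simp add: cover)
  qed
  then obtain n x0 where "x0 \<in> interior (closure (A n))"
    by auto
  then obtain r where r: "0 < r" "ball x0 r \<subseteq> closure (A n)"
    unfolding mem_interior by blast
  have approx: "\<exists>a\<in>A n. norm (y - a) < r / 8" if "norm (y - x0) < r" for y
  proof -
    have "y \<in> closure (A n)"
      using that r(2) by (auto simp: dist_norm norm_minus_commute)
    then show ?thesis
      using r(1) unfolding closure_approachable by (metis dist_commute dist_norm zero_less_divide_iff zero_less_numeral)
  qed
  \<comment> \<open>The first term is \<open>2 * real n / t\<close> per unit of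
    \<open>norm x\<close>, for the scale \<open>t\<close> chosen below; the added 1 makes
    \<open>C\<close> positive even if \<open>n = 0\<close>.\<close>
  define C where "C = 4 * real n / r + 1"
  show ?thesis
  proof (rule that[of C])
    show "0 < C"
      using r(1) by (simp add: C_def add_nonneg_pos)
    fix x
    show "\<exists>g c. norm g \<le> C * norm x \<and> (\<forall>f\<in>F. cmod (c f) \<le> C * norm x) \<and>
      norm (x - (T g + (\<Sum>f\<in>F. c f *\<^sub>C f))) \<le> norm x / 2"
    proof (cases "x = 0")
      case True
      then show ?thesis
        by (intro exI[of _ 0] exI[of _ "\<lambda>_. 0"]) (simp add: clinear_0[OF T] scaleC.zero_left)
    next
      case False
      \<comment> \<open>At this scale \<open>x0 + t *\<^sub>R x\<close> stays in the ball.
        Subtracting the approximations of this point and of \<open>x0\<close> cancels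
        \<open>x0\<close>, and two errors below \<open>r / 8\<close>, divided by \<open>t\<close>,
        amount to at most \<open>norm x / 2\<close>.\<close>
      define t where "t = r / (2 * norm x)"
      have t: "0 < t"
        using False r(1) by (simp add: t_def)
      obtain a1 a0 where a: "a1 \<in> A n" "norm (x0 + t *\<^sub>R x - a1) < r / 8" "a0 \<in> A n" "norm (x0 - a0) < r / 8"
        using approx[of "x0 + t *\<^sub>R x"] approx[of x0] r(1) False by (auto simp: t_def)
      then obtain g1 c1 g0 c0 where
        g1: "a1 = T g1 + (\<Sum>f\<in>F. c1 f *\<^sub>C f)" "norm g1 \<le> n" "\<And>f. f \<in> F \<Longrightarrow> cmod (c1 f) \<le> n" and
        g0: "a0 = T g0 + (\<Sum>f\<in>F. c0 f *\<^sub>C f)" "norm g0 \<le> n" "\<And>f. f \<in> F \<Longrightarrow> cmod (c0 f) \<le> n"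
        unfolding A_def by blast
      define k where "k = complex_of_real (1 / t)"
      have k: "cmod k = 1 / t"
        using t by (simp add: k_def norm_divide)
      have bound: "2 * real n / t \<le> C * norm x"
        using r(1) by (simp add: C_def t_def field_simps)
      define g where "g = k *\<^sub>C (g1 - g0)"
      define c where "c f = k * (c1 f - c0 f)" for f
      have "norm g = norm (g1 - g0) / t"
        by (simp add: g_def norm_scaleC k)
      also have "norm (g1 - g0) / t \<le> 2 * real n / t"
        using t norm_triangle_ineq4[of g1 g0] g1(2) g0(2) by (intro divide_right_mono) auto
      finally have "norm g \<le> C * norm x"
        using bound by simp
      moreover have "cmod (c f) \<le> C * norm x" if f: "f \<in> F" for f
      proof -
        have "cmod (c f) = cmod (c1 f - c0 f) / t"
          by (simp add: c_def norm_mult k)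
        also have "\<dots> \<le> 2 * real n / t"
          using t norm_triangle_ineq4[of "c1 f" "c0 f"] g1(3)[OF f] g0(3)[OF f] by (intro divide_right_mono) auto
        finally show ?thesis
          using bound by simp
      qed
      moreover have "norm (x - (T g + (\<Sum>f\<in>F. c f *\<^sub>C f))) \<le> norm x / 2"
      proof -
        have "x = k *\<^sub>C t *\<^sub>R x"
          using t unfolding k_def scaleC_of_real by simp
        moreover have "T g + (\<Sum>f\<in>F. c f *\<^sub>C f) = k *\<^sub>C (a1 - a0)"
          by (simp add: g_def c_def g1(1) g0(1) clinear_scaleC[OF T] clinear_diff[OF T] scaleC.add_right
              scaleC.diff_right scaleC.diff_left right_diff_distrib sum_subtractf scaleC_scaleC
              complex_vector.scale_sum_right)
        ultimately have "x - (T g + (\<Sum>f\<in>F. c f *\<^sub>C f)) = k *\<^sub>C (t *\<^sub>R x) - k *\<^sub>C (a1 - a0)"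
          by (rule arg_cong2[where f = minus])
        also have "\<dots> = k *\<^sub>C ((x0 + t *\<^sub>R x - a1) - (x0 - a0))"
          unfolding scaleC.diff_right[symmetric] by (rule arg_cong[where f = "scaleC k"]) simp
        finally have "x - (T g + (\<Sum>f\<in>F. c f *\<^sub>C f)) = k *\<^sub>C ((x0 + t *\<^sub>R x - a1) - (x0 - a0))" .
        then have "norm (x - (T g + (\<Sum>f\<in>F. c f *\<^sub>C f))) = norm ((x0 + t *\<^sub>R x - a1) - (x0 - a0)) / t"
          by (simp add: norm_scaleC k)
        also have "\<dots> \<le> (r / 4) / t"
          using t a norm_triangle_ineq4[of "x0 + t *\<^sub>R x - a1" "x0 - a0"] by (intro divide_right_mono) auto
        also have "\<dots> = norm x / 2"
          using r(1) False by (simp add: t_def)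
        finally show ?thesis .
      qed
      ultimately show ?thesis
        by blast
    qed
  qed
qed

section \<open>Contractions commuting with a pure isometry\<close>

lemma summable_bounded_mult_power:
  fixes z :: complex
  assumes "\<And>n. cmod (a n) \<le> M" "cmod z < 1"
  shows "summable (\<lambda>n. a n * z ^ n)"
proof (rule summable_comparison_test')
  show "summable (\<lambda>n. M * cmod z ^ n)"
    using assms(2) by (intro summable_mult summable_geometric) auto
  show "norm (a n * z ^ n) \<le> M * cmod z ^ n" for n
    using assms(1) by (simp add: norm_mult norm_power mult_right_mono)
qed

locale commuting_contraction = pure_isometry U Us
  for U Us :: "'m::{complex_inner, complete_space} \<Rightarrow> 'm" +
  fixes Z Zs :: "'m \<Rightarrow> 'm" and B :: "'m set"
  assumes Z: "clinear Z" and norm_Z: "norm (Z x) \<le> norm x"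
    and Zs: "clinear Zs" and norm_Zs: "norm (Zs x) \<le> norm x"
    and adj_Z: "cinner (Z x) y = cinner x (Zs y)"
    and comm: "U (Z x) = Z (U x)"
    and B: "finite B" "\<exists>b\<in>complex_vector.span B. x - b \<in> range U"
    and fredholm: "\<omega> \<in> \<bbbD> \<Longrightarrow> \<exists>F. finite F \<and>
      (\<forall>x. \<exists>g. \<exists>b\<in>complex_vector.span F. x = (Z g - \<omega> *\<^sub>C g) + b)"
begin

section \<open>Eigenvalues of the adjoint of the contraction on the eigenspaces\<close>

lemma Us_Zs: "Us (Zs x) = Zs (Us x)"
  by (rule cinner_eqI) (simp add: comm flip: adj adj_Z)

lemma Zs_in_E: "x \<in> E \<zeta> \<Longrightarrow> Zs x \<in> E \<zeta>"
  by (rule EI) (simp add: Us_Zs ED clinear_scaleC[OF Zs])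

text \<open>Write \<open>x\<close> approximately as \<open>T g\<close> plus a combination of
  \<open>F\<close> and pair it with itself. The error contributes at most half of
  \<open>(norm x)\<^sup>2\<close> and, by weak decay, the finite part at most a quarter. As
  \<open>cinner (T g) x = cinner g x * (\<mu> - \<omega>)\<close>, the remaining quarter forces
  \<mu> away from \<omega>.\<close>

lemma eigenvalue_separated:
  assumes "\<omega> \<in> \<bbbD>"
  shows "\<exists>\<rho><1. \<exists>\<delta>>0. \<forall>\<zeta> x \<mu>. \<rho> \<le> cmod \<zeta> \<longrightarrow> cmod \<zeta> < 1 \<longrightarrow> x \<in> E \<zeta> \<longrightarrow> x \<noteq> 0 \<longrightarrow>
    Zs x = cnj \<mu> *\<^sub>C x \<longrightarrow> \<delta> \<le> cmod (\<mu> - \<omega>)"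
proof -
  define T where "T g = Z g - \<omega> *\<^sub>C g" for g
  have T: "clinear T"
    by (rule clinearI) (simp_all add: T_def clinear_add[OF Z] clinear_scaleC[OF Z] scaleC.add_right
        scaleC.diff_right scaleC_scaleC mult.commute)
  obtain F where F: "finite F" "\<And>x. \<exists>g. \<exists>b\<in>complex_vector.span F. x = T g + b"
    using fredholm[OF assms] unfolding T_def by metis
  obtain C where C: "0 < C" "\<And>x. \<exists>g c. norm g \<le> C * norm x \<and> (\<forall>f\<in>F. cmod (c f) \<le> C * norm x) \<and>
      norm (x - (T g + (\<Sum>f\<in>F. c f *\<^sub>C f))) \<le> norm x / 2"
    by (rule approximate_preimage_bound[OF T F]) (rule that)
  \<comment> \<open>Small enough that \<open>card F\<close> terms, each with a coefficient bounded
    by \<open>C * norm x\<close>, together stay below the quarter.\<close>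
  define \<eta> where "\<eta> = 1 / (4 * C * (real (card F) + 1))"
  have "C * (real (card F) * \<eta>) = real (card F) / (real (card F) + 1) * (1 / 4)"
    using C(1) by (simp add: \<eta>_def)
  also have "\<dots> \<le> 1 / 4"
    by simp
  finally have \<eta>: "0 < \<eta>" "C * (real (card F) * \<eta>) \<le> 1 / 4"
    using C(1) by (simp_all add: \<eta>_def add_nonneg_pos)
  obtain \<rho> where \<rho>: "\<And>f. \<rho> f < 1" "\<And>f \<zeta> x. \<rho> f \<le> cmod \<zeta> \<Longrightarrow> cmod \<zeta> < 1 \<Longrightarrow> x \<in> E \<zeta> \<Longrightarrow>
      cmod (cinner f x) \<le> \<eta> * norm x"
    using weak_decay[OF \<eta>(1)] by metis
  define \<rho>0 where "\<rho>0 = Max (insert 0 (\<rho> ` F))"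
  have \<rho>0: "\<rho>0 < 1" "\<And>f. f \<in> F \<Longrightarrow> \<rho> f \<le> \<rho>0"
    using F(1) \<rho>(1) by (auto simp: \<rho>0_def)
  have "1 / (4 * C) \<le> cmod (\<mu> - \<omega>)"
    if \<zeta>: "\<rho>0 \<le> cmod \<zeta>" "cmod \<zeta> < 1" and x: "x \<in> E \<zeta>" "x \<noteq> 0" "Zs x = cnj \<mu> *\<^sub>C x" for \<zeta> x \<mu>
  proof -
    obtain g c where g: "norm g \<le> C * norm x" "\<And>f. f \<in> F \<Longrightarrow> cmod (c f) \<le> C * norm x"
      "norm (x - (T g + (\<Sum>f\<in>F. c f *\<^sub>C f))) \<le> norm x / 2"
      using C(2)[of x] by blast
    define R where "R = x - (T g + (\<Sum>f\<in>F. c f *\<^sub>C f))"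
    have "cmod (cinner R x) \<le> norm x / 2 * norm x"
      using norm_cinner_le[of R x] mult_right_mono[OF g(3), of "norm x"] by (simp add: R_def)
    moreover have "cmod (cinner (T g) x) \<le> C * norm x * norm x * cmod (\<mu> - \<omega>)"
    proof -
      have "cinner (T g) x = cinner g x * (\<mu> - \<omega>)"
        by (simp add: T_def cinner_simps adj_Z x(3) algebra_simps)
      then have "cmod (cinner (T g) x) \<le> norm g * norm x * cmod (\<mu> - \<omega>)"
        by (simp add: norm_mult norm_cinner_le mult_right_mono)
      also have "\<dots> \<le> C * norm x * norm x * cmod (\<mu> - \<omega>)"
        by (intro mult_right_mono g) auto
      finally show ?thesis .
    qed
    moreover have "cmod (\<Sum>f\<in>F. c f * cinner f x) \<le> norm x * norm x / 4"
    proof -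
      have "cmod (\<Sum>f\<in>F. c f * cinner f x) \<le> (\<Sum>f\<in>F. (C * norm x) * (\<eta> * norm x))"
        using C(1) by (intro sum_norm_le)
          (auto simp: norm_mult intro!: mult_mono g(2) \<rho>(2)[OF order_trans[OF \<rho>0(2) \<zeta>(1)] \<zeta>(2) x(1)])
      also have "\<dots> = C * (real (card F) * \<eta>) * (norm x * norm x)"
        by simp
      also have "\<dots> \<le> 1 / 4 * (norm x * norm x)"
        by (intro mult_right_mono \<eta>) simp
      finally show ?thesis
        by simp
    qed
    moreover have "cinner x x = cinner R x + cinner (T g) x + (\<Sum>f\<in>F. c f * cinner f x)"
      by (simp add: R_def cinner_simps cinner.sum_left)
    then have "norm x * norm x \<le> cmod (cinner R x) + cmod (cinner (T g) x) + cmod (\<Sum>f\<in>F. c f * cinner f x)"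
      by (metis (no_types, lifting) add_right_mono cinner_self norm_of_real abs_of_nonneg
          norm_triangle_ineq order_trans power2_eq_square zero_le_power2)
    ultimately have "(norm x * norm x) * (1 / 4) \<le> (norm x * norm x) * (C * cmod (\<mu> - \<omega>))"
      by (simp add: algebra_simps)
    then have "1 / 4 \<le> C * cmod (\<mu> - \<omega>)"
      using x(2) by (subst (asm) mult_le_cancel_left_pos) auto
    then show ?thesis
      using C(1) by (simp add: field_simps)
  qed
  moreover have "0 < 1 / (4 * C)"
    using C(1) by simp
  ultimately show ?thesis
    using \<rho>0(1) by blast
qed

text \<open>Compactness: finitely many of the excluded disks around points \<omega> cover
  \<open>cball 0 s\<close>, and the largest of their radii \<rho> serves for all.\<close>

lemma eigenvalues_near_circle:
  assumes "s < 1"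
  shows "\<exists>\<rho><1. \<forall>\<zeta> x \<mu>. \<rho> \<le> cmod \<zeta> \<longrightarrow> cmod \<zeta> < 1 \<longrightarrow> x \<in> E \<zeta> \<longrightarrow> x \<noteq> 0 \<longrightarrow>
    Zs x = cnj \<mu> *\<^sub>C x \<longrightarrow> s < cmod \<mu>"
proof -
  define sep where "sep \<omega> \<rho> \<delta> \<longleftrightarrow> (\<forall>\<zeta> x \<mu>. \<rho> \<le> cmod \<zeta> \<longrightarrow> cmod \<zeta> < 1 \<longrightarrow> x \<in> E \<zeta> \<longrightarrow>
    x \<noteq> 0 \<longrightarrow> Zs x = cnj \<mu> *\<^sub>C x \<longrightarrow> \<delta> \<le> cmod (\<mu> - \<omega>))" for \<omega> \<rho> \<delta>
  have "\<forall>\<omega>. \<exists>\<rho> \<delta>. \<omega> \<in> \<bbbD> \<longrightarrow> \<rho> < 1 \<and> 0 < \<delta> \<and> sep \<omega> \<rho> \<delta>"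
    using eigenvalue_separated unfolding sep_def[symmetric] by blast
  then obtain \<rho> \<delta> where \<rho>: "\<And>\<omega>. \<omega> \<in> \<bbbD> \<Longrightarrow> \<rho> \<omega> < 1" "\<And>\<omega>. \<omega> \<in> \<bbbD> \<Longrightarrow> 0 < \<delta> \<omega>"
    "\<And>\<omega>. \<omega> \<in> \<bbbD> \<Longrightarrow> sep \<omega> (\<rho> \<omega>) (\<delta> \<omega>)"
    by metis
  have disk: "cball 0 s \<subseteq> \<bbbD>"
    using assms by auto
  have "cball 0 s \<subseteq> (\<Union>\<omega>\<in>cball 0 s. ball \<omega> (\<delta> \<omega>))"
    using disk \<rho>(2) by force
  then obtain K where K: "K \<subseteq> cball 0 s" "finite K" "cball 0 s \<subseteq> (\<Union>\<omega>\<in>K. ball \<omega> (\<delta> \<omega>))"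
    using compactE_image[of "cball 0 s" "cball 0 s" "\<lambda>\<omega>. ball \<omega> (\<delta> \<omega>)"] by auto
  define \<rho>0 where "\<rho>0 = Max (insert 0 (\<rho> ` K))"
  have \<rho>0: "\<rho>0 < 1" "\<And>\<omega>. \<omega> \<in> K \<Longrightarrow> \<rho> \<omega> \<le> \<rho>0"
    using K disk \<rho>(1) by (auto simp: \<rho>0_def)
  have "s < cmod \<mu>"
    if \<zeta>: "\<rho>0 \<le> cmod \<zeta>" "cmod \<zeta> < 1" and x: "x \<in> E \<zeta>" "x \<noteq> 0" "Zs x = cnj \<mu> *\<^sub>C x" for \<zeta> x \<mu>
  proof (rule ccontr)
    assume "\<not> s < cmod \<mu>"
    then have "\<mu> \<in> cball 0 s"
      by simp
    then obtain \<omega> where \<omega>: "\<omega> \<in> K" "cmod (\<mu> - \<omega>) < \<delta> \<omega>"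
      using K(3) by (auto simp: dist_norm norm_minus_commute)
    then show False
      using \<rho>(3)[of \<omega>] \<rho>0(2)[of \<omega>] K(1) disk \<zeta> x unfolding sep_def by force
  qed
  then show ?thesis
    using \<rho>0(1) by blast
qed

text \<open>Bounds the dimension of \<open>E \<zeta>\<close> by \<open>card B\<close>, uniformly in
  \<zeta>. Since \<open>P\<close> vanishes on the range of \<open>U\<close>, the wandering vectors
  are already spanned by the images of \<open>B\<close>.\<close>

lemma E_eq_span:
  assumes "cmod \<zeta> < 1"
  shows "complex_vector.span ((\<lambda>b. kernel_vec \<zeta> (P b)) ` B) = E \<zeta>"
proof
  show "complex_vector.span ((\<lambda>b. kernel_vec \<zeta> (P b)) ` B) \<subseteq> E \<zeta>"
    by (rule complex_vector.span_minimal[OF _ subspace_E]) (auto intro!: kernel_vec_in_E assms)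
  show "E \<zeta> \<subseteq> complex_vector.span ((\<lambda>b. kernel_vec \<zeta> (P b)) ` B)"
  proof
    fix x
    assume x: "x \<in> E \<zeta>"
    obtain b y where b: "b \<in> complex_vector.span B" "P x - b = U y"
      using B(2) by blast
    have "P (P x) - P b = 0"
      by (simp add: b(2) flip: clinear_diff[OF P])
    then have Px: "P x = P b"
      by (simp add: P_wandering)
    have KP: "clinear (\<lambda>b. kernel_vec \<zeta> (P b))"
      using clinear_kernel_vec[OF assms] P by (intro clinearI) (simp_all add: clinear_add clinear_scaleC)
    show "x \<in> complex_vector.span ((\<lambda>b. kernel_vec \<zeta> (P b)) ` B)"
      unfolding module_hom.span_image[OF clinear_module_hom[OF KP]]
      using E_eq_kernel_vec[OF assms x] b(1) Px by auto
  qed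
qed

text \<open>A lower bound for the adjoint on the finite-dimensional invariant space \<open>E \<zeta>\<close> makes it
  surjective there, so the bound carries over to \<open>Z\<close> itself.\<close>

lemma Z_lower_bound_E:
  assumes \<zeta>: "cmod \<zeta> < 1" and m: "0 < m" "\<And>x. x \<in> E \<zeta> \<Longrightarrow> m * norm x \<le> norm (Zs x)"
    and x: "x \<in> E \<zeta>"
  shows "m * norm x \<le> norm (Z x)"
proof (cases "x = 0")
  case False
  define S where "S = (\<lambda>b. kernel_vec \<zeta> (P b)) ` B"
  have S: "finite S" "complex_vector.span S = E \<zeta>"
    using B(1) E_eq_span[OF \<zeta>] by (auto simp: S_def)
  obtain b where b: "b \<subseteq> E \<zeta>" "complex_vector.independent b" "E \<zeta> \<subseteq> complex_vector.span b"
    using complex_vector.maximal_independent_subset[of "E \<zeta>"] by blast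
  have fin: "finite b"
    using complex_vector.independent_span_bound[OF S(1) b(2)] b(1) S(2) by simp
  have span_b: "complex_vector.span b = E \<zeta>"
    using b complex_vector.span_minimal[OF b(1) subspace_E] by blast
  have inj: "inj_on Zs (complex_vector.span b)"
  proof (rule inj_onI)
    fix y z
    assume "y \<in> complex_vector.span b" "z \<in> complex_vector.span b" and eq: "Zs y = Zs z"
    then have yz: "y - z \<in> E \<zeta>"
      unfolding span_b using complex_vector.subspace_diff[OF subspace_E] by blast
    then show "y = z"
      using m(1) m(2)[OF yz] eq by (simp add: clinear_diff[OF Zs] mult_le_0_iff)
  qed
  interpret pair: vector_space_pair "scaleC :: complex \<Rightarrow> 'm \<Rightarrow> 'm" "scaleC :: complex \<Rightarrow> 'm \<Rightarrow> 'm" ..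
  have ind: "complex_vector.independent (Zs ` b)"
    using pair.linear_independent_injective_image[OF Zs b(2)] inj by simp
  have card: "card (Zs ` b) = card b"
    using inj complex_vector.span_superset[of b] by (meson card_image inj_on_subset)
  have x_in: "x \<in> complex_vector.span (Zs ` b)"
  proof (rule ccontr)
    assume x': "\<not> ?thesis"
    then have "complex_vector.independent (insert x (Zs ` b))"
      by (rule complex_vector.independent_insertI[OF _ ind])
    moreover have "insert x (Zs ` b) \<subseteq> complex_vector.span b"
      using x b(1) Zs_in_E by (auto simp: span_b)
    ultimately have "card (insert x (Zs ` b)) \<le> card b"
      using complex_vector.independent_span_bound[OF fin] by blast
    moreover have "x \<notin> Zs ` b"
      using x' complex_vector.span_base[of x "Zs ` b"] by argo
    ultimately show False
      using fin card by simp
  qed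
  then obtain y where y: "y \<in> E \<zeta>" "x = Zs y"
    unfolding module_hom.span_image[OF clinear_module_hom[OF Zs]] span_b by blast
  \<comment> \<open>\<open>Z\<close> need not preserve \<open>E \<zeta>\<close>, so its lower bound
    comes from pairing \<open>Z x\<close> with the preimage \<open>y\<close> of \<open>x\<close>
    under \<open>Zs\<close>, whose norm is at most \<open>norm x / m\<close>.\<close>
  have "norm x * norm x = Re (cinner (Z x) y)"
    by (simp add: adj_Z flip: y(2) norm_sq_cinner power2_eq_square)
  also have "\<dots> \<le> norm (Z x) * norm y"
    by (meson complex_Re_le_cmod norm_cinner_le order_trans)
  finally have "m * (norm x * norm x) \<le> norm (Z x) * (m * norm y)"
    using m(1) by (simp add: mult.left_commute)
  also have "\<dots> \<le> norm (Z x) * norm x"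
    using m(2)[OF y(1)] y(2) by (intro mult_left_mono) auto
  finally show ?thesis
    using False by simp
qed simp

text \<open>The same \<open>m\<close> serves for all \<zeta> near the circle, because
  \<open>card B\<close> bounds every dimension involved, and it tends to 1 with
  \<open>s\<close>.\<close>

lemma Z_near_isometric_E:
  assumes s: "0 < s" "s < 1" and m: "m = s - real (card B) * sqrt (1 - s\<^sup>2)" "0 < m"
  shows "\<exists>\<rho><1. \<forall>\<zeta> x. \<rho> \<le> cmod \<zeta> \<longrightarrow> cmod \<zeta> < 1 \<longrightarrow> x \<in> E \<zeta> \<longrightarrow> m * norm x \<le> norm (Z x)"
proof -
  obtain \<rho> where \<rho>: "\<rho> < 1" "\<And>\<zeta> x \<mu>. \<rho> \<le> cmod \<zeta> \<Longrightarrow> cmod \<zeta> < 1 \<Longrightarrow> x \<in> E \<zeta> \<Longrightarrow> x \<noteq> 0 \<Longrightarrow>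
    Zs x = cnj \<mu> *\<^sub>C x \<Longrightarrow> s < cmod \<mu>"
    using eigenvalues_near_circle[OF s(2)] by blast
  have "m * norm x \<le> norm (Z x)" if \<zeta>: "\<rho> \<le> cmod \<zeta>" "cmod \<zeta> < 1" and x: "x \<in> E \<zeta>" for \<zeta> x
  proof (rule Z_lower_bound_E[OF \<zeta>(2) m(2) _ x])
    fix y
    assume y: "y \<in> E \<zeta>"
    note [simp] = E_eq_span[OF \<zeta>(2)]
    show "m * norm y \<le> norm (Zs y)"
      unfolding m(1)
    proof (rule norm_ge_of_eigenvalues_ge[OF Zs, of "(\<lambda>b. kernel_vec \<zeta> (P b)) ` B"])
      show "s \<le> cmod \<mu>" if "v \<in> complex_vector.span ((\<lambda>b. kernel_vec \<zeta> (P b)) ` B)" "v \<noteq> 0"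
        "Zs v = \<mu> *\<^sub>C v" for \<mu> v
        using \<rho>(2)[OF \<zeta>, of v "cnj \<mu>"] that by simp
    qed (use B(1) s y in \<open>auto simp: card_image_le norm_Zs Zs_in_E\<close>)
  qed
  then show ?thesis
    using \<rho>(1) by blast
qed

section \<open>The defect form and its harmonic symbol\<close>

definition defect where "defect x y = cinner x y - cinner (Z x) (Z y)"

text \<open>The form of a Toeplitz operator with respect to \<open>U\<close>: compression by
  \<open>U\<close> does not change it.\<close>

lemma defect_U: "defect (U x) (U y) = defect x y"
  by (simp add: defect_def cinner_U_U flip: comm)

lemma defect_self: "defect x x = complex_of_real ((norm x)\<^sup>2 - (norm (Z x))\<^sup>2)"
  by (simp add: defect_def cinner_self)

lemma norm_defect: "cmod (defect x y) \<le> 2 * norm x * norm y"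
proof -
  have "norm (Z x) * norm (Z y) \<le> norm x * norm y"
    by (intro mult_mono norm_Z) auto
  then show ?thesis
    using norm_triangle_ineq4[of "cinner x y" "cinner (Z x) (Z y)"]
      norm_cinner_le[of x y] norm_cinner_le[of "Z x" "Z y"]
    by (simp add: defect_def)
qed

text \<open>The analytic completion of a harmonic function. The Fourier coefficients of positive
  index are doubled, so that the real part also accounts for their conjugates at negative index;
  \<open>Suc n\<close> and the outer factor \<zeta> start the series at index 1.\<close>

definition symbol where
  "symbol w \<zeta> = defect w w + 2 * \<zeta> * (\<Sum>n. defect w ((U ^^ Suc n) w) * \<zeta> ^ n)"

lemma holomorphic_symbol: "symbol w holomorphic_on \<bbbD>"
proof -
  have "(\<lambda>\<zeta>. \<Sum>n. defect w ((U ^^ Suc n) w) * \<zeta> ^ n) holomorphic_on \<bbbD>"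
  proof (rule power_series_holomorphic)
    fix \<zeta> :: complex
    assume "\<zeta> \<in> \<bbbD>"
    then have "summable (\<lambda>n. defect w ((U ^^ Suc n) w) * \<zeta> ^ n)"
      using norm_defect[of w] norm_funpow_U
      by (intro summable_bounded_mult_power[of _ "2 * norm w * norm w"]) (metis, simp)
    then show "(\<lambda>n. defect w ((U ^^ Suc n) w) * (\<zeta> - 0) ^ n) sums (\<Sum>n. defect w ((U ^^ Suc n) w) * \<zeta> ^ n)"
      by (simp add: summable_sums)
  qed
  then show ?thesis
    unfolding symbol_def by (intro holomorphic_intros)
qed

text \<open>Expanding the kernel vector \<open>k\<close> as \<open>w + cnj \<zeta> *\<^sub>C U k\<close> exhibits the defect of \<open>k\<close>
  as a harmonic function of \<open>\<zeta>\<close>, namely as the Poisson extension of a Toeplitz symbol.\<close>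

lemma Re_symbol:
  fixes w
  assumes \<zeta>: "cmod \<zeta> < 1"
  defines "k \<equiv> kernel_vec \<zeta> w"
  shows "Re (symbol w \<zeta>) = (1 - (cmod \<zeta>)\<^sup>2) * ((norm k)\<^sup>2 - (norm (Z k))\<^sup>2)"
proof -
  have blU: "bounded_linear (\<lambda>y. defect w (U y))"
  proof (rule bounded_linear_intro[where K = "2 * norm w"])
    show "defect w (U (x + y)) = defect w (U x) + defect w (U y)" for x y
      by (simp add: defect_def clinear_add[OF U] clinear_add[OF Z] cinner_simps)
    show "defect w (U (r *\<^sub>R x)) = r *\<^sub>R defect w (U x)" for r x
      using clinear_scaleC[OF U, of "of_real r" x] clinear_scaleC[OF Z, of "of_real r" "U x"]
      by (simp add: defect_def scaleC_of_real cinner.scaleR_right scaleR_diff_right)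
    show "norm (defect w (U x)) \<le> norm x * (2 * norm w)" for x
      using norm_defect[of w "U x"] by (simp add: mult.commute)
  qed
  have "(\<lambda>n. defect w (U (cnj \<zeta> ^ n *\<^sub>C (U ^^ n) w))) sums defect w (U k)"
    unfolding k_def kernel_vec_def
    by (intro bounded_linear.sums[OF blU] summable_sums summable_kernel_vec \<zeta>)
  then have "(\<lambda>n. defect w ((U ^^ Suc n) w) * \<zeta> ^ n) sums defect w (U k)"
    by (simp add: defect_def clinear_scaleC[OF U] clinear_scaleC[OF Z] cinner_scaleC_right algebra_simps)
  then have sym: "symbol w \<zeta> = defect w w + 2 * \<zeta> * defect w (U k)"
    by (simp add: symbol_def sums_iff)
  have k: "k = w + cnj \<zeta> *\<^sub>C U k"
    unfolding k_def by (rule kernel_vec_eq[OF \<zeta>])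
  have "defect k k = defect (w + cnj \<zeta> *\<^sub>C U k) (w + cnj \<zeta> *\<^sub>C U k)"
    by (simp flip: k)
  also have "\<dots> = defect w w + \<zeta> * defect w (U k) + cnj \<zeta> * defect (U k) w + cnj \<zeta> * \<zeta> * defect (U k) (U k)"
    by (simp add: defect_def clinear_add[OF Z] clinear_scaleC[OF Z] cinner_simps algebra_simps)
  also have "defect (U k) w = cnj (defect w (U k))"
    unfolding defect_def complex_cnj_diff by (simp add: cinner_commute[symmetric])
  also have "cnj \<zeta> * \<zeta> * defect (U k) (U k) = complex_of_real ((cmod \<zeta>)\<^sup>2) * defect k k"
    by (simp add: complex_norm_square defect_U mult.commute del: of_real_power)
  finally have "defect k k = defect w w + \<zeta> * defect w (U k) + cnj \<zeta> * cnj (defect w (U k)) +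
      complex_of_real ((cmod \<zeta>)\<^sup>2) * defect k k" .
  \<comment> \<open>The two mixed terms are conjugate, which accounts for the 2 in the symbol.
    Moving the last term, produced by \<open>defect_U\<close>, to the left yields the factor
    \<open>1 - (cmod \<zeta>)\<^sup>2\<close>.\<close>
  from arg_cong[OF this, of Re] show ?thesis
    unfolding sym by (simp add: defect_self algebra_simps)
qed

lemma Z_isometric_wandering:
  assumes w: "Us w = 0"
  shows "norm (Z w) = norm w"
proof -
  define m where "m s = s - real (card B) * sqrt (1 - s\<^sup>2)" for s
  have bound: "(norm w)\<^sup>2 - (norm (Z w))\<^sup>2 \<le> (1 - (m s)\<^sup>2) * (norm w)\<^sup>2" if s: "0 < s" "s < 1" "0 < m s" for s
  proof -
    obtain \<rho> where \<rho>: "\<rho> < 1" "\<And>\<zeta> x. \<rho> \<le> cmod \<zeta> \<Longrightarrow> cmod \<zeta> < 1 \<Longrightarrow> x \<in> E \<zeta> \<Longrightarrow> m s * norm x \<le> norm (Z x)"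
      using Z_near_isometric_E[OF s(1,2) m_def s(3)] by blast
    \<comment> \<open>The circle must lie beyond \<rho>, where the estimate holds, and have positive
      radius, so that it encloses 0.\<close>
    obtain r where r: "max 0 \<rho> < r" "r < 1"
      using \<rho>(1) dense[of "max 0 \<rho>" 1] by auto
    have "Re (symbol w 0) \<le> (1 - (m s)\<^sup>2) * (norm w)\<^sup>2"
    proof (rule maximum_real_frontier[where S = "ball 0 r" and f = "symbol w" and \<xi> = 0])
      show "symbol w holomorphic_on interior (ball 0 r)"
        using r by (intro holomorphic_on_subset[OF holomorphic_symbol]) auto
      show "continuous_on (closure (ball 0 r)) (symbol w)"
        using r by (intro continuous_on_subset[OF holomorphic_on_imp_continuous_on[OF holomorphic_symbol]]) auto
      fix \<zeta> :: complex
      assume "\<zeta> \<in> frontier (ball 0 r)"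
      then have \<zeta>: "\<rho> \<le> cmod \<zeta>" "cmod \<zeta> < 1"
        using r by auto
      define k where "k = kernel_vec \<zeta> w"
      have k: "k \<in> E \<zeta>"
        unfolding k_def by (rule kernel_vec_in_E[OF \<zeta>(2) w])
      have "P k = w"
        by (simp add: P_def ED[OF k] clinear_scaleC[OF U])
           (metis add_diff_cancel_right' k_def kernel_vec_eq[OF \<zeta>(2)])
      \<comment> \<open>The growth of the kernel vector exactly cancels the factor
        \<open>1 - (cmod \<zeta>)\<^sup>2\<close>; the bound on the circle is therefore independent
        of \<open>r\<close>.\<close>
      then have nw: "(norm w)\<^sup>2 = (1 - (cmod \<zeta>)\<^sup>2) * (norm k)\<^sup>2"
        using norm_P_E[OF k] by simp
      have "(m s * norm k)\<^sup>2 \<le> (norm (Z k))\<^sup>2"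
        using \<rho>(2)[OF \<zeta> k] s(3) by (intro power_mono) auto
      then have "(norm k)\<^sup>2 - (norm (Z k))\<^sup>2 \<le> (1 - (m s)\<^sup>2) * (norm k)\<^sup>2"
        by (simp add: power_mult_distrib algebra_simps)
      moreover have "0 \<le> 1 - (cmod \<zeta>)\<^sup>2"
        using \<zeta> by (simp add: power_le_one)
      ultimately have "(1 - (cmod \<zeta>)\<^sup>2) * ((norm k)\<^sup>2 - (norm (Z k))\<^sup>2)
          \<le> (1 - (cmod \<zeta>)\<^sup>2) * ((1 - (m s)\<^sup>2) * (norm k)\<^sup>2)"
        by (rule mult_left_mono)
      then show "Re (symbol w \<zeta>) \<le> (1 - (m s)\<^sup>2) * (norm w)\<^sup>2"
        unfolding Re_symbol[OF \<zeta>(2)] nw k_def[symmetric] by (simp add: mult.left_commute)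
    qed (use r in auto)
    then show ?thesis
      by (simp add: symbol_def defect_self)
  qed
  \<comment> \<open>Only now does \<open>s\<close> tend to 1: the circle, which depends on
    \<open>s\<close>, no longer occurs in the bound.\<close>
  have m1: "((\<lambda>s. m s) \<longlongrightarrow> 1) (at_left 1)"
    unfolding m_def by (rule tendsto_eq_intros | simp)+
  have "((\<lambda>s. (1 - (m s)\<^sup>2) * (norm w)\<^sup>2) \<longlongrightarrow> (1 - 1\<^sup>2) * (norm w)\<^sup>2) (at_left 1)"
    by (intro tendsto_intros m1)
  moreover have "\<forall>\<^sub>F s in at_left 1. (norm w)\<^sup>2 - (norm (Z w))\<^sup>2 \<le> (1 - (m s)\<^sup>2) * (norm w)\<^sup>2"
  proof -
    have "\<forall>\<^sub>F s in at_left 1. 0 < m s"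
      using order_tendstoD(1)[OF m1, of 0] by simp
    moreover have "\<forall>\<^sub>F s in at_left (1::real). s \<in> {0<..<1}"
      by (intro eventually_at_left_real) simp
    ultimately show ?thesis
      by eventually_elim (use bound in auto)
  qed
  ultimately have "(norm w)\<^sup>2 - (norm (Z w))\<^sup>2 \<le> (1 - 1\<^sup>2) * (norm w)\<^sup>2"
    by (rule tendsto_lowerbound) simp
  then have "norm w \<le> norm (Z w)"
    by (simp add: power2_le_iff_abs_le)
  then show ?thesis
    using norm_Z[of w] by simp
qed

text \<open>Preservation of the norm is not visibly a linear condition on \<open>x\<close>, but the
  equivalent equation \<open>Zs (Z x) = x\<close> defines a closed subspace. It is invariant under
  \<open>U\<close>, which is isometric and commutes with \<open>Z\<close>.\<close>

lemma Z_isometric: "norm (Z x) = norm x"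
proof -
  have iso: "norm (Z x) = norm x \<longleftrightarrow> Zs (Z x) = x" for x
  proof
    assume "Zs (Z x) = x"
    then show "norm (Z x) = norm x"
      using norm_Zs[of "Z x"] norm_Z[of x] by simp
  qed (rule adjoint_isometric_vector[OF adj_Z norm_Zs])
  have "{x. Zs (Z x) = x} = UNIV"
  proof (rule closed_invariant_eq_UNIV)
    show "complex_vector.subspace {x. Zs (Z x) = x}"
      by (auto simp: complex_vector.subspace_def clinear_0[OF Z] clinear_0[OF Zs] clinear_add[OF Z]
          clinear_add[OF Zs] clinear_scaleC[OF Z] clinear_scaleC[OF Zs])
    have "bounded_linear Z" "bounded_linear Zs"
      using clinear_bounded_linear[OF Z, of 1] clinear_bounded_linear[OF Zs, of 1] norm_Z norm_Zs by auto
    then have "bounded_linear (\<lambda>x. Zs (Z x))"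
      using bounded_linear_compose by blast
    then show "closed {x. Zs (Z x) = x}"
      by (intro closed_Collect_eq linear_continuous_on continuous_on_id)
    show "w \<in> {x. Zs (Z x) = x}" if "Us w = 0" for w
      using Z_isometric_wandering[OF that] iso by simp
    show "U x \<in> {x. Zs (Z x) = x}" if "x \<in> {x. Zs (Z x) = x}" for x
      using that by (simp flip: iso) (simp flip: comm)
  qed
  then show ?thesis
    using iso by blast
qed

end

section \<open>The Hardy space model of a pure isometry\<close>

text \<open>An orthonormal set of largest size in the range spans it: the normalized error of an
  expansion could otherwise be added. Injectivity of \<open>T\<close> gives the dimension count that
  allows indexing by \<open>'k\<close>.\<close>

lemma finite_dim_orthonormal_basis:
  fixes T :: "complex ^ 'k \<Rightarrow> 'm::complex_inner"
  assumes T: "clinear T" and inj: "inj T"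
  obtains h :: "'k \<Rightarrow> 'm" where "\<And>i. h i \<in> range T"
    "\<And>i j. cinner (h i) (h j) = (if i = j then 1 else 0)"
    "\<And>w. w \<in> range T \<Longrightarrow> w = (\<Sum>i\<in>UNIV. cinner w (h i) *\<^sub>C h i)"
proof -
  interpret pair: vector_space_pair "scaleC :: complex \<Rightarrow> complex ^ 'k \<Rightarrow> complex ^ 'k"
    "scaleC :: complex \<Rightarrow> 'm \<Rightarrow> 'm" ..
  let ?R = "range T"
  have sub: "complex_vector.subspace ?R"
    using module_hom.subspace_image[OF clinear_module_hom[OF T]] complex_vector.subspace_UNIV by blast
  obtain b :: "(complex ^ 'k) set" where b: "complex_vector.independent b" "UNIV \<subseteq> complex_vector.span b"
    by (rule complex_vector.maximal_independent_subset[of "UNIV :: (complex ^ 'k) set"])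
  then have b_UNIV: "complex_vector.span b = UNIV"
    by auto
  have "card b = CARD('k)"
    using complex_vector.dim_eq_card[of b UNIV] b b_UNIV by (simp add: complex_dim_vec)
  moreover from this have "finite b"
    using zero_less_card_finite[where 'a = 'k] by (metis card_ge_0_finite)
  ultimately have fin_b: "finite (T ` b)" "card (T ` b) = CARD('k)"
    using card_image[OF inj_on_subset[OF inj], of b] by simp_all
  have span_b: "complex_vector.span (T ` b) = ?R"
    unfolding module_hom.span_image[OF clinear_module_hom[OF T]] b_UNIV ..
  have "complex_vector.independent (T ` b)"
    using pair.linear_independent_injective_image[OF T b(1)] inj_on_subset[OF inj] by simp
  then have dim: "complex_vector.dim ?R = CARD('k)"
    using complex_vector.dim_eq_card_independent fin_b(2) complex_vector.dim_span[of "T ` b"]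
    by (metis span_b)
  define orthonormal :: "'m set \<Rightarrow> bool" where
    "orthonormal S \<longleftrightarrow> finite S \<and> S \<subseteq> ?R \<and> (\<forall>x\<in>S. \<forall>y\<in>S. cinner x y = (if x = y then 1 else 0))" for S
  have indep: "complex_vector.independent S" if S: "orthonormal S" for S
  proof (rule complex_vector.independent_if_scalars_zero)
    fix u e
    assume u: "(\<Sum>x\<in>S. u x *\<^sub>C x) = 0" and e: "e \<in> S"
    have "cinner (\<Sum>x\<in>S. u x *\<^sub>C x) e = (\<Sum>x\<in>S. if x = e then u x else 0)"
      unfolding cinner.sum_left using S e by (intro sum.cong) (auto simp: orthonormal_def cinner_scaleC_left)
    then show "u e = 0"
      using S e by (simp add: u orthonormal_def cinner.zero_left)
  qed (use S in \<open>simp add: orthonormal_def\<close>)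
  have card_le: "card S \<le> CARD('k)" if "orthonormal S" for S
    using complex_vector.independent_span_bound[OF fin_b(1) indep[OF that]] that fin_b(2)
    by (simp add: orthonormal_def span_b)
  have "orthonormal {}"
    by (simp add: orthonormal_def)
  then have "\<exists>S. orthonormal S \<and> (\<forall>S'. orthonormal S' \<longrightarrow> card S' \<le> card S)"
    by (rule ex_has_greatest_nat[where b = "Suc CARD('k)"]) (simp add: card_le less_Suc_eq_le)
  then obtain S where S: "orthonormal S" and max: "\<And>S'. orthonormal S' \<Longrightarrow> card S' \<le> card S"
    by auto
  have exp: "w = (\<Sum>e\<in>S. cinner w e *\<^sub>C e)" if w: "w \<in> ?R" for w
  proof (rule ccontr)
    assume neq: "w \<noteq> (\<Sum>e\<in>S. cinner w e *\<^sub>C e)"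
    define y where "y = w - (\<Sum>e\<in>S. cinner w e *\<^sub>C e)"
    define v where "v = complex_of_real (inverse (norm y)) *\<^sub>C y"
    have y0: "y \<noteq> 0"
      using neq by (simp add: y_def)
    have "cinner y e = 0" if e: "e \<in> S" for e
    proof -
      have "cinner (\<Sum>x\<in>S. cinner w x *\<^sub>C x) e = (\<Sum>x\<in>S. if x = e then cinner w x else 0)"
        unfolding cinner.sum_left using S e by (intro sum.cong) (auto simp: orthonormal_def cinner_scaleC_left)
      then show ?thesis
        using S e by (simp add: y_def cinner.diff_left orthonormal_def)
    qed
    then have orth: "cinner v e = 0" "cinner e v = 0" if "e \<in> S" for e
      using that cinner_eq_0_commute[of y e] by (simp_all add: v_def cinner_simps)
    have "norm v = 1"
      using y0 by (simp add: v_def norm_scaleC norm_inverse)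
    then have vv: "cinner v v = 1"
      by (simp add: cinner_self)
    have "v \<in> ?R"
      unfolding v_def y_def using S w
      by (intro complex_vector.subspace_scale[OF sub] complex_vector.subspace_diff[OF sub]
          complex_vector.subspace_sum[OF sub]) (auto simp: orthonormal_def)
    then have "orthonormal (insert v S)"
      using S orth vv by (auto simp: orthonormal_def)
    moreover have "v \<notin> S"
      using orth vv by force
    ultimately show False
      using max[of "insert v S"] S by (simp add: orthonormal_def)
  qed
  have "?R \<subseteq> complex_vector.span S"
  proof
    fix w
    assume "w \<in> ?R"
    from exp[OF this] show "w \<in> complex_vector.span S"
      by (metis (no_types, lifting) complex_vector.span_base complex_vector.span_scale complex_vector.span_sum)
  qed
  moreover have "complex_vector.span S \<subseteq> ?R"
    using S by (intro complex_vector.span_minimal[OF _ sub]) (simp add: orthonormal_def)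
  ultimately have "complex_vector.span S = complex_vector.span ?R"
    by (simp add: complex_vector.span_span)
  then have "card S = CARD('k)"
    using complex_vector.dim_eq_card[OF _ indep[OF S], of ?R] dim by simp
  then obtain h :: "'k \<Rightarrow> 'm" where h: "bij_betw h UNIV S"
    using finite_same_card_bij[of "UNIV :: 'k set" S] S by (auto simp: orthonormal_def)
  show ?thesis
  proof (rule that[of h])
    have inS: "h i \<in> S" for i
      using h by (auto simp: bij_betw_def)
    then show "h i \<in> ?R" for i
      using S by (auto simp: orthonormal_def)
    show "cinner (h i) (h j) = (if i = j then 1 else 0)" for i j
    proof -
      have "cinner (h i) (h j) = (if h i = h j then 1 else 0)"
        using S inS[of i] inS[of j] unfolding orthonormal_def by blast
      then show ?thesis
        using inj_eq[OF bij_betw_imp_inj_on[OF h]] by simp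
    qed
    show "w = (\<Sum>i\<in>UNIV. cinner w (h i) *\<^sub>C h i)" if "w \<in> ?R" for w
      using exp[OF that] sum.reindex_bij_betw[OF h, of "\<lambda>e. cinner w e *\<^sub>C e"] by simp
  qed
qed

section \<open>Decay of the adjoint powers and Wold coordinates\<close>

context pure_isometry
begin

lemma clinear_funpow_Us: "clinear (Us ^^ n)"
  by (induction n) (auto intro!: clinearI simp: clinear_add[OF Us] clinear_scaleC[OF Us] clinear_add clinear_scaleC)

lemma norm_funpow_Us: "norm ((Us ^^ n) x) \<le> norm x"
  by (induction n) (auto intro: order_trans[OF norm_Us])

lemma adj_funpow: "cinner ((U ^^ n) x) y = cinner x ((Us ^^ n) y)"
  by (induction n arbitrary: y) (simp_all add: adj funpow_swap1[of Us])

lemma cinner_funpow_U: "cinner ((U ^^ n) x) ((U ^^ n) y) = cinner x y"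
  by (induction n) (simp_all add: cinner_U_U)

text \<open>Purity in adjoint form, needed to remove the remainder of a telescoping sum.
  \<open>Us\<close> kills wandering vectors at once, \<open>U\<close> merely delays the sequence,
  and the common bound on the powers makes the set of good vectors closed.\<close>

lemma funpow_Us_tendsto_0: "(\<lambda>n. (Us ^^ n) x) \<longlonglongrightarrow> 0"
proof -
  let ?G = "{x. (\<lambda>n. (Us ^^ n) x) \<longlonglongrightarrow> 0}"
  have "?G = UNIV"
  proof (rule closed_invariant_eq_UNIV)
    show "complex_vector.subspace ?G"
    proof (rule complex_vector.subspaceI)
      show "0 \<in> ?G"
        by (simp add: clinear_0[OF clinear_funpow_Us])
      show "x + y \<in> ?G" if "x \<in> ?G" "y \<in> ?G" for x y
        using that tendsto_add[of _ 0 _ _ 0] by (simp add: clinear_add[OF clinear_funpow_Us])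
      show "c *\<^sub>C x \<in> ?G" if "x \<in> ?G" for c x
        using that scaleC.tendsto[OF tendsto_const[of c], of _ 0]
        by (simp add: clinear_scaleC[OF clinear_funpow_Us] scaleC.zero_right)
    qed
    show "closed ?G"
      unfolding closure_subset_eq[symmetric]
    proof
      fix x
      assume x: "x \<in> closure ?G"
      show "x \<in> ?G"
      proof (rule CollectI, rule LIMSEQ_I)
        fix r :: real
        assume "0 < r"
        then obtain g where g: "(\<lambda>n. (Us ^^ n) g) \<longlonglongrightarrow> 0" "dist g x < r / 2"
          using x unfolding closure_approachable by (metis half_gt_zero mem_Collect_eq)
        then obtain N where N: "\<And>n. N \<le> n \<Longrightarrow> norm ((Us ^^ n) g) < r / 2"
          using LIMSEQ_D[OF g(1) half_gt_zero[OF \<open>0 < r\<close>]] by auto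
        have "norm ((Us ^^ n) x) < r" if "N \<le> n" for n
        proof -
          have "norm ((Us ^^ n) (x - g)) < r / 2"
            using norm_funpow_Us[of n "x - g"] g(2) by (simp add: dist_norm norm_minus_commute)
          then show ?thesis
            using N[OF that] norm_triangle_ineq[of "(Us ^^ n) (x - g)" "(Us ^^ n) g"]
            by (simp add: clinear_diff[OF clinear_funpow_Us])
        qed
        then show "\<exists>no. \<forall>n\<ge>no. norm ((Us ^^ n) x - 0) < r"
          by auto
      qed
    qed
    show "w \<in> ?G" if w: "Us w = 0" for w
    proof -
      have "(Us ^^ Suc n) w = 0" for n
        by (induction n) (simp_all add: w clinear_0[OF Us])
      then have "(\<lambda>n. (Us ^^ Suc n) w) \<longlonglongrightarrow> 0"
        by simp
      then show ?thesis
        by (simp only: mem_Collect_eq) (rule LIMSEQ_imp_Suc)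
    qed
    show "U x \<in> ?G" if "x \<in> ?G" for x
    proof -
      have "(Us ^^ Suc n) (U x) = (Us ^^ n) x" for n
        by (simp add: funpow_swap1[of Us])
      then have "(\<lambda>n. (Us ^^ Suc n) (U x)) \<longlonglongrightarrow> 0"
        using that by simp
      then show ?thesis
        by (simp only: mem_Collect_eq) (rule LIMSEQ_imp_Suc)
    qed
  qed
  then show ?thesis
    by blast
qed

end

locale hardy_model = pure_isometry U Us
  for U Us :: "'m::{complex_inner, complete_space} \<Rightarrow> 'm" +
  fixes h :: "'k::finite \<Rightarrow> 'm"
  assumes h: "Us (h i) = 0"
    and orthonormal: "cinner (h i) (h j) = (if i = j then 1 else 0)"
    and expansion: "Us w = 0 \<Longrightarrow> w = (\<Sum>i\<in>UNIV. cinner w (h i) *\<^sub>C h i)"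
begin

text \<open>Coordinates of \<open>P ((Us ^^ n) x)\<close>, the wandering component of
  \<open>x\<close> at level \<open>n\<close>. The projection can be omitted since each
  \<open>h i\<close> is orthogonal to the range of \<open>U\<close>.\<close>

definition coef :: "'m \<Rightarrow> nat \<Rightarrow> complex ^ 'k"
  where "coef x n = (\<chi> i. cinner ((Us ^^ n) x) (h i))"

lemma clinear_coef: "clinear (\<lambda>x. coef x n)"
  by (rule clinearI) (simp_all add: coef_def vec_eq_iff scaleC_vec_def scaleC_complex_def
      clinear_add[OF clinear_funpow_Us] clinear_scaleC[OF clinear_funpow_Us] cinner_simps)

text \<open>Parseval in the basis \<open>h\<close> for the projected vectors; in this form the sum
  over \<open>n\<close> telescopes.\<close>

lemma cinner_coef: "cinner (coef x n) (coef y n) =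
    cinner ((Us ^^ n) x) ((Us ^^ n) y) - cinner ((Us ^^ Suc n) x) ((Us ^^ Suc n) y)"
proof -
  have P_h: "cinner (P z) (h i) = cinner z (h i)" for z i
    by (simp add: P_def cinner.diff_left adj h cinner.zero_right)
  let ?x = "P ((Us ^^ n) x)" and ?y = "P ((Us ^^ n) y)"
  have "cinner (coef x n) (coef y n) = (\<Sum>i\<in>UNIV. cinner ?x (h i) * cnj (cinner ?y (h i)))"
    by (simp add: cinner_vec_def coef_def cinner_complex_def P_h)
  also have "\<dots> = cinner ?x (\<Sum>i\<in>UNIV. cinner ?y (h i) *\<^sub>C h i)"
    by (simp add: cinner.sum_right cinner_scaleC_right mult.commute)
  also have "\<dots> = cinner ?x ?y"
    using expansion[of ?y] by simp
  finally show ?thesis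
    by (simp add: cinner_P_P)
qed

lemma cinner_coef_sums: "(\<lambda>n. cinner (coef x n) (coef y n)) sums cinner x y"
proof -
  have "(\<lambda>n. cinner ((Us ^^ n) x) ((Us ^^ n) y)) \<longlonglongrightarrow> cinner (0 :: 'm) (0 :: 'm)"
    by (rule cinner.tendsto) (rule funpow_Us_tendsto_0)+
  from telescope_sums'[OF this] show ?thesis
    by (simp add: cinner_coef cinner.zero_right)
qed

lemma norm_coef_le: "norm (coef x n) \<le> norm x"
proof -
  have "(norm (coef x n))\<^sup>2 \<le> (norm ((Us ^^ n) x))\<^sup>2"
    by (simp add: norm_sq_cinner cinner_coef) (simp flip: norm_sq_cinner)
  then show ?thesis
    using norm_funpow_Us[of n x] by (meson order_trans power2_le_imp_le norm_ge_zero)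
qed

lemma norm_sq_coef_summable: "summable (\<lambda>n. (norm (coef x n))\<^sup>2)"
  unfolding norm_sq_cinner using sums_Re[OF cinner_coef_sums[of x x]] by (rule sums_summable)

definition V :: "'m \<Rightarrow> complex \<Rightarrow> complex ^ 'k"
  where "V x z = (if z \<in> \<bbbD> then \<Sum>n. z ^ n *\<^sub>C coef x n else 0)"

lemma coef_sums_V:
  assumes "z \<in> \<bbbD>"
  shows "(\<lambda>n. z ^ n *\<^sub>C coef x n) sums V x z"
proof -
  have "summable (\<lambda>n. z ^ n *\<^sub>C coef x n)"
  proof (rule summable_of_norm_le)
    show "summable (\<lambda>n. cmod z ^ n * norm x)"
      using assms by (intro summable_mult2 summable_geometric) auto
    show "norm (z ^ n *\<^sub>C coef x n) \<le> cmod z ^ n * norm x" for n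
      by (simp add: norm_scaleC norm_power norm_coef_le mult_left_mono)
  qed
  then show ?thesis
    using assms by (simp add: V_def summable_sums)
qed

lemma has_taylor_coeffs_V: "has_taylor_coeffs (V x) (coef x)"
  by (simp add: has_taylor_coeffs_def coef_sums_V del: mem_ball)

lemma hardy_cinner_V: "hardy_cinner (V x) (V y) = cinner x y"
  unfolding hardy_cinner_def taylor_coeff_eq[OF has_taylor_coeffs_V]
  by (rule sums_unique[symmetric, OF cinner_coef_sums])

lemma V_in_hardy_space: "V x \<in> hardy_space"
  unfolding hardy_space_def using has_taylor_coeffs_V norm_sq_coef_summable by (auto simp: V_def)

lemma V_add: "V (x + y) z = V x z + V y z"
proof (cases "z \<in> \<bbbD>")
  case True
  have "(\<lambda>n. z ^ n *\<^sub>C coef (x + y) n) sums (V x z + V y z)"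
    using sums_add[OF coef_sums_V[OF True, of x] coef_sums_V[OF True, of y]]
    by (simp add: clinear_add[OF clinear_coef] scaleC.add_right)
  then show ?thesis
    using coef_sums_V[OF True] sums_unique2 by blast
qed (simp add: V_def)

lemma V_scaleC: "V (c *\<^sub>C x) z = c *\<^sub>C V x z"
proof (cases "z \<in> \<bbbD>")
  case True
  have "(\<lambda>n. z ^ n *\<^sub>C coef (c *\<^sub>C x) n) sums (c *\<^sub>C V x z)"
    using bounded_linear.sums[OF scaleC.bounded_linear_right[of c] coef_sums_V[OF True, of x]]
    by (simp add: clinear_scaleC[OF clinear_coef] scaleC_scaleC mult.commute)
  then show ?thesis
    using coef_sums_V[OF True] sums_unique2 by blast
qed (simp add: V_def scaleC.zero_right)

lemma clinear_V: "clinear (\<lambda>x. V x z)"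
  by (rule clinearI) (simp_all add: V_add V_scaleC)

lemma V_U: "V (U x) z = z *\<^sub>C V x z"
proof (cases "z \<in> \<bbbD>")
  case True
  \<comment> \<open>The constant coefficient vanishes, so shifting the index by one loses
    nothing.\<close>
  have 0: "coef (U x) 0 = 0"
    by (simp add: coef_def vec_eq_iff adj h cinner.zero_right)
  have "(\<lambda>n. z *\<^sub>C z ^ n *\<^sub>C coef x n) sums (z *\<^sub>C V x z)"
    by (intro bounded_linear.sums[OF scaleC.bounded_linear_right] coef_sums_V True)
  also have "(\<lambda>n. z *\<^sub>C z ^ n *\<^sub>C coef x n) = (\<lambda>n. z ^ Suc n *\<^sub>C coef (U x) (Suc n))"
    by (simp add: fun_eq_iff scaleC_scaleC coef_def funpow_swap1[of Us])
  finally have "(\<lambda>n. z ^ n *\<^sub>C coef (U x) n) sums (z *\<^sub>C V x z)"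
    by (subst (asm) sums_Suc_iff) (simp add: 0 scaleC.zero_right)
  then show ?thesis
    using coef_sums_V[OF True] sums_unique2 by blast
qed (simp add: V_def scaleC.zero_right)

text \<open>Continuity of evaluation at a fixed point, which later lets the module property pass to
  a limit. Uniformly bounded coefficients and a geometric series suffice.\<close>

lemma norm_V_le:
  assumes "z \<in> \<bbbD>"
  shows "norm (V x z) \<le> norm x / (1 - cmod z)"
proof -
  have z: "norm (cmod z) < 1"
    using assms by simp
  have le: "norm (z ^ n *\<^sub>C coef x n) \<le> cmod z ^ n * norm x" for n
    by (simp add: norm_scaleC norm_power norm_coef_le mult_left_mono)
  have "norm (\<Sum>n. z ^ n *\<^sub>C coef x n) \<le> (\<Sum>n. cmod z ^ n * norm x)"
    by (intro norm_suminf_le le summable_mult2 summable_geometric z)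
  also have "\<dots> = (\<Sum>n. cmod z ^ n) * norm x"
    by (intro suminf_mult2[symmetric] summable_geometric z)
  finally show ?thesis
    using assms suminf_geometric[OF z] by (simp add: V_def)
qed

lemma inj_V: "inj V"
proof (rule injI)
  fix x y
  assume "V x = V y"
  then have "cinner x z = cinner y z" for z
    using hardy_cinner_V[of x z] hardy_cinner_V[of y z] by simp
  then show "x = y"
    using cinner_eqI cinner_commute by metis
qed

lemma funpow_orthogonal:
  assumes "Us w = 0" "Us w' = 0" "m \<noteq> n"
  shows "cinner ((U ^^ m) w) ((U ^^ n) w') = 0"
proof -
  have lt: "cinner ((U ^^ m) w) ((U ^^ n) w') = 0" if w: "Us w = 0" and mn: "m < n" for m n w w'
  proof -
    have "(Us ^^ m) ((U ^^ m) z) = z" for z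
      by (induction m) (simp_all add: funpow_swap1[of Us])
    moreover obtain k where n: "n = m + Suc k"
      using less_imp_Suc_add[OF mn] by auto
    have "(U ^^ n) w' = (U ^^ m) (U ((U ^^ k) w'))"
      by (simp only: n funpow_add o_apply funpow.simps)
    ultimately have "cinner ((U ^^ m) w) ((U ^^ n) w') = cinner w (U ((U ^^ k) w'))"
      by (simp add: adj_funpow)
    also have "\<dots> = 0"
      by (simp add: w cinner.zero_left flip: adj')
    finally show ?thesis .
  qed
  show ?thesis
    using lt[of w m n w'] lt[of w' n m w] assms cinner_eq_0_commute[of "(U ^^ m) w"]
    by (cases m n rule: linorder_cases) auto
qed

text \<open>The preimage is the sum of \<open>(U ^^ n) (w n)\<close>, where the wandering vector
  \<open>w n\<close> has coordinates \<open>a n\<close>. These terms are orthogonal, so square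
  summability gives convergence.\<close>

lemma coef_surj:
  fixes a :: "nat \<Rightarrow> complex ^ 'k"
  assumes a: "summable (\<lambda>n. (norm (a n))\<^sup>2)"
  obtains x where "coef x = a"
proof -
  define w where "w n = (\<Sum>i\<in>UNIV. (a n $ i) *\<^sub>C h i)" for n
  have w: "Us (w n) = 0" for n
    by (simp add: w_def clinear_sum[OF Us] clinear_scaleC[OF Us] h scaleC.zero_right)
  have w_h: "cinner (w n) (h j) = a n $ j" for n j
  proof -
    have "cinner (w n) (h j) = (\<Sum>i\<in>UNIV. if i = j then a n $ i else 0)"
      unfolding w_def cinner.sum_left by (intro sum.cong) (simp_all add: cinner_scaleC_left orthonormal)
    then show ?thesis
      by simp
  qed
  have "cinner (w n) (w n) = (\<Sum>i\<in>UNIV. cnj (a n $ i) * (a n $ i))" for n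
    by (subst (2) w_def) (simp add: cinner.sum_right cinner_scaleC_right w_h)
  then have "cinner (w n) (w n) = cinner (a n) (a n)" for n
    by (simp add: cinner_vec_def cinner_complex_def mult.commute)
  then have norm_w: "(norm (w n))\<^sup>2 = (norm (a n))\<^sup>2" for n
    by (simp add: norm_sq_cinner)
  have "summable (\<lambda>n. (U ^^ n) (w n))"
  proof (rule summable_of_sum_norm_le[OF a, of _ 2])
    fix A :: "nat set"
    assume "finite A"
    then show "norm (\<Sum>n\<in>A. (U ^^ n) (w n)) ^ 2 \<le> (\<Sum>n\<in>A. (norm (a n))\<^sup>2)"
    proof induction
      case (insert m A)
      have "cinner ((U ^^ m) (w m)) (\<Sum>n\<in>A. (U ^^ n) (w n)) = 0"
        unfolding cinner.sum_right using insert(2) by (intro sum.neutral ballI funpow_orthogonal w) auto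
      then show ?case
        using insert by (simp add: norm_sq_add_orthogonal norm_w)
    qed simp
  qed simp
  then obtain x where x: "(\<lambda>n. (U ^^ n) (w n)) sums x"
    by (auto simp: summable_def)
  show ?thesis
  proof (rule that[of x], rule ext, rule iffD2[OF vec_eq_iff], rule allI)
    fix n j
    have "(\<lambda>m. cinner ((U ^^ m) (w m)) ((U ^^ n) (h j))) sums cinner x ((U ^^ n) (h j))"
      by (intro bounded_linear.sums[OF cinner.bounded_linear_left] x)
    moreover have "(\<lambda>m. cinner ((U ^^ m) (w m)) ((U ^^ n) (h j))) =
        (\<lambda>m. if m = n then cinner ((U ^^ m) (w m)) ((U ^^ n) (h j)) else 0)"
      by (auto simp: fun_eq_iff funpow_orthogonal w h)
    ultimately have "(\<lambda>m. if m = n then cinner ((U ^^ m) (w m)) ((U ^^ n) (h j)) else 0) sums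
        cinner x ((U ^^ n) (h j))"
      by simp
    then have "cinner x ((U ^^ n) (h j)) = cinner ((U ^^ n) (w n)) ((U ^^ n) (h j))"
      by (rule sums_unique2[OF _ sums_single])
    also have "\<dots> = cinner (w n) (h j)"
      by (rule cinner_funpow_U)
    finally have "cinner x ((U ^^ n) (h j)) = a n $ j"
      by (simp add: w_h)
    then show "coef x n $ j = a n $ j"
      using adj_funpow[of n "h j" x] cinner_commute by (metis coef_def vec_lambda_beta)
  qed
qed

lemma range_V: "range V = hardy_space"
proof
  show "range V \<subseteq> hardy_space"
    using V_in_hardy_space by blast
  show "hardy_space \<subseteq> range V"
  proof
    fix f :: "complex \<Rightarrow> complex ^ 'k"
    assume f: "f \<in> hardy_space"
    then obtain a where a: "has_taylor_coeffs f a" "summable (\<lambda>n. (norm (a n))\<^sup>2)"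
      and zero: "\<And>z. z \<notin> \<bbbD> \<Longrightarrow> f z = 0"
      by (auto simp: hardy_space_def)
    obtain x where x: "coef x = a"
      using coef_surj[OF a(2)] by blast
    have "f z = V x z" for z
    proof (cases "z \<in> \<bbbD>")
      case True
      then show ?thesis
        using a(1) coef_sums_V[of z x] x unfolding has_taylor_coeffs_def by (metis sums_unique2)
    qed (simp add: zero V_def)
    then show "f \<in> range V"
      by (auto simp: fun_eq_iff)
  qed
qed

end

section \<open>Quasi-free modules\<close>

lemma disk_fun_simps:
  "disk_fun (f + g) z = disk_fun f z + disk_fun g z"
  "disk_fun (f - g) z = disk_fun f z - disk_fun g z"
  "disk_fun (f * g) z = disk_fun f z * disk_fun g z"
  by (simp_all only: plus_disk_algebra.rep_eq times_disk_algebra.rep_eq minus_disk_algebra_def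
      uminus_disk_algebra.rep_eq add_uminus_conv_diff[where 'a = complex])

lemma disk_fun_poly: "disk_fun (disk_poly p) z = (if z \<in> \<bbbD> then poly p z else 0)"
  by (simp add: disk_poly.rep_eq on_disk_def)

lemma disk_poly_mult: "disk_poly (p * q) = disk_poly p * disk_poly q"
  by transfer (auto simp: on_disk_def fun_eq_iff)

lemma disk_poly_diff: "disk_poly (p - q) = disk_poly p - disk_poly q"
  by (rule disk_fun_inject[THEN iffD1]) (auto simp: fun_eq_iff disk_fun_simps disk_fun_poly)

lemma disk_norm_le:
  assumes "\<And>z. z \<in> \<bbbD> \<Longrightarrow> cmod (disk_fun \<phi> z) \<le> M"
  shows "disk_norm \<phi> \<le> M"
  unfolding disk_norm_def using assms by (intro cSUP_least) auto

text \<open>Division is carried out for functions analytic on the closed disk, which are dense.\<close>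

lemma disk_algebra_division:
  assumes z0: "z0 \<in> \<bbbD>" and \<epsilon>: "0 < \<epsilon>"
  shows "\<exists>g. disk_norm (\<phi> - disk_poly [:disk_fun \<phi> z0:] - disk_poly [:- z0, 1:] * g) \<le> \<epsilon>"
proof -
  have "disk_limit (disk_fun \<phi>)"
    using disk_fun[of \<phi>] by simp
  then obtain \<psi> where \<psi>: "\<And>n::nat. \<psi> n analytic_on cball 0 1"
    and lim: "uniform_limit \<bbbD> \<psi> (disk_fun \<phi>) sequentially"
    unfolding disk_limit_def by blast
  have "\<exists>n. \<forall>z\<in>\<bbbD>. dist (\<psi> n z) (disk_fun \<phi> z) < \<epsilon> / 2"
    using uniform_limitD[OF lim half_gt_zero[OF \<epsilon>]] eventually_happens trivial_limit_sequentially by blast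
  then obtain n where n: "\<And>z. z \<in> \<bbbD> \<Longrightarrow> cmod (\<psi> n z - disk_fun \<phi> z) < \<epsilon> / 2"
    unfolding dist_norm by blast
  define p where "p z = \<psi> n z - \<psi> n z0" for z
  define h where "h z = (if z = z0 then deriv p z0 else p z / (z - z0))" for z
  have p: "p analytic_on cball 0 1"
    unfolding p_def by (intro analytic_intros \<psi>)
  have ph: "p z = (z - z0) * h z" for z
    by (simp add: h_def p_def)
  have "h analytic_on cball 0 1"
  proof (rule pole_theorem_analytic_0[OF p, of z0])
    show "\<exists>d>0. \<forall>w\<in>ball z d - {z0}. p w = (w - z0) * h w" for z
      using ph by (intro exI[of _ 1]) simp
  qed (simp_all add: h_def p_def)
  then have "disk_limit (on_disk h)"
    by (simp add: disk_limit_analytic)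
  then have g: "disk_fun (Abs_disk_algebra (on_disk h)) = on_disk h"
    by (intro Abs_disk_algebra_inverse) (simp add: on_disk_def)
  have "cmod (disk_fun \<phi> z - disk_fun \<phi> z0 - (z - z0) * h z) \<le> \<epsilon>" if z: "z \<in> \<bbbD>" for z
  proof -
    \<comment> \<open>Dividing the approximant exactly leaves only its approximation errors at
      \<open>z0\<close> and at \<open>z\<close>.\<close>
    have eq: "disk_fun \<phi> z - disk_fun \<phi> z0 - (z - z0) * h z = (\<psi> n z0 - disk_fun \<phi> z0) - (\<psi> n z - disk_fun \<phi> z)"
      by (simp add: p_def flip: ph)
    show ?thesis
      unfolding eq
      using n[OF z] n[OF z0] norm_triangle_ineq4[of "\<psi> n z0 - disk_fun \<phi> z0" "\<psi> n z - disk_fun \<phi> z"]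
      by simp
  qed
  then show ?thesis
    by (intro exI[of _ "Abs_disk_algebra (on_disk h)"] disk_norm_le)
       (simp add: disk_fun_simps disk_fun_poly g on_disk_def algebra_simps)
qed

section \<open>Multiplication by the coordinate and approximate division\<close>

context hilbert_module
begin

lemma clinear_act: "clinear (act \<phi>)"
proof (rule clinearI)
  show "act \<phi> (c *\<^sub>C x) = c *\<^sub>C act \<phi> x" for c x
    by (simp add: mult.commute flip: act_const)
qed (rule scale_right_distrib)

definition Z where "Z = act (disk_poly [:0, 1:])"

lemma clinear_Z: "clinear Z"
  by (simp add: Z_def clinear_act)

lemma norm_Z_le: "norm (Z x) \<le> norm x"
proof -
  have "disk_norm (disk_poly [:0, 1:]) \<le> 1"
    by (rule disk_norm_le) (simp add: disk_fun_poly)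
  then show ?thesis
    using norm_act_le[of "disk_poly [:0, 1:]" x] mult_right_mono[of _ 1 "norm x"]
    by (fastforce simp: Z_def)
qed

lemma act_linear_poly: "act (disk_poly [:- \<omega>, 1:]) x = Z x - \<omega> *\<^sub>C x"
proof -
  have "disk_poly [:- \<omega>, 1:] = disk_poly [:0, 1:] - disk_poly [:\<omega>:]"
    by (simp flip: disk_poly_diff)
  then show ?thesis
    by (simp add: Z_def scale_left_diff_distrib act_const)
qed

text \<open>A continuous linear map that kills every \<open>Z y - z0 *\<^sub>C y\<close> cannot
  distinguish \<open>act \<phi>\<close> from multiplication by \<open>disk_fun \<phi> z0\<close>.
  This is applied to the wandering projection at 0 and to evaluations of the Hardy model.\<close>

lemma act_approx:
  assumes "z0 \<in> \<bbbD>" "0 < \<epsilon>"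
  shows "\<exists>y. norm (act \<phi> x - disk_fun \<phi> z0 *\<^sub>C x - (Z y - z0 *\<^sub>C y)) \<le> \<epsilon>"
proof -
  have pos: "0 < norm x + 1"
    by (simp add: add_nonneg_pos)
  then obtain g where g:
    "disk_norm (\<phi> - disk_poly [:disk_fun \<phi> z0:] - disk_poly [:- z0, 1:] * g) \<le> \<epsilon> / (norm x + 1)"
    using disk_algebra_division[OF assms(1)] assms(2) divide_pos_pos by metis
  have "act \<phi> x - disk_fun \<phi> z0 *\<^sub>C x - (Z (act g x) - z0 *\<^sub>C act g x) =
      act (\<phi> - disk_poly [:disk_fun \<phi> z0:] - disk_poly [:- z0, 1:] * g) x"
    by (simp add: scale_left_diff_distrib act_const flip: act_linear_poly)
  then have "norm (act \<phi> x - disk_fun \<phi> z0 *\<^sub>C x - (Z (act g x) - z0 *\<^sub>C act g x)) \<le>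
      \<epsilon> / (norm x + 1) * norm x"
    using norm_act_le g mult_right_mono[OF g, of "norm x"] by (metis norm_ge_zero order_trans)
  also have "\<dots> \<le> \<epsilon> / (norm x + 1) * (norm x + 1)"
    using assms(2) pos by (intro mult_left_mono) auto
  finally show ?thesis
    using pos by auto
qed

text \<open>The maximal ideal at \<omega> is principal, so its product with the module lies in the
  range of the single operator \<open>Z - \<omega>\<close>.\<close>

lemma semi_fredholm_imp_decomposition:
  assumes "semi_fredholm_at act \<omega>"
  shows "\<exists>F. finite F \<and> (\<forall>x. \<exists>g. \<exists>b\<in>complex_vector.span F. x = (Z g - \<omega> *\<^sub>C g) + b)"
proof -
  have lin: "clinear (\<lambda>g. Z g - \<omega> *\<^sub>C g)"
    unfolding act_linear_poly[symmetric] by (rule clinear_act)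
  have "{act (disk_poly p) f | p f. poly p \<omega> = 0} \<subseteq> range (\<lambda>g. Z g - \<omega> *\<^sub>C g)"
  proof clarify
    fix p f
    assume "poly p \<omega> = 0"
    then obtain q where "p = [:- \<omega>, 1:] * q"
      by (auto simp: poly_eq_0_iff_dvd)
    then have "act (disk_poly p) f = Z (act (disk_poly q) f) - \<omega> *\<^sub>C act (disk_poly q) f"
      by (simp only: disk_poly_mult flip: act_linear_poly scale_scale)
    then show "act (disk_poly p) f \<in> range (\<lambda>g. Z g - \<omega> *\<^sub>C g)"
      by simp
  qed
  then have "ideal_product act \<omega> \<subseteq> range (\<lambda>g. Z g - \<omega> *\<^sub>C g)"
    unfolding ideal_product_def
    using module_hom.subspace_image[OF clinear_module_hom[OF lin]] complex_vector.subspace_UNIV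
    by (intro complex_vector.span_minimal) blast+
  moreover obtain F where F: "finite F"
    "\<And>x. \<exists>b\<in>complex_vector.span F. x - b \<in> ideal_product act \<omega>"
    using assms unfolding semi_fredholm_at_def finite_codim_def by blast
  ultimately have "\<exists>g. \<exists>b\<in>complex_vector.span F. x - b = Z g - \<omega> *\<^sub>C g" for x
    using F(2)[of x] by blast
  then show ?thesis
    using F(1) by (metis diff_add_cancel)
qed

end

section \<open>The tensor product and evaluations on its completion\<close>

lemma disk_tensor_term: "(\<lambda>z. disk_fun \<theta> z *\<^sub>C x) \<in> disk_tensor"
  unfolding disk_tensor_def by (intro CollectI exI[of _ "Suc 0"] exI[of _ "\<lambda>_. \<theta>"] exI[of _ "\<lambda>_. x"]) simp

lemma disk_tensorE:
  assumes "F \<in> disk_tensor"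
  obtains n :: nat and \<theta> x where "F = (\<lambda>z. \<Sum>i<n. disk_fun (\<theta> i) z *\<^sub>C x i)"
  using assms unfolding disk_tensor_def by (elim CollectE exE) (rule that)

lemma disk_tensorI: "(\<lambda>z. \<Sum>i<n::nat. disk_fun (\<theta> i) z *\<^sub>C x i) \<in> disk_tensor"
  unfolding disk_tensor_def by blast

lemma disk_tensor_add:
  assumes "F \<in> disk_tensor" "G \<in> disk_tensor"
  shows "(\<lambda>z. F z + G z) \<in> disk_tensor"
proof -
  have snoc: "(\<lambda>z. H z + disk_fun \<theta> z *\<^sub>C x) \<in> disk_tensor" if H: "H \<in> disk_tensor" for H \<theta> and x :: 'a
  proof -
    obtain n :: nat and \<eta> y where H: "H = (\<lambda>z. \<Sum>i<n. disk_fun (\<eta> i) z *\<^sub>C y i)"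
      by (rule disk_tensorE[OF H]) (rule that)
    have "(\<lambda>z. H z + disk_fun \<theta> z *\<^sub>C x) =
        (\<lambda>z. \<Sum>i<Suc n. disk_fun ((\<eta>(n := \<theta>)) i) z *\<^sub>C ((y(n := x)) i))"
      by (simp add: H)
    also have "\<dots> \<in> disk_tensor"
      by (rule disk_tensorI)
    finally show ?thesis .
  qed
  obtain m :: nat and \<theta> x where G: "G = (\<lambda>z. \<Sum>i<m. disk_fun (\<theta> i) z *\<^sub>C x i)"
    by (rule disk_tensorE[OF assms(2)]) (rule that)
  have "(\<lambda>z. F z + (\<Sum>i<m. disk_fun (\<theta> i) z *\<^sub>C x i)) \<in> disk_tensor" for m
    by (induction m) (auto simp: assms(1) add.assoc[symmetric] intro: snoc)
  then show ?thesis
    by (simp add: G)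
qed

lemma disk_tensor_scaleC:
  assumes "F \<in> disk_tensor"
  shows "(\<lambda>z. c *\<^sub>C F z) \<in> disk_tensor"
proof -
  obtain n :: nat and \<theta> x where F: "F = (\<lambda>z. \<Sum>i<n. disk_fun (\<theta> i) z *\<^sub>C x i)"
    by (rule disk_tensorE[OF assms]) (rule that)
  have "(\<lambda>z. c *\<^sub>C F z) = (\<lambda>z. \<Sum>i<n. disk_fun (\<theta> i) z *\<^sub>C c *\<^sub>C x i)"
    by (simp add: F complex_vector.scale_sum_right scaleC_scaleC mult.commute)
  also have "\<dots> \<in> disk_tensor"
    by (rule disk_tensorI)
  finally show ?thesis .
qed

lemma disk_tensor_mult:
  assumes "F \<in> disk_tensor"
  shows "(\<lambda>z. disk_fun \<phi> z *\<^sub>C F z) \<in> disk_tensor"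
proof -
  obtain n :: nat and \<theta> x where F: "F = (\<lambda>z. \<Sum>i<n. disk_fun (\<theta> i) z *\<^sub>C x i)"
    by (rule disk_tensorE[OF assms]) (rule that)
  have "(\<lambda>z. disk_fun \<phi> z *\<^sub>C F z) = (\<lambda>z. \<Sum>i<n. disk_fun (\<phi> * \<theta> i) z *\<^sub>C x i)"
    by (simp add: F complex_vector.scale_sum_right scaleC_scaleC disk_fun_simps)
  also have "\<dots> \<in> disk_tensor"
    by (rule disk_tensorI)
  finally show ?thesis .
qed

context quasi_free_embedding
begin

text \<open>The factor \<open>disk_fun 1 z\<close> makes the constant vanish off the disk, as
  members of \<open>disk_tensor\<close> must.\<close>

definition const where "const c = (\<lambda>z. disk_fun 1 z *\<^sub>C (c :: 'e))"

lemma const_in_tensor: "const c \<in> disk_tensor"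
  unfolding const_def by (rule disk_tensor_term)

lemma clinear_\<iota>_const: "clinear (\<lambda>c. \<iota> (const c))"
proof (rule clinearI)
  show "\<iota> (const (c + d)) = \<iota> (const c) + \<iota> (const d)" for c d
    using \<iota>_add[OF const_in_tensor const_in_tensor] by (simp add: const_def scaleC.add_right)
  show "\<iota> (const (a *\<^sub>C c)) = a *\<^sub>C \<iota> (const c)" for a c
    using \<iota>_scaleC[OF const_in_tensor] by (simp add: const_def scaleC_scaleC mult.commute)
qed

lemma approximating_sequence:
  obtains F where "\<And>n. F n \<in> disk_tensor" "(\<lambda>n. \<iota> (F n)) \<longlonglongrightarrow> x"
proof -
  have "x \<in> closure (\<iota> ` disk_tensor)"
    using \<iota>_dense by simp
  then obtain y where y: "\<And>n. y n \<in> \<iota> ` disk_tensor" "y \<longlonglongrightarrow> x"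
    unfolding closure_sequential by blast
  then obtain F where "\<And>n. F n \<in> disk_tensor" "\<And>n. y n = \<iota> (F n)"
    unfolding image_iff by metis
  then show ?thesis
    using y(2) that by presburger
qed

text \<open>Injectivity of \<iota> makes evaluation well defined on the dense range, where it is
  Lipschitz and so extends continuously. Linearity and the bound pass along approximating
  sequences.\<close>

lemma evaluation_extends:
  assumes "z \<in> \<bbbD>"
  shows "\<exists>e C. clinear e \<and> (\<forall>x. norm (e x) \<le> C * norm x) \<and> (\<forall>F\<in>disk_tensor. e (\<iota> F) = F z)"
proof -
  obtain C0 where C0: "\<And>F. F \<in> disk_tensor \<Longrightarrow> norm (F z) \<le> C0 * norm (\<iota> F)"
    using eval_bounded[OF assms] by blast
  define C where "C = max C0 0"
  have C: "0 \<le> C" "norm (F z) \<le> C * norm (\<iota> F)" if "F \<in> disk_tensor" for F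
    using C0[OF that] mult_right_mono[of C0 C "norm (\<iota> F)"] by (auto simp: C_def)
  define f where "f x = inv_into disk_tensor \<iota> x z" for x
  have f: "f (\<iota> F) = F z" if "F \<in> disk_tensor" for F
    using that by (simp add: f_def inv_into_f_f[OF \<iota>_inj])
  have "C-lipschitz_on (\<iota> ` disk_tensor) f"
  proof (rule lipschitz_onI)
    fix x y
    assume "x \<in> \<iota> ` disk_tensor" "y \<in> \<iota> ` disk_tensor"
    then obtain F G where F: "F \<in> disk_tensor" "x = \<iota> F" and G: "G \<in> disk_tensor" "y = \<iota> G"
      by blast
    have diff: "(\<lambda>z. F z + (- 1) *\<^sub>C G z) \<in> disk_tensor"
      by (intro disk_tensor_add disk_tensor_scaleC F G)
    have minus: "(- 1) *\<^sub>C u = - u" for u :: "'b::complex_inner"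
      by (simp add: scaleC.minus_left scaleC_one)
    have "\<iota> (\<lambda>z. F z + (- 1) *\<^sub>C G z) = x - y"
      using \<iota>_add[OF F(1) disk_tensor_scaleC[OF G(1)], of "- 1"] \<iota>_scaleC[OF G(1), of "- 1"]
      by (simp add: F G minus)
    then show "dist (f x) (f y) \<le> C * dist x y"
      using C(2)[OF diff] by (simp add: F G f dist_norm minus)
  qed (simp add: C_def)
  then obtain g where g: "continuous_on UNIV g" "\<And>F. F \<in> disk_tensor \<Longrightarrow> g (\<iota> F) = F z"
    using uniformly_continuous_on_extension_on_closure[OF lipschitz_on_uniformly_continuous]
    by (metis \<iota>_dense f image_eqI uniformly_continuous_imp_continuous)
  have lim: "(\<lambda>n. F n z) \<longlonglongrightarrow> g x" if "\<And>n. F n \<in> disk_tensor" "(\<lambda>n. \<iota> (F n)) \<longlonglongrightarrow> x" for F x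
  proof -
    have "(\<lambda>n. g (\<iota> (F n))) \<longlonglongrightarrow> g x"
      using that(2) g(1) by (auto intro: continuous_on_tendsto_compose)
    then show ?thesis
      by (simp add: g(2) that(1))
  qed
  have "clinear g"
  proof (rule clinearI)
    fix x y
    obtain F where F: "\<And>n. F n \<in> disk_tensor" "(\<lambda>n. \<iota> (F n)) \<longlonglongrightarrow> x"
      by (rule approximating_sequence[of x]) (rule that)
    obtain G where G: "\<And>n. G n \<in> disk_tensor" "(\<lambda>n. \<iota> (G n)) \<longlonglongrightarrow> y"
      by (rule approximating_sequence[of y]) (rule that)
    have "(\<lambda>n. \<iota> (\<lambda>z. F n z + G n z)) \<longlonglongrightarrow> x + y"
      using tendsto_add[OF F(2) G(2)] by (simp add: \<iota>_add F G)
    then have "(\<lambda>n. F n z + G n z) \<longlonglongrightarrow> g (x + y)"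
      using lim[of "\<lambda>n z. F n z + G n z"] disk_tensor_add F(1) G(1) by blast
    then show "g (x + y) = g x + g y"
      using tendsto_add[OF lim[OF F] lim[OF G]] LIMSEQ_unique by blast
  next
    fix c x
    obtain F where F: "\<And>n. F n \<in> disk_tensor" "(\<lambda>n. \<iota> (F n)) \<longlonglongrightarrow> x"
      by (rule approximating_sequence[of x]) (rule that)
    have "(\<lambda>n. \<iota> (\<lambda>z. c *\<^sub>C F n z)) \<longlonglongrightarrow> c *\<^sub>C x"
      using scaleC.tendsto[OF tendsto_const F(2), of c] by (simp add: \<iota>_scaleC F)
    then have "(\<lambda>n. c *\<^sub>C F n z) \<longlonglongrightarrow> g (c *\<^sub>C x)"
      using lim[of "\<lambda>n z. c *\<^sub>C F n z"] disk_tensor_scaleC F(1) by blast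
    then show "g (c *\<^sub>C x) = c *\<^sub>C g x"
      using scaleC.tendsto[OF tendsto_const lim[OF F], of c] LIMSEQ_unique by blast
  qed
  moreover have "norm (g x) \<le> C * norm x" for x
  proof -
    obtain F where F: "\<And>n. F n \<in> disk_tensor" "(\<lambda>n. \<iota> (F n)) \<longlonglongrightarrow> x"
      by (rule approximating_sequence[of x]) (rule that)
    show ?thesis
      by (rule LIMSEQ_le[OF tendsto_norm[OF lim[OF F]] tendsto_mult[OF tendsto_const tendsto_norm[OF F(2)]]])
         (auto simp: C F)
  qed
  ultimately show ?thesis
    using g(2) by blast
qed

definition ev where
  "ev z = (SOME e. clinear e \<and> (\<exists>C. \<forall>x. norm (e x) \<le> C * norm x) \<and> (\<forall>F\<in>disk_tensor. e (\<iota> F) = F z))"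

lemma ev:
  assumes "z \<in> \<bbbD>"
  shows "clinear (ev z)" "\<exists>C. \<forall>x. norm (ev z x) \<le> C * norm x" "F \<in> disk_tensor \<Longrightarrow> ev z (\<iota> F) = F z"
proof -
  have "\<exists>e. clinear e \<and> (\<exists>C. \<forall>x. norm (e x) \<le> C * norm x) \<and> (\<forall>F\<in>disk_tensor. e (\<iota> F) = F z)"
    using evaluation_extends[OF assms] by blast
  from someI_ex[OF this]
  show "clinear (ev z)" "\<exists>C. \<forall>x. norm (ev z x) \<le> C * norm x" "F \<in> disk_tensor \<Longrightarrow> ev z (\<iota> F) = F z"
    unfolding ev_def[symmetric] by blast+
qed

lemma bounded_linear_ev: "z \<in> \<bbbD> \<Longrightarrow> bounded_linear (ev z)"
  using ev(1,2) clinear_bounded_linear by blast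

text \<open>Elements of the completion are determined by their values: this is the condition on
  Cauchy sequences, read along an approximating sequence.\<close>

lemma ev_eq_0_imp:
  assumes "\<And>z. z \<in> \<bbbD> \<Longrightarrow> ev z x = 0"
  shows "x = 0"
proof -
  obtain F where F: "\<And>n. F n \<in> disk_tensor" "(\<lambda>n. \<iota> (F n)) \<longlonglongrightarrow> x"
    by (rule approximating_sequence[of x]) (rule that)
  have "(\<lambda>n. F n z) \<longlonglongrightarrow> 0" if "z \<in> \<bbbD>" for z
    using bounded_linear.tendsto[OF bounded_linear_ev[OF that] F(2)] assms that
    by (simp add: ev(3) F(1))
  then have "(\<lambda>n. norm (\<iota> (F n))) \<longlonglongrightarrow> 0"
    using cauchy_eval_iff[OF F(1) LIMSEQ_imp_Cauchy[OF F(2)]] by blast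
  then show ?thesis
    using LIMSEQ_unique[OF F(2)] by (simp add: tendsto_norm_zero_iff)
qed

lemma ev_Z:
  assumes "z \<in> \<bbbD>"
  shows "ev z (Z x) = z *\<^sub>C ev z x"
proof -
  have "closure (\<iota> ` disk_tensor) \<subseteq> {x. ev z (Z x) = z *\<^sub>C ev z x}"
  proof (rule closure_minimal)
    show "\<iota> ` disk_tensor \<subseteq> {x. ev z (Z x) = z *\<^sub>C ev z x}"
    proof clarify
      fix F :: "complex \<Rightarrow> 'e"
      assume F: "F \<in> disk_tensor"
      have "Z (\<iota> F) = \<iota> (\<lambda>z. disk_fun (disk_poly [:0, 1:]) z *\<^sub>C F z)"
        by (simp add: Z_def \<iota>_act F)
      then have "ev z (Z (\<iota> F)) = disk_fun (disk_poly [:0, 1:]) z *\<^sub>C F z"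
        by (simp only: ev(3)[OF assms disk_tensor_mult[OF F]])
      then show "ev z (Z (\<iota> F)) = z *\<^sub>C ev z (\<iota> F)"
        using assms by (simp add: ev(3) F disk_fun_poly)
    qed
    have "bounded_linear Z"
      using clinear_bounded_linear[OF clinear_Z, of 1] norm_Z_le by simp
    then have "bounded_linear (\<lambda>x. ev z (Z x))"
      using bounded_linear_compose[OF bounded_linear_ev[OF assms]] by blast
    moreover have "bounded_linear (\<lambda>x. z *\<^sub>C ev z x)"
      using bounded_linear_compose[OF scaleC.bounded_linear_right bounded_linear_ev[OF assms]] .
    ultimately show "closed {x. ev z (Z x) = z *\<^sub>C ev z x}"
      by (intro closed_Collect_eq linear_continuous_on)
  qed
  then show ?thesis
    using \<iota>_dense by blast
qed

text \<open>If \<open>x = (Z ^^ n) y\<close>, isometry gives \<open>y\<close> the norm of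
  \<open>x\<close>, while evaluation at \<open>z\<close> gains the factor \<open>z ^ n\<close>. As
  this holds for all \<open>n\<close>, every value of \<open>x\<close> vanishes.\<close>

lemma Z_pure:
  assumes iso: "\<And>x. norm (Z x) = norm x"
  shows "(\<Inter>j. range (Z ^^ j)) = {0}"
proof -
  have "x = 0" if x: "\<And>j. x \<in> range (Z ^^ j)" for x
  proof (rule ev_eq_0_imp)
    fix z :: complex
    assume z: "z \<in> \<bbbD>"
    obtain C where C: "\<And>x. norm (ev z x) \<le> C * norm x"
      using ev(2)[OF z] by blast
    have "norm (ev z x) \<le> cmod z ^ n * (C * norm x)" for n
    proof -
      obtain y where y: "x = (Z ^^ n) y"
        using x[of n] by blast
      have "norm ((Z ^^ n) y) = norm y" "ev z ((Z ^^ n) y) = z ^ n *\<^sub>C ev z y"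
        by (induction n) (simp_all add: iso ev_Z[OF z] scaleC_scaleC scaleC_one)
      then show ?thesis
        using C[of y] by (simp add: y norm_scaleC norm_power mult_left_mono)
    qed
    moreover have "(\<lambda>n. cmod z ^ n * (C * norm x)) \<longlonglongrightarrow> 0"
      using z by (intro tendsto_mult_left_zero LIMSEQ_realpow_zero) auto
    ultimately have "norm (ev z x) \<le> 0"
      by (intro LIMSEQ_le_const) auto
    then show "ev z x = 0"
      by simp
  qed
  moreover have "0 \<in> range (Z ^^ j)" for j
  proof -
    have "(Z ^^ j) 0 = 0"
      by (induction j) (simp_all add: clinear_0[OF clinear_Z])
    then show ?thesis
      using range_eqI[of 0 "Z ^^ j" 0] by simp
  qed
  ultimately show ?thesis
    by auto
qed

end

theorem theorem2:
  fixes act :: "disk_algebra \<Rightarrow> 'm \<Rightarrow> 'm::{complex_inner, polish_space}"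
  assumes "quasi_free act TYPE(complex ^ 'k)"
    and "\<And>\<omega>. \<omega> \<in> \<bbbD> \<Longrightarrow> semi_fredholm_at act \<omega>"
    and "\<exists>U. isometric_module_map act U \<and> (\<Inter>j. range (U ^^ j)) = {0} \<and> finite_codim (range U)"
  shows "\<exists>V :: 'm \<Rightarrow> complex \<Rightarrow> complex ^ 'k. unitary_module_map_hardy act V"
proof -
  obtain \<iota> :: "(complex \<Rightarrow> complex ^ 'k) \<Rightarrow> 'm" where "quasi_free_embedding act \<iota>"
    using assms(1) unfolding quasi_free_def by blast
  then interpret quasi_free_embedding act \<iota> .
  obtain U where U: "module_hom act act U" "\<And>x. norm (U x) = norm x"
      "(\<Inter>j. range (U ^^ j)) = {0}" "finite_codim (range U)"
    using assms(3) unfolding isometric_module_map_def by blast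
  have U_lin: "clinear U"
  proof (rule clinearI)
    show "U (c *\<^sub>C x) = c *\<^sub>C U x" for c x
      using module_hom.scale[OF U(1), of "disk_poly [:c:]" x] by (simp add: act_const)
  qed (rule module_hom.add[OF U(1)])
  obtain Us where Us: "clinear Us" "\<And>x. norm (Us x) \<le> norm x" "\<And>x y. cinner (U x) y = cinner x (Us y)"
    by (rule adjoint_exists[OF U_lin]) (simp_all add: U(2) that)
  obtain Zs where Zs: "clinear Zs" "\<And>x. norm (Zs x) \<le> norm x" "\<And>x y. cinner (Z x) y = cinner x (Zs y)"
    by (rule adjoint_exists[OF clinear_Z norm_Z_le]) (rule that)
  obtain B where B: "finite B" "\<And>x. \<exists>b\<in>complex_vector.span B. x - b \<in> range U"
    using U(4) unfolding finite_codim_def by blast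
  have UZ: "U (Z x) = Z (U x)" for x
    by (simp add: Z_def module_hom.scale[OF U(1)])
  have iso: "norm (Z x) = norm x" for x
  proof -
    interpret commuting_contraction U Us Z Zs B
      by (intro commuting_contraction.intro pure_isometry.intro commuting_contraction_axioms.intro)
         (rule U_lin U(2,3) Us clinear_Z norm_Z_le Zs UZ B semi_fredholm_imp_decomposition assms(2) |
          assumption)+
    show ?thesis
      by (rule Z_isometric)
  qed
  interpret Z: pure_isometry Z Zs
    by (rule pure_isometry.intro) (rule clinear_Z iso Zs Z_pure[OF iso])+
  have 0: "(0 :: complex) \<in> \<bbbD>"
    by simp
  \<comment> \<open>\<open>T\<close> will identify the fibre over 0 with the wandering subspace of
    \<open>Z\<close>; this is how its dimension becomes the rank.\<close>
  define T where "T c = Z.P (\<iota> (const c))" for c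
  have T: "clinear T"
    unfolding T_def
    by (rule clinearI) (simp_all add: clinear_add[OF Z.P] clinear_scaleC[OF Z.P]
        clinear_add[OF clinear_\<iota>_const] clinear_scaleC[OF clinear_\<iota>_const])
  have ev0_const: "ev 0 (\<iota> (const c)) = c" for c
  proof -
    have "ev 0 (\<iota> (const c)) = disk_fun 1 0 *\<^sub>C c"
      by (simp add: ev(3) const_in_tensor) (simp add: const_def)
    then show ?thesis
      by (simp add: one_disk_algebra.rep_eq on_disk_def scaleC_one)
  qed
  have "inj T"
  proof (rule injI)
    fix c d
    assume "T c = T d"
    \<comment> \<open>Equal projections put the difference of the constants into the range of
      \<open>Z\<close>, where evaluation at 0 vanishes.\<close>
    then have "\<iota> (const c) - \<iota> (const d) = Z (Zs (\<iota> (const c) - \<iota> (const d)))"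
      by (simp add: T_def Z.P_def clinear_diff[OF clinear_Z] clinear_diff[OF Zs(1)] algebra_simps)
    then have "ev 0 (\<iota> (const c) - \<iota> (const d)) = 0"
      by (metis 0 ev_Z scaleC.zero_left)
    then show "c = d"
      by (simp add: clinear_diff[OF ev(1)[OF 0]] ev0_const)
  qed
  \<comment> \<open>The projection depends only on the value at 0. Wandering vectors are fixed by it
    and hence lie in the range of \<open>T\<close>.\<close>
  have P_eq: "Z.P x = T (ev 0 x)" for x
  proof -
    have bl_P: "bounded_linear Z.P"
      unfolding Z.P_def [abs_def]
      by (intro bounded_linear_sub bounded_linear_ident bounded_linear_compose[OF Z.bounded_linear_U Z.bounded_linear_Us])
    \<comment> \<open>\<open>Z.P\<close> is a contraction vanishing on the range of
      \<open>Z\<close>, so approximate division at 0 applies with arbitrarily small error.\<close>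
    have P_act: "Z.P (act \<phi> x) = disk_fun \<phi> 0 *\<^sub>C Z.P x" for \<phi> x
    proof -
      have "norm (Z.P (act \<phi> x - disk_fun \<phi> 0 *\<^sub>C x)) \<le> \<epsilon>" if \<epsilon>: "0 < \<epsilon>" for \<epsilon>
      proof -
        obtain y where y: "norm (act \<phi> x - disk_fun \<phi> 0 *\<^sub>C x - (Z y - 0 *\<^sub>C y)) \<le> \<epsilon>"
          using act_approx[OF 0 \<epsilon>] by blast
        have "Z.P (act \<phi> x - disk_fun \<phi> 0 *\<^sub>C x) = Z.P (act \<phi> x - disk_fun \<phi> 0 *\<^sub>C x - (Z y - 0 *\<^sub>C y))"
          by (simp add: clinear_diff[OF Z.P] scaleC.zero_left)
        moreover have "norm (Z.P u) \<le> norm u" for u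
          using Z.norm_P[of u] by (simp add: power2_le_imp_le)
        ultimately show ?thesis
          using y order_trans by fastforce
      qed
      then have "norm (Z.P (act \<phi> x - disk_fun \<phi> 0 *\<^sub>C x)) \<le> 0"
        by (rule field_le_epsilon[where y = 0, simplified])
      then show ?thesis
        by (simp add: clinear_diff[OF Z.P] clinear_scaleC[OF Z.P])
    qed
    have P_tensor: "Z.P (\<iota> F) = T (F 0)" if F: "F \<in> disk_tensor" for F
    proof -
      obtain n :: nat and \<theta> c where F_eq: "F = (\<lambda>z. \<Sum>i<n. disk_fun (\<theta> i) z *\<^sub>C c i)"
        by (rule disk_tensorE[OF F]) (rule that)
      define G where "G m z = (\<Sum>i<m. disk_fun (\<theta> i) z *\<^sub>C c i)" for m :: nat and z
      have G: "G m \<in> disk_tensor" for m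
        unfolding G_def by (rule disk_tensorI)
      have term_eq: "\<iota> (\<lambda>z. disk_fun \<phi> z *\<^sub>C d) = act \<phi> (\<iota> (const d))" for \<phi> d
      proof -
        have "(\<lambda>z. disk_fun \<phi> z *\<^sub>C const d z) = (\<lambda>z. disk_fun (\<phi> * 1) z *\<^sub>C d)"
          by (simp only: const_def scaleC_scaleC disk_fun_simps)
        then show ?thesis
          using \<iota>_act[OF const_in_tensor, of \<phi> d] by simp
      qed
      have "Z.P (\<iota> (G m)) = T (G m 0)" for m
      proof (induction m)
        case 0
        have "\<iota> (\<lambda>z. 0 *\<^sub>C G 0 z) = 0 *\<^sub>C \<iota> (G 0)"
          by (rule \<iota>_scaleC[OF G])
        then have "\<iota> (G 0) = 0"
          by (simp add: G_def [abs_def] scaleC.zero_left)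
        moreover have "G 0 0 = 0"
          by (simp add: G_def)
        ultimately show ?case
          by (simp add: clinear_0[OF T] clinear_0[OF Z.P])
      next
        case (Suc m)
        have "\<iota> (G (Suc m)) = \<iota> (G m) + act (\<theta> m) (\<iota> (const (c m)))"
          using \<iota>_add[OF G[of m] disk_tensor_term[of "\<theta> m" "c m"]]
          by (simp add: G_def [abs_def] term_eq)
        moreover have "G (Suc m) 0 = G m 0 + disk_fun (\<theta> m) 0 *\<^sub>C c m"
          by (simp add: G_def)
        ultimately show ?case
          by (simp add: Suc clinear_add[OF Z.P] P_act clinear_add[OF T] clinear_scaleC[OF T] flip: T_def)
      qed
      then show ?thesis
        by (simp add: F_eq G_def [abs_def])
    qed
    \<comment> \<open>\<open>T\<close> has a finite-dimensional domain, so linearity already makes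
      it continuous.\<close>
    have "linear T"
      using clinear_add[OF T] clinear_scaleC[OF T, of "of_real _"]
      by (intro linearI) (simp_all add: scaleC_of_real)
    then have bl_T: "bounded_linear T"
      by (simp add: linear_conv_bounded_linear)
    obtain F where F: "\<And>n. F n \<in> disk_tensor" "(\<lambda>n. \<iota> (F n)) \<longlonglongrightarrow> x"
      by (rule approximating_sequence[of x]) (rule that)
    have "(\<lambda>n. T (ev 0 (\<iota> (F n)))) \<longlonglongrightarrow> T (ev 0 x)"
      by (intro bounded_linear.tendsto[OF bl_T] bounded_linear.tendsto[OF bounded_linear_ev] F 0)
    moreover have "(\<lambda>n. Z.P (\<iota> (F n))) \<longlonglongrightarrow> Z.P x"
      by (intro bounded_linear.tendsto[OF bl_P] F)
    ultimately show ?thesis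
      using LIMSEQ_unique by (simp add: P_tensor ev(3) F(1))
  qed
  obtain h :: "'k \<Rightarrow> 'm" where h: "\<And>i. h i \<in> range T"
    "\<And>i j. cinner (h i) (h j) = (if i = j then 1 else 0)"
    "\<And>w. w \<in> range T \<Longrightarrow> w = (\<Sum>i\<in>UNIV. cinner w (h i) *\<^sub>C h i)"
    using finite_dim_orthonormal_basis[OF T \<open>inj T\<close>] by blast
  interpret hardy_model Z Zs h
  proof
    show "Zs (h i) = 0" for i
      using h(1)[of i] by (auto simp: T_def)
    show "w = (\<Sum>i\<in>UNIV. cinner w (h i) *\<^sub>C h i)" if "Zs w = 0" for w
      using P_eq[of w] Z.P_wandering[OF that] by (intro h(3)) (metis rangeI)
  qed (rule h(2))
  \<comment> \<open>Evaluation of the model at \<open>z\<close> kills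
    \<open>Z y - z *\<^sub>C y\<close> by \<open>V_U\<close>. The tolerance
    \<open>\<epsilon> * (1 - cmod z)\<close> below compensates the constant in
    \<open>norm_V_le\<close>.\<close>
  have "V (act \<phi> x) z = disk_fun \<phi> z *\<^sub>C V x z" for \<phi> x z
  proof (cases "z \<in> \<bbbD>")
    case True
    have "norm (V (act \<phi> x - disk_fun \<phi> z *\<^sub>C x) z) \<le> \<epsilon>" if \<epsilon>: "0 < \<epsilon>" for \<epsilon>
    proof -
      have z: "0 < 1 - cmod z"
        using True by simp
      then obtain y where y: "norm (act \<phi> x - disk_fun \<phi> z *\<^sub>C x - (Z y - z *\<^sub>C y)) \<le> \<epsilon> * (1 - cmod z)"
        using act_approx[OF True] \<epsilon> mult_pos_pos by metis
      have "V (act \<phi> x - disk_fun \<phi> z *\<^sub>C x) z = V (act \<phi> x - disk_fun \<phi> z *\<^sub>C x - (Z y - z *\<^sub>C y)) z"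
        by (simp add: clinear_diff[OF clinear_V] V_scaleC V_U)
      then show ?thesis
        using norm_V_le[OF True] y z by (metis order_trans pos_divide_le_eq)
    qed
    then have "norm (V (act \<phi> x - disk_fun \<phi> z *\<^sub>C x) z) \<le> 0"
      by (rule field_le_epsilon[where y = 0, simplified])
    then show ?thesis
      by (simp add: clinear_diff[OF clinear_V] V_scaleC)
  qed (simp add: V_def scaleC.zero_right)
  then have "unitary_module_map_hardy act V"
    unfolding unitary_module_map_hardy_def bij_betw_def
    by (simp add: inj_V range_V hardy_cinner_V V_add fun_eq_iff)
  then show ?thesis
    by blast
qed

end
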